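(* Let $d\ge 2$ and let $B\subset\mathbb{R}^d$ be a bounded open set whose boundary $\partial B$ is a $C^1$ hypersurface, with $n(Q)$ denoting the unit normal to $\partial B$ at $Q\in\partial B$. Suppose that $\partial B$ can be decomposed into finitely many neighborhoods, i.e. $\partial B=U_1\cup\dots\cup U_N$ with each $U_j$ relatively open in $\partial B$, and that there is a constant $C_0>0$ such that for every $j$ and every pair of points $P,Q\in U_j$, $$\left|(P-Q)\cdot n(Q)\right|\le C_0\,|P-Q|^{3/2}.$$ Then there exists a constant $C>0$, independent of $R$ (it may depend on $B$ and $d$), such that for all $R>0$ $$\int_{S^{d-1}} \left|\widehat{\chi}_B(R\omega)\right|^2\, d\omega \;\le\; C\, R^{-(d+1)}.$$
   Context: $\chi_B$ denotes the characteristic (indicator) function of $B$. The Fourier transform is $\hat f(\xi)=\int_{\mathbb{R}^d} e^{-i x\cdot \xi} f(x)\,dx$. $S^{d-1}$ is the unit sphere in $\mathbb{R}^d$ and $d\omega$ is its surface measure. That $\partial B$ is a $C^1$ hypersurface means that near each of its points $\partial B$ is, after a rotation of coordinates, the graph of a $C^1$ function of $d-1$ variables; the unit normal $n(Q)$ is determined up to sign, which does not affect the hypothesis. *)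

theory Defs
  imports "HOL-Analysis.Analysis"
begin

definition fourier :: "('a::euclidean_space \<Rightarrow> complex) \<Rightarrow> 'a \<Rightarrow> complex" where
  "fourier f \<xi> = (LINT x|lebesgue. exp (- (\<i> * complex_of_real (x \<bullet> \<xi>))) * f x)"

(* The surface measure of the unit sphere is the unique measure satisfying the polar coordinate
   formula dx = r^(d-1) dr d\<omega>.  On A it is d times the volume of the cone
   {r \<omega> | 0 < r < 1, \<omega> \<in> A}; see emeasure_sphere_measure. *)
definition sphere_measure :: "'a::euclidean_space measure" where
  "sphere_measure = scale_measure (ennreal (real DIM('a)))
     (distr (restrict_space lborel (ball 0 1 - {0})) (restrict_space borel (sphere 0 1))
        (\<lambda>x. x /\<^sub>R norm x))"

lemma sets_sphere_measure [simp]: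
  "sets (sphere_measure :: 'a::euclidean_space measure) = sets (restrict_space borel (sphere 0 1))"
  by (simp add: sphere_measure_def)

lemma space_sphere_measure [simp]:
  "space (sphere_measure :: 'a::euclidean_space measure) = sphere 0 1"
  using sets_eq_imp_space_eq[OF sets_sphere_measure] by (simp add: space_restrict_space)

lemma emeasure_sphere_measure:
  fixes A :: "'a::euclidean_space set"
  assumes "A \<in> sets borel" "A \<subseteq> sphere 0 1"
  shows "emeasure sphere_measure A =
    ennreal (real DIM('a)) * emeasure lborel {r *\<^sub>R \<omega> | r \<omega>. 0 < r \<and> r < 1 \<and> \<omega> \<in> A}"
proof -
  let ?M = "restrict_space lborel (ball 0 1 - {0::'a})"
  let ?N = "restrict_space borel (sphere 0 (1::real)) :: 'a measure"
  have "(\<lambda>x::'a. x /\<^sub>R norm x) \<in> borel_measurable ?M"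
    by (rule measurable_restrict_space1) simp
  moreover have "(\<lambda>x::'a. x /\<^sub>R norm x) \<in> space ?M \<rightarrow> sphere 0 1"
    by (auto simp: space_restrict_space)
  ultimately have meas: "(\<lambda>x::'a. x /\<^sub>R norm x) \<in> measurable ?M ?N"
    by (intro measurable_restrict_space2) auto
  have A: "A \<in> sets ?N"
    using assms by (auto simp: sets_restrict_space_iff)
  have cone: "(\<lambda>x. x /\<^sub>R norm x) -` A \<inter> space ?M = {r *\<^sub>R \<omega> | r \<omega>. 0 < r \<and> r < 1 \<and> \<omega> \<in> A}"
    (is "?L = ?R")
  proof
    show "?L \<subseteq> ?R"
    proof
      fix x assume x: "x \<in> ?L"
      then have "x = norm x *\<^sub>R (x /\<^sub>R norm x)" "0 < norm x" "norm x < 1" "x /\<^sub>R norm x \<in> A"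
        by (auto simp: space_restrict_space)
      then show "x \<in> ?R" by blast
    qed
    show "?R \<subseteq> ?L"
      using assms(2) by (auto simp: space_restrict_space subset_iff)
  qed
  have "emeasure (distr ?M ?N (\<lambda>x. x /\<^sub>R norm x)) A = emeasure ?M ?R"
    using emeasure_distr[OF meas A] cone by simp
  also have "\<dots> = emeasure lborel ?R"
    using cone by (intro emeasure_restrict_space) (auto simp: space_restrict_space)
  finally show ?thesis
    by (simp add: sphere_measure_def emeasure_scale_measure)
qed

definition C1_function_on :: "('a::euclidean_space \<Rightarrow> real) \<Rightarrow> 'a set \<Rightarrow> bool" where
  "C1_function_on g V \<longleftrightarrow> (\<exists>G. (\<forall>y\<in>V. GDERIV g y :> G y) \<and> continuous_on V G)"

(* Rotating coordinates amounts to choosing the unit vector e of the vertical axis; the d - 1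
   horizontal coordinates of x are x - (x \<bullet> e) e, which lies in the hyperplane orthogonal to e.
   Only the values of g on that hyperplane matter; a C1 function of d - 1 variables is
   identified with its extension that is constant in the direction e. *)
definition C1_hypersurface :: "'a::euclidean_space set \<Rightarrow> bool" where
  "C1_hypersurface S \<longleftrightarrow>
     (\<forall>Q\<in>S. \<exists>e W V g. norm e = 1 \<and> open W \<and> Q \<in> W \<and> open V \<and> C1_function_on g V \<and>
        (\<forall>x\<in>W. x - (x \<bullet> e) *\<^sub>R e \<in> V) \<and>
        S \<inter> W = {x \<in> W. x \<bullet> e = g (x - (x \<bullet> e) *\<^sub>R e)})"

definition tangent_vector :: "'a::euclidean_space set \<Rightarrow> 'a \<Rightarrow> 'a \<Rightarrow> bool" where
  "tangent_vector S Q v \<longleftrightarrow>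
     (\<exists>\<gamma> \<epsilon>. \<epsilon> > 0 \<and> \<gamma> 0 = Q \<and> (\<forall>t. \<bar>t\<bar> < \<epsilon> \<longrightarrow> \<gamma> t \<in> S) \<and>
        (\<gamma> has_vector_derivative v) (at (0::real)))"

definition unit_normal :: "'a::euclidean_space set \<Rightarrow> 'a \<Rightarrow> 'a \<Rightarrow> bool" where
  "unit_normal S Q \<nu> \<longleftrightarrow> norm \<nu> = 1 \<and> (\<forall>v. tangent_vector S Q v \<longrightarrow> v \<bullet> \<nu> = 0)"

end

theory Submission
  imports Defs "HOL-Probability.Characteristic_Functions"
begin

text \<open>
  Let \<open>\<chi>\<close> be the indicator function of the set and \<open>h = e\<^sub>i / R\<close>. Where \<open>|\<omega>\<^sub>i| \<ge> d\<^sup>-\<^sup>1\<^sup>/\<^sup>2\<close>, the transform of \<open>\<chi>\<close> at \<open>R \<omega>\<close> is controlled by that of the second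
  difference \<open>\<Delta>\<^sub>h\<^sup>2 \<chi>\<close>, which lives in a layer of width \<open>O(1/R)\<close> around the boundary. Cut the layer into pieces
  \<open>G\<close> on which the boundary is the zero set of a function \<open>F\<close> with gradient close to a unit vector \<open>n\<close>.

  The basic tool is the trace inequality
  \<open>\<integral>\<^bsub>S\<^esub> |H^(R \<omega>)|\<^sup>2 d\<omega> \<le> C R\<^bsup>1-d\<^esup> \<integral> |H|\<^sup>2\<close> for \<open>H\<close> supported in a fixed ball. It is dual to an \<open>L\<^sup>2\<close> bound on balls for the
  solutions \<open>u = \<integral>\<^bsub>S\<^esub> a(\<omega>) exp(i R \<omega> \<bullet> x) d\<omega>\<close> of the Helmholtz equation.

  For \<open>|\<omega> \<bullet> n| \<ge> 1/2\<close> one gains a factor \<open>1/R\<close>: \<open>\<integral> |u|\<^sup>2\<close> over the layer is \<open>O(1/R)\<close> times the bound on a ball.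
  The Rellich identity with multiplier \<open>\<partial>\<^sub>n u\<close> bounds the layer integral of \<open>|u|\<^sup>2\<close> by that of \<open>|\<nabla>' u|\<^sup>2 / R\<^sup>2\<close>, where \<open>\<nabla>'\<close> is the
  part of the gradient orthogonal to \<open>n\<close>, plus an acceptable term. As \<open>\<nabla>' / R\<close> multiplies \<open>a\<close> by
  \<open>\<omega> - (\<omega> \<bullet> n) n\<close>, of squared length at most \<open>3/4\<close>, the best constant of the layer bound is at most a fraction of itself
  plus an acceptable term. This part only uses that the boundary is \<open>C\<^sup>1\<close>.

  For \<open>|\<omega> \<bullet> n| < 1/2\<close> there is a vector \<open>q\<close> transversal to the boundary with \<open>|\<omega> \<bullet> q| \<le> 1/R\<close>. For such \<open>\<omega>\<close> the transform of \<open>G\<close> at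
  \<open>R \<omega>\<close> is comparable with that of the (weighted) X-ray transform of \<open>G\<close> in the direction \<open>q\<close>. The
  latter is a second difference of the parameters at which parallel lines hit the boundary, hence \<open>O(R\<^bsup>-3/2\<^esup>)\<close> by the
  hypothesis on the normal, and the trace inequality gives \<open>O(R\<^bsup>1-d\<^esup> R\<^sup>-\<^sup>3)\<close>. It remains to sum over the \<open>O(R)\<close>
  vectors \<open>q\<close> that are needed.
\<close>

section \<open>Fourier transform and Plancherel's inequality\<close>

text \<open>The trace inequality alone falls one power of R short: a bounded function on a layer of
  volume O(1/R) has \<open>energy\<close> O(1/R), which yields only R^(-d). Both halves of the
  frequency sphere must gain a further factor 1/R, and they do so for different reasons.

  In the transversal half, a bound by a fraction of itself says something only if the best constant
  is known to be finite; a crude bound, worse by a factor R, supplies this. Absorption succeeds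
  because the gradient of F deviates from n by at most 1/20, which turns the fraction 3/4 into 69/76
  < 1.

  In the tangential half the exponent 3/2 is exactly what the number of directions allows. Second
  differences are essential: the crossing parameters of neighbouring parallel lines differ by
  O(1/R), and a first difference would retain this size. In a second difference the shift h cancels,
  and what is left is the normal component of two chords of length O(1/R) issuing from a common
  boundary point.\<close>

lemma fubini_kernel:
  fixes f :: "'a \<Rightarrow> complex" and g :: "'b \<Rightarrow> complex"
      and k :: "'a \<Rightarrow> 'b \<Rightarrow> complex"
  assumes "sigma_finite_measure M" "sigma_finite_measure N"
    and f: "integrable M f" and g: "integrable N g"
    and k [measurable]: "(\<lambda>(x, y). k x y) \<in> borel_measurable (M \<Otimes>\<^sub>M N)"
    and bnd: "\<And>x y. cmod (k x y) \<le> K"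
  shows "(LINT x|M. f x * (LINT y|N. k x y * g y)) = (LINT y|N. g y * (LINT x|M. k x y * f x))"
proof -
  interpret M: sigma_finite_measure M by fact
  interpret N: sigma_finite_measure N by fact
  interpret pair_sigma_finite M N ..
  have [measurable]: "f \<in> borel_measurable M" "g \<in> borel_measurable N"
    using f g by auto
  have "integrable (M \<Otimes>\<^sub>M N) (\<lambda>(x, y). f x * g y)"
    by (rule Fubini_integrable) (use f g in \<open>auto simp: norm_mult integrable_norm\<close>)
  then have "integrable (M \<Otimes>\<^sub>M N) (\<lambda>z. K *\<^sub>R (f (fst z) * g (snd z)))"
    by (simp add: case_prod_beta')
  then have int: "integrable (M \<Otimes>\<^sub>M N) (\<lambda>(x, y). f x * (k x y * g y))"
  proof (rule Bochner_Integration.integrable_bound)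
    have "0 \<le> K" using norm_ge_zero bnd order_trans by blast
    then show "AE z in M \<Otimes>\<^sub>M N. norm (case z of (x, y) \<Rightarrow> f x * (k x y * g y))
        \<le> norm (K *\<^sub>R (f (fst z) * g (snd z)))"
    proof (intro AE_I2)
      fix z
      have "cmod (f (fst z) * g (snd z)) * cmod (k (fst z) (snd z)) \<le> cmod (f (fst z) * g (snd z)) * K"
        by (intro mult_left_mono bnd) simp
      then show "norm (case z of (x, y) \<Rightarrow> f x * (k x y * g y))
          \<le> norm (K *\<^sub>R (f (fst z) * g (snd z)))"
        using \<open>0 \<le> K\<close> by (simp add: case_prod_beta' norm_mult mult_ac)
    qed
  qed simp
  have "(LINT x|M. f x * (LINT y|N. k x y * g y)) = (LINT x|M. (LINT y|N. f x * (k x y * g y)))"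
    by simp
  also have "\<dots> = (LINT y|N. (LINT x|M. f x * (k x y * g y)))"
    using Fubini_integral[OF int] by simp
  also have "\<dots> = (LINT y|N. g y * (LINT x|M. k x y * f x))"
  proof (rule Bochner_Integration.integral_cong)
    show "(LINT x|M. f x * (k x y * g y)) = g y * (LINT x|M. k x y * f x)" for y
      by (subst integral_mult_right_zero[symmetric]) (simp add: mult_ac)
  qed simp
  finally show ?thesis .
qed

lemma lborel_integral_prod:
  fixes f :: "'a::euclidean_space \<Rightarrow> real \<Rightarrow> complex"
  assumes f: "\<And>b. b \<in> Basis \<Longrightarrow> integrable lborel (f b)"
  shows "(LINT x|lborel. (\<Prod>b\<in>Basis. f b (x \<bullet> b))) = (\<Prod>b\<in>Basis. LINT t|lborel. f b t)"
proof -
  interpret product_sigma_finite "\<lambda>b::'a. lborel :: real measure" ..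
  have [measurable]: "b \<in> Basis \<Longrightarrow> f b \<in> borel_measurable borel" for b
    using borel_measurable_integrable[OF f] by simp
  have "(LINT x|lborel. (\<Prod>b\<in>Basis. f b (x \<bullet> b)))
      = (LINT x|(\<Pi>\<^sub>M b\<in>(Basis :: 'a set). (lborel :: real measure)). (\<Prod>b\<in>Basis. f b ((\<Sum>c\<in>Basis. x c *\<^sub>R c) \<bullet> b)))"
    unfolding lborel_def[where 'a='a] lborel_eq_real[symmetric]
    by (subst integral_distr) auto
  also have "\<dots> = (LINT x|(\<Pi>\<^sub>M b\<in>(Basis :: 'a set). (lborel :: real measure)). (\<Prod>b\<in>Basis. f b (x b)))"
    by (intro Bochner_Integration.integral_cong prod.cong) auto
  also have "\<dots> = (\<Prod>b\<in>Basis. LINT t|lborel. f b t)"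
    by (rule product_integral_prod) (auto intro: f)
  finally show ?thesis .
qed

lemma nn_integral_lborel_scale:
  fixes F :: "'a::euclidean_space \<Rightarrow> ennreal"
  assumes [measurable]: "F \<in> borel_measurable borel" and l: "l > 0"
  shows "(\<integral>\<^sup>+x. F x \<partial>lborel) = ennreal (l ^ DIM('a))
      * (\<integral>\<^sup>+x. F (l *\<^sub>R x) \<partial>lborel)"
proof -
  have "(\<integral>\<^sup>+x. F x \<partial>lborel)
      = (\<integral>\<^sup>+x. F x \<partial>(density (distr lborel borel (\<lambda>x. 0
      + l *\<^sub>R x)) (\<lambda>_. ennreal (\<bar>l\<bar> ^ DIM('a)))))"
    using l by (subst lborel_affine[symmetric]) auto
  also have "\<dots> = ennreal (l ^ DIM('a)) * (\<integral>\<^sup>+x. F (l *\<^sub>R x) \<partial>lborel)"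
    using l by (simp add: nn_integral_density nn_integral_distr nn_integral_cmult)
  finally show ?thesis .
qed

text \<open>The transform with respect to \<open>lborel\<close>, with \<open>cis\<close> in place of
  the exponential. \<open>fourier_eq_ft\<close> identifies it with \<open>fourier\<close> on Borel
  functions.\<close>

definition ft :: "('a::euclidean_space \<Rightarrow> complex) \<Rightarrow> 'a \<Rightarrow> complex" where
  "ft f \<xi> = (LINT x|lborel. cis (- (x \<bullet> \<xi>)) * f x)"

abbreviation energy :: "('a::euclidean_space \<Rightarrow> complex) \<Rightarrow> ennreal" where
  "energy H \<equiv> \<integral>\<^sup>+x. ennreal ((cmod (H x))\<^sup>2) \<partial>lborel"

abbreviation sphere_energy :: "real \<Rightarrow> ('a::euclidean_space \<Rightarrow> complex) \<Rightarrow> ennreal" where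
  "sphere_energy R H \<equiv> \<integral>\<^sup>+\<omega>. ennreal ((cmod (ft H (R *\<^sub>R \<omega>)))\<^sup>2) \<partial>sphere_measure"

lemma measurable_cis [measurable]: "cis \<in> borel_measurable borel"
  by (intro borel_measurable_continuous_onI continuous_intros)

lemma cmod_ft_le: "cmod (ft f \<xi>) \<le> (LINT x|lborel. cmod (f x))"
  unfolding ft_def using integral_norm_bound[of lborel "\<lambda>x. cis (- (x \<bullet> \<xi>)) * f x"]
  by (simp add: norm_mult)

lemma measurable_ft [measurable]:
  assumes [measurable]: "f \<in> borel_measurable borel"
  shows "ft f \<in> borel_measurable borel"
proof -
  have "(\<lambda>\<xi>. LINT x|lborel. cis (- (x \<bullet> \<xi>)) * f x) \<in> borel_measurable borel"
    by (rule sigma_finite_measure.borel_measurable_lebesgue_integral) (auto intro: lborel.sigma_finite_measure_axioms)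
  then show ?thesis by (simp add: ft_def[abs_def])
qed

text \<open>Read off from the characteristic function of the standard normal distribution, whose
  density is the Gaussian divided by sqrt (2 pi).\<close>

lemma gaussian_fourier_1d:
  shows "integrable lborel (\<lambda>x. cis (t * x) * complex_of_real (exp (- x\<^sup>2 / 2)))" (is ?I)
    and "(LINT x|lborel. cis (t * x) * complex_of_real (exp (- x\<^sup>2 / 2)))
        = complex_of_real (sqrt (2 * pi) * exp (- t\<^sup>2 / 2))" (is ?E)
proof -
  have eq: "complex_of_real (exp (- x\<^sup>2 / 2))
      = complex_of_real (sqrt (2 * pi)) * complex_of_real (std_normal_density x)" for x
    unfolding std_normal_density_def of_real_mult[symmetric] by simp
  have "integrable lborel (\<lambda>x. complex_of_real (std_normal_density x))"
    by (simp add: integrable_of_real integrable_normal_density)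
  then have 1: "integrable lborel (\<lambda>x. cis (t * x) * complex_of_real (std_normal_density x))"
    by (rule Bochner_Integration.integrable_bound) (auto simp: norm_mult)
  have 2: "(LINT x|lborel. cis (t * x) * complex_of_real (std_normal_density x))
      = complex_of_real (exp (- t\<^sup>2 / 2))"
  proof -
    have "char std_normal_distribution t = (LINT x|lborel. cis (t * x) * complex_of_real (std_normal_density x))"
      unfolding char_def
      by (subst integral_density) (auto simp: scaleR_conv_of_real mult_ac cis_conv_exp)
    then show ?thesis
      by (simp add: char_std_normal_distribution)
  qed
  show ?I
    using integrable_mult_right[OF 1, of "complex_of_real (sqrt (2 * pi))"] unfolding eq by (simp add: mult_ac)
  show ?E
  proof -
    have "(LINT x|lborel. cis (t * x) * (complex_of_real (sqrt (2 * pi)) * complex_of_real (std_normal_density x)))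
      = (LINT x|lborel. complex_of_real (sqrt (2 * pi)) * (cis (t * x) * complex_of_real (std_normal_density x)))"
      by (simp only: mult.left_commute)
    also have "\<dots> = complex_of_real (sqrt (2 * pi)) * complex_of_real (exp (- t\<^sup>2 / 2))"
      by (simp only: integral_mult_right_zero 2)
    finally have *: "(LINT x|lborel. cis (t * x)
        * (complex_of_real (sqrt (2 * pi)) * complex_of_real (std_normal_density x)))
      = complex_of_real (sqrt (2 * pi) * exp (- t\<^sup>2 / 2))"
      by (simp only: of_real_mult)
    show ?thesis by (simp only: eq[of x for x] *)
  qed
qed

lemma prod_exp_norm:
  fixes x :: "'a::euclidean_space"
  shows "(\<Prod>b\<in>Basis. exp (- (x \<bullet> b)\<^sup>2 / 2)) = exp (- (norm x)\<^sup>2 / 2)"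
proof -
  have "(norm x)\<^sup>2 = (\<Sum>b\<in>Basis. (x \<bullet> b)\<^sup>2)"
    by (simp only: norm_eq_sqrt_inner) (simp add: power2_eq_square euclidean_inner[of x x] real_sqrt_mult_self sum_nonneg)
  then show ?thesis
    by (simp add: exp_sum[symmetric] sum_divide_distrib sum_negf)
qed

lemma gaussian_fourier:
  fixes z :: "'a::euclidean_space"
  shows "(LINT x|lborel. cis (x \<bullet> z) * complex_of_real (exp (- (norm x)\<^sup>2 / 2)))
    = complex_of_real (sqrt (2 * pi) ^ DIM('a) * exp (- (norm z)\<^sup>2 / 2))"
proof -
  have cis_sum: "cis (sum f A) = (\<Prod>b\<in>A. cis (f b))" if "finite A" for f and A :: "'a set"
    using that by induction (auto simp: cis_mult[symmetric])
  have "(LINT x|lborel. cis (x \<bullet> z) * complex_of_real (exp (- (norm x)\<^sup>2 / 2)))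
    = (LINT x|lborel. (\<Prod>b\<in>Basis. cis ((z \<bullet> b)
        * (x \<bullet> b)) * complex_of_real (exp (- (x \<bullet> b)\<^sup>2 / 2))))"
    by (intro Bochner_Integration.integral_cong refl, subst euclidean_inner)
      (simp only: cis_sum[OF finite_Basis] prod.distrib prod_exp_norm[symmetric] mult.commute of_real_prod)
  also have "\<dots> = (\<Prod>b\<in>Basis. complex_of_real (sqrt (2 * pi) * exp (- (z \<bullet> b)\<^sup>2 / 2)))"
    by (subst lborel_integral_prod) (simp_all only: gaussian_fourier_1d)
  also have "\<dots> = complex_of_real (sqrt (2 * pi) ^ DIM('a) * exp (- (norm z)\<^sup>2 / 2))"
    by (simp only: of_real_prod[symmetric] prod.distrib prod_exp_norm) simp
  finally show ?thesis .
qed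

lemma integrable_gaussian:
  "integrable lborel (\<lambda>x::'a::euclidean_space. exp (- (norm x)\<^sup>2 / 2))"
  "(\<integral>\<^sup>+(x::'a). ennreal (exp (- (norm x)\<^sup>2 / 2)) \<partial>lborel)
      = ennreal (sqrt (2 * pi) ^ DIM('a))"
proof -
  have "(\<integral>\<^sup>+(x::'a). ennreal (exp (- (norm x)\<^sup>2 / 2)) \<partial>lborel)
     = (\<integral>\<^sup>+(x::'a). (\<Prod>b\<in>Basis. ennreal (exp (- (x \<bullet> b)\<^sup>2 / 2))) \<partial>lborel)"
    by (subst prod_ennreal) (simp_all only: prod_exp_norm exp_ge_zero)
  also have "\<dots> = (\<Prod>b\<in>(Basis :: 'a set). \<integral>\<^sup>+t. ennreal (exp (- t\<^sup>2 / 2)) \<partial>lborel)"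
    by (rule nn_integral_lborel_prod) auto
  also have "(\<integral>\<^sup>+t. ennreal (exp (- t\<^sup>2 / 2)) \<partial>lborel) = ennreal (sqrt (2 * pi))"
  proof -
    have i: "integrable lborel (\<lambda>t::real. exp (- t\<^sup>2 / 2))"
      using integrable_norm[OF gaussian_fourier_1d(1)[of 0]] by simp
    have "complex_of_real (LINT t|lborel. exp (- t\<^sup>2 / 2)) = complex_of_real (sqrt (2 * pi))"
      using gaussian_fourier_1d(2)[of 0] by (simp flip: integral_complex_of_real)
    then have "(LINT t|lborel. exp (- t\<^sup>2 / 2)) = sqrt (2 * pi)"
      by (simp only: of_real_eq_iff)
    then show ?thesis
      by (subst nn_integral_eq_integral[OF i]) auto
  qed
  finally show E: "(\<integral>\<^sup>+(x::'a). ennreal (exp (- (norm x)\<^sup>2 / 2)) \<partial>lborel)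
      = ennreal (sqrt (2 * pi) ^ DIM('a))"
    by (simp add: ennreal_power)
  show "integrable lborel (\<lambda>x::'a. exp (- (norm x)\<^sup>2 / 2))"
    by (rule integrableI_nonneg) (use E in auto)
qed

lemma cmod_integral_le_nn_integral:
  fixes f :: "'a \<Rightarrow> complex"
  shows "ennreal (cmod (LINT x|M. f x)) \<le> (\<integral>\<^sup>+x. ennreal (cmod (f x)) \<partial>M)"
  by (cases "integrable M f") (auto simp: integral_norm_bound_ennreal not_integrable_integral_eq)

lemma measurable_cnj [measurable (raw)]:
  "f \<in> borel_measurable M \<Longrightarrow> (\<lambda>x. cnj (f x)) \<in> borel_measurable M"
  by (rule measurable_compose[of f M borel cnj borel])
    (auto intro!: borel_measurable_continuous_onI continuous_intros)

text \<open>Schur's test for a convolution. After 2 a b \<le> a^2 + b^2 each square is integrated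
  against the kernel in the other variable, and both integrals equal the mass of k by translation
  and evenness.\<close>

lemma Schur_convolution:
  fixes H :: "'a::euclidean_space \<Rightarrow> ennreal" and k :: "'a \<Rightarrow> ennreal"
  assumes [measurable]: "H \<in> borel_measurable borel" "k \<in> borel_measurable borel"
    and k_even: "\<And>z. k (- z) = k z"
  shows "(\<integral>\<^sup>+x. H x * (\<integral>\<^sup>+y. H y * k (y - x) \<partial>lborel) \<partial>lborel)
    \<le> (\<integral>\<^sup>+x. H x ^ 2 \<partial>lborel) * (\<integral>\<^sup>+z. k z \<partial>lborel)"
proof -
  define I where "I = (\<integral>\<^sup>+x. H x ^ 2 \<partial>lborel)"
  define K where "K = (\<integral>\<^sup>+z. k z \<partial>lborel)"
  have shift: "(\<integral>\<^sup>+y. k (y - x) \<partial>lborel) = K" for x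
  proof -
    have "K = (\<integral>\<^sup>+y. k y \<partial>(distr lborel borel ((+) (- x))))"
      unfolding K_def using lborel_distr_plus[of "- x"] by simp
    also have "\<dots> = (\<integral>\<^sup>+y. k (y - x) \<partial>lborel)"
      by (subst nn_integral_distr) auto
    finally show ?thesis by simp
  qed

  have "2 * (\<integral>\<^sup>+x. H x * (\<integral>\<^sup>+y. H y * k (y - x) \<partial>lborel) \<partial>lborel)
    = (\<integral>\<^sup>+x. \<integral>\<^sup>+y. 2 * H x * H y * k (y - x) \<partial>lborel \<partial>lborel)"
    by (simp add: nn_integral_cmult[symmetric] mult_ac)
  also have "\<dots> \<le> (\<integral>\<^sup>+x. \<integral>\<^sup>+y. (H x ^ 2 + H y ^ 2) * k (y
      - x) \<partial>lborel \<partial>lborel)"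
    by (intro nn_integral_mono mult_right_mono sum_of_squares_ge_ennreal) auto
  also have "\<dots> = (\<integral>\<^sup>+x. (\<integral>\<^sup>+y. H x ^ 2 * k (y - x) \<partial>lborel)
      + (\<integral>\<^sup>+y. H y ^ 2 * k (y - x) \<partial>lborel) \<partial>lborel)"
    by (simp add: distrib_right nn_integral_add)
  also have "\<dots> = (\<integral>\<^sup>+x. \<integral>\<^sup>+y. H x ^ 2 * k (y
      - x) \<partial>lborel \<partial>lborel) + (\<integral>\<^sup>+x. \<integral>\<^sup>+y. H y ^ 2 * k (y
      - x) \<partial>lborel \<partial>lborel)"
    by (rule nn_integral_add) auto
  also have "(\<integral>\<^sup>+x. \<integral>\<^sup>+y. H x ^ 2 * k (y
      - x) \<partial>lborel \<partial>lborel) = I * K"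
    by (simp add: nn_integral_cmult nn_integral_multc shift I_def)
  also have "(\<integral>\<^sup>+x. \<integral>\<^sup>+y. H y ^ 2 * k (y - x) \<partial>lborel \<partial>lborel)
      = (\<integral>\<^sup>+y. \<integral>\<^sup>+x. H y ^ 2 * k (x - y) \<partial>lborel \<partial>lborel)"
    using k_even[of "_ - _"] by (subst lborel_pair.Fubini') (auto simp: )
  also have "\<dots> = I * K"
    by (simp add: nn_integral_cmult nn_integral_multc shift I_def)
  finally have "2 * (\<integral>\<^sup>+x. H x * (\<integral>\<^sup>+y. H y * k (y
      - x) \<partial>lborel) \<partial>lborel) \<le> 2 * (I * K)"
    by (simp add: mult_2)
  then show ?thesis
    unfolding I_def K_def by (subst (asm) ennreal_mult_le_mult_iff) auto
qed

text \<open>One half of Plancherel, uniformly in \<rho>. A Gaussian weight makes the multiple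
  integrals absolutely convergent, so that Fubini produces a convolution of H with the transform of
  the weight, another Gaussian, to which Schur's test applies. The loss exp (1/2) is the reciprocal
  of the least value of the weight on the unit ball.\<close>

lemma fourier_L2_bound:
  fixes H :: "'a::euclidean_space \<Rightarrow> complex"
  assumes H: "integrable lborel H" and \<rho>: "\<rho> > 0"
  shows "(\<integral>\<^sup>+\<xi>. indicator (cball 0 \<rho>) \<xi> * ennreal ((cmod (ft H \<xi>))\<^sup>2) \<partial>lborel)
    \<le> ennreal (exp (1/2) * (2 * pi) ^ DIM('a)) * energy H"
proof -
  define w where "w x = exp (- (norm x)\<^sup>2 / 2)" for x :: 'a
  define c where "c = sqrt (2 * pi) ^ DIM('a)"
  have c0: "c \<ge> 0" by (simp add: c_def)
  have wI: "(\<integral>\<^sup>+x. ennreal (w x) \<partial>lborel) = ennreal c"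
    unfolding w_def c_def by (rule integrable_gaussian(2))
  have w0: "w x \<ge> 0" for x by (simp add: w_def)
  have w_int: "integrable lborel w" unfolding w_def by (rule integrable_gaussian)
  have [measurable]: "w \<in> borel_measurable borel" unfolding w_def by simp
  have [measurable]: "H \<in> borel_measurable borel" using H by auto
  have cnjH: "integrable lborel (\<lambda>x. cnj (H x))" using H by simp
  define h where "h \<eta> = ft H (\<rho> *\<^sub>R \<eta>)" for \<eta>
  have [measurable]: "h \<in> borel_measurable borel" unfolding h_def by measurable
  have h_bd: "cmod (h \<eta>) \<le> (LINT x|lborel. cmod (H x))" for \<eta>
    unfolding h_def by (rule cmod_ft_le)
  have wc: "integrable lborel (\<lambda>\<eta>. complex_of_real (w \<eta>) * u \<eta>)"
    if [measurable]: "u \<in> borel_measurable borel" and "\<And>\<eta>. cmod (u \<eta>) \<le> B"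
        for u :: "'a \<Rightarrow> complex" and B
  proof (rule Bochner_Integration.integrable_bound)
    show "integrable lborel (\<lambda>\<eta>. B * w \<eta>)" using w_int by simp
    have "0 \<le> B" using that(2)[of 0] norm_ge_zero order_trans by blast
    then show "AE \<eta> in lborel. norm (complex_of_real (w \<eta>) * u \<eta>) \<le> norm (B * w \<eta>)"
      using that(2) by (auto simp: norm_mult w_def mult.commute)
  qed simp
  \<comment> \<open>\<open>J\<close> is the weighted energy of the rescaled transform, computed
    twice: Fubini gives the form bounded by Schur's test, while \<open>J_nn\<close> recognises a
    nonnegative integral that dominates the integral over the ball up to the factor exp
    (1/2).\<close>
  define J where "J = (LINT \<eta>|lborel. (complex_of_real (w \<eta>) * cnj (h \<eta>)) * h \<eta>)"
  have "J = (LINT \<eta>|lborel. (complex_of_real (w \<eta>) * cnj (h \<eta>))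
      * (LINT x|lborel. cis (- (x \<bullet> (\<rho> *\<^sub>R \<eta>))) * H x))"
    by (simp add: J_def h_def ft_def)
  also have "\<dots> = (LINT x|lborel. H x
      * (LINT \<eta>|lborel. cis (- (x \<bullet> (\<rho> *\<^sub>R \<eta>)))
      * (complex_of_real (w \<eta>) * cnj (h \<eta>))))"
    by (rule fubini_kernel[where K=1])
      (use H h_bd in \<open>auto intro!: wc[where B="LINT x|lborel. cmod (H x)"] simp: lborel.sigma_finite_measure_axioms\<close>)
  also have "\<dots> = (LINT x|lborel. H x
      * (LINT y|lborel. cnj (H y) * complex_of_real (c * w (\<rho> *\<^sub>R (y - x)))))"
  proof -
    have cnj_h: "cnj (h \<eta>) = (LINT y|lborel. cis (y \<bullet> (\<rho> *\<^sub>R \<eta>)) * cnj (H y))" for \<eta>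
      unfolding h_def ft_def Bochner_Integration.integral_cnj[symmetric] by (simp add: cis_cnj)
    have "(LINT \<eta>|lborel. cis (- (x \<bullet> (\<rho> *\<^sub>R \<eta>)))
        * (complex_of_real (w \<eta>) * cnj (h \<eta>)))
      = (LINT y|lborel. cnj (H y) * complex_of_real (c * w (\<rho> *\<^sub>R (y - x))))" for x
    proof -
      have "(LINT \<eta>|lborel. cis (- (x \<bullet> (\<rho> *\<^sub>R \<eta>)))
          * (complex_of_real (w \<eta>) * cnj (h \<eta>)))
        = (LINT \<eta>|lborel. (complex_of_real (w \<eta>) * cis (- (x \<bullet> (\<rho> *\<^sub>R \<eta>)))) * (LINT y|lborel. cis (y \<bullet> (\<rho> *\<^sub>R \<eta>)) * cnj (H y)))"
        unfolding cnj_h by (intro Bochner_Integration.integral_cong refl) (simp only: mult_ac)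
      also have "\<dots> = (LINT y|lborel. cnj (H y)
          * (LINT \<eta>|lborel. cis (y \<bullet> (\<rho> *\<^sub>R \<eta>))
          * (complex_of_real (w \<eta>) * cis (- (x \<bullet> (\<rho> *\<^sub>R \<eta>))))))"
        by (rule fubini_kernel[where K=1])
          (use cnjH in \<open>auto intro!: wc[where B=1] simp: lborel.sigma_finite_measure_axioms\<close>)
      also have "\<dots> = (LINT y|lborel. cnj (H y) * complex_of_real (c * w (\<rho> *\<^sub>R (y - x))))"
      proof -
        have "cis (y \<bullet> (\<rho> *\<^sub>R \<eta>)) * cis (- (x \<bullet> (\<rho> *\<^sub>R \<eta>)))
            = cis (\<eta> \<bullet> (\<rho> *\<^sub>R (y - x)))" for y \<eta>
          unfolding cis_mult by (simp add: inner_diff_right inner_commute algebra_simps)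
        then have "cis (y \<bullet> (\<rho> *\<^sub>R \<eta>))
            * (complex_of_real (w \<eta>) * cis (- (x \<bullet> (\<rho> *\<^sub>R \<eta>))))
            = cis (\<eta> \<bullet> (\<rho> *\<^sub>R (y - x))) * complex_of_real (w \<eta>)" for y \<eta>
          by (metis mult.assoc mult.commute)
        note eq = this
        have "(LINT \<eta>|lborel. cis (y \<bullet> (\<rho> *\<^sub>R \<eta>))
            * (complex_of_real (w \<eta>) * cis (- (x \<bullet> (\<rho> *\<^sub>R \<eta>)))))
            = complex_of_real (c * w (\<rho> *\<^sub>R (y - x)))" for y
          unfolding eq unfolding c_def w_def by (rule gaussian_fourier)
        then show ?thesis by simp
      qed
      finally show ?thesis .
    qed
    then show ?thesis by (simp only:)
  qed
  finally have J_eq: "J = (LINT x|lborel. H x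
      * (LINT y|lborel. cnj (H y) * complex_of_real (c * w (\<rho> *\<^sub>R (y - x)))))" .
  have "ennreal (cmod J) \<le> (\<integral>\<^sup>+x. ennreal (cmod (H x))
      * (\<integral>\<^sup>+y. ennreal (cmod (H y)) * ennreal (c * w (\<rho> *\<^sub>R (y
      - x))) \<partial>lborel) \<partial>lborel)"
  proof -
    have "ennreal (cmod J) \<le> (\<integral>\<^sup>+x. ennreal (cmod (H x
        * (LINT y|lborel. cnj (H y) * complex_of_real (c * w (\<rho> *\<^sub>R (y - x)))))) \<partial>lborel)"
      unfolding J_eq by (rule cmod_integral_le_nn_integral)
    also have "\<dots> = (\<integral>\<^sup>+x. ennreal (cmod (H x)) * ennreal (cmod (LINT y|lborel. cnj (H y) * complex_of_real (c * w (\<rho> *\<^sub>R (y - x))))) \<partial>lborel)"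
      by (simp add: norm_mult ennreal_mult)
    also have "\<dots> \<le> (\<integral>\<^sup>+x. ennreal (cmod (H x))
        * (\<integral>\<^sup>+y. ennreal (cmod (cnj (H y) * complex_of_real (c * w (\<rho> *\<^sub>R (y
        - x))))) \<partial>lborel) \<partial>lborel)"
      by (intro nn_integral_mono mult_left_mono cmod_integral_le_nn_integral) auto
    also have "\<dots> = (\<integral>\<^sup>+x. ennreal (cmod (H x))
        * (\<integral>\<^sup>+y. ennreal (cmod (H y)) * ennreal (c * w (\<rho> *\<^sub>R (y
        - x))) \<partial>lborel) \<partial>lborel)"
      using c0 by (simp add: norm_mult ennreal_mult w_def abs_mult)
    finally show ?thesis .
  qed
  also have "\<dots> \<le> (\<integral>\<^sup>+x. ennreal (cmod (H x)) ^ 2 \<partial>lborel)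
      * (\<integral>\<^sup>+z. ennreal (c * w (\<rho> *\<^sub>R z)) \<partial>lborel)"
    by (rule Schur_convolution[where k="\<lambda>z. ennreal (c * w (\<rho> *\<^sub>R z))"]) (auto simp: w_def)
  finally have J_le: "ennreal (cmod J) \<le> energy H
      * (\<integral>\<^sup>+z. ennreal (c * w (\<rho> *\<^sub>R z)) \<partial>lborel)"
    by (simp add: ennreal_power)
  \<comment> \<open>The dilation factor \<rho>^d cancels the 1/\<rho>^d in the mass of the dilated
    Gaussian. Of the two factors \<open>c\<close>, one comes from the transform of the Gaussian and
    one from its mass.\<close>
  have c_int: "ennreal (\<rho> ^ DIM('a))
      * (\<integral>\<^sup>+z. ennreal (c * w (\<rho> *\<^sub>R z)) \<partial>lborel) = ennreal ((2 * pi) ^ DIM('a))"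
  proof -
    have "ennreal (\<rho> ^ DIM('a))
        * (\<integral>\<^sup>+z. ennreal (c * w (\<rho> *\<^sub>R z)) \<partial>lborel)
        = (\<integral>\<^sup>+z. ennreal (c * w z) \<partial>lborel)"
      using nn_integral_lborel_scale[OF _ \<rho>, of "\<lambda>z. ennreal (c * w z)"] by simp
    also have "\<dots> = ennreal c * ennreal c"
      using c0 w0 by (simp add: ennreal_mult nn_integral_cmult wI)
    also have "\<dots> = ennreal ((2 * pi) ^ DIM('a))"
    proof -
      have "c * c = (sqrt (2 * pi) * sqrt (2 * pi)) ^ DIM('a)"
        unfolding c_def by (rule power_mult_distrib[symmetric])
      also have "sqrt (2 * pi) * sqrt (2 * pi) = 2 * pi"
        by (rule real_sqrt_mult_self[THEN trans]) simp
      finally show ?thesis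
        using c0 by (subst ennreal_mult[symmetric]) auto
    qed
    finally show ?thesis .
  qed
  have J_nn: "ennreal (cmod J) = (\<integral>\<^sup>+\<eta>. ennreal (w \<eta>
      * (cmod (h \<eta>))\<^sup>2) \<partial>lborel)"
  proof -
    have eq: "(complex_of_real (w \<eta>) * cnj (h \<eta>)) * h \<eta> = complex_of_real (w \<eta>
        * (cmod (h \<eta>))\<^sup>2)" for \<eta>
      using complex_norm_square[of "h \<eta>"] by (simp add: mult_ac)
    have i: "integrable lborel (\<lambda>\<eta>. complex_of_real (w \<eta>) * (cnj (h \<eta>) * h \<eta>))"
      by (rule wc[where B="(LINT x|lborel. cmod (H x))\<^sup>2"])
        (auto simp: norm_mult power2_eq_square intro!: mult_mono h_bd order_trans[OF norm_ge_zero h_bd])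
    have "integrable lborel (\<lambda>\<eta>. complex_of_real (w \<eta> * (cmod (h \<eta>))\<^sup>2))"
      using i unfolding mult.assoc[symmetric] eq .
    then have i2: "integrable lborel (\<lambda>\<eta>. w \<eta> * (cmod (h \<eta>))\<^sup>2)"
      unfolding complex_of_real_integrable_eq .
    have "J = complex_of_real (LINT \<eta>|lborel. w \<eta> * (cmod (h \<eta>))\<^sup>2)"
      unfolding J_def eq by (rule integral_complex_of_real)
    then have "cmod J = (LINT \<eta>|lborel. w \<eta> * (cmod (h \<eta>))\<^sup>2)"
      by (simp add: w_def)
    then show ?thesis
      by (subst nn_integral_eq_integral[OF i2]) (auto simp: w_def)
  qed
  have "(\<integral>\<^sup>+\<xi>. indicator (cball 0 \<rho>) \<xi> * ennreal ((cmod (ft H \<xi>))\<^sup>2) \<partial>lborel)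
    = ennreal (\<rho> ^ DIM('a))
        * (\<integral>\<^sup>+\<eta>. indicator (cball 0 \<rho>) (\<rho> *\<^sub>R \<eta>) * ennreal ((cmod (h \<eta>))\<^sup>2) \<partial>lborel)"
  proof -
    have [measurable]: "ft H \<in> borel_measurable borel" "cball (0::'a) \<rho> \<in> sets borel"
        by (auto intro: measurable_ft)
    show ?thesis
      unfolding h_def by (rule nn_integral_lborel_scale[OF _ \<rho>]) measurable
  qed
  also have "\<dots> \<le> ennreal (\<rho> ^ DIM('a))
      * (\<integral>\<^sup>+\<eta>. ennreal (exp (1/2)) * ennreal (w \<eta>
      * (cmod (h \<eta>))\<^sup>2) \<partial>lborel)"
  proof (intro mult_left_mono nn_integral_mono)
    fix \<eta> :: 'a
    show "indicator (cball 0 \<rho>) (\<rho> *\<^sub>R \<eta>) * ennreal ((cmod (h \<eta>))\<^sup>2)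
        \<le> ennreal (exp (1/2)) * ennreal (w \<eta> * (cmod (h \<eta>))\<^sup>2)"
    proof (cases "norm \<eta> \<le> 1")
      case True
      then have "(norm \<eta>)\<^sup>2 \<le> 1" by (simp add: power_le_one)
      then have "1 \<le> exp (1/2) * w \<eta>" by (simp add: w_def exp_add[symmetric])
      then have "(cmod (h \<eta>))\<^sup>2 \<le> exp (1/2) * (w \<eta> * (cmod (h \<eta>))\<^sup>2)"
        using mult_right_mono[of 1 "exp (1/2) * w \<eta>" "(cmod (h \<eta>))\<^sup>2"] by (simp add: mult.assoc)
      then show ?thesis
        by (auto simp: ennreal_mult[symmetric] w_def split: split_indicator intro!: ennreal_leI)
    next
      case False
      then show ?thesis using \<rho> by (simp add: indicator_def)
    qed
  qed auto
  also have "\<dots> = ennreal (exp (1/2)) * (ennreal (\<rho> ^ DIM('a)) * ennreal (cmod J))"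
    by (subst nn_integral_cmult) (auto simp: J_nn w_def mult_ac)
  also have "\<dots> \<le> ennreal (exp (1/2)) * (ennreal (\<rho> ^ DIM('a)) * (energy H
      * (\<integral>\<^sup>+z. ennreal (c * w (\<rho> *\<^sub>R z)) \<partial>lborel)))"
    by (intro mult_left_mono J_le) auto
  also have "\<dots> = ennreal (exp (1/2)) * (energy H * ennreal ((2 * pi) ^ DIM('a)))"
    unfolding c_int[symmetric] by (simp add: mult_ac)
  also have "\<dots> = ennreal (exp (1/2) * (2 * pi) ^ DIM('a)) * energy H"
    by (simp add: ennreal_mult mult_ac)
  finally show ?thesis .
qed

section \<open>The surface measure of the sphere\<close>

lemma measurable_sphere_measure [measurable (raw)]:
  "f \<in> borel_measurable borel \<Longrightarrow> f \<in> borel_measurable sphere_measure"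
  unfolding measurable_cong_sets[OF sets_sphere_measure refl] by (rule measurable_restrict_space1)

lemma nn_integral_sphere_measure:
  fixes F :: "'a::euclidean_space \<Rightarrow> ennreal"
  assumes [measurable]: "F \<in> borel_measurable borel"
  shows "(\<integral>\<^sup>+\<omega>. F \<omega> \<partial>sphere_measure)
    = ennreal (real DIM('a)) * (\<integral>\<^sup>+x. F (x /\<^sub>R norm x) * indicator (ball 0 1
        - {0}) x \<partial>lborel)"
proof -
  let ?M = "restrict_space lborel (ball 0 1 - {0::'a})"
  let ?N = "restrict_space borel (sphere 0 (1::real)) :: 'a measure"
  have "(\<lambda>x::'a. x /\<^sub>R norm x) \<in> borel_measurable ?M"
    by (rule measurable_restrict_space1) simp
  moreover have "(\<lambda>x::'a. x /\<^sub>R norm x) \<in> space ?M \<rightarrow> sphere 0 1"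
    by (auto simp: space_restrict_space)
  ultimately have meas [measurable]: "(\<lambda>x::'a. x /\<^sub>R norm x) \<in> measurable ?M ?N"
    by (intro measurable_restrict_space2) auto
  have F [measurable]: "F \<in> borel_measurable ?N"
    by (rule measurable_restrict_space1) simp
  show ?thesis
    unfolding sphere_measure_def
    by (simp add: nn_integral_scale_measure nn_integral_distr nn_integral_restrict_space)
qed

lemma emeasure_sphere_measure_finite:
  "emeasure (sphere_measure :: 'a::euclidean_space measure) (space sphere_measure) < top"
proof -
  have "emeasure (sphere_measure :: 'a measure) (space sphere_measure)
      = (\<integral>\<^sup>+(\<omega>::'a). 1 \<partial>sphere_measure)"
    by simp
  also have "\<dots> = ennreal (real DIM('a)) * emeasure lborel (ball 0 1 - {0::'a})"
    by (subst nn_integral_sphere_measure) auto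
  also have "\<dots> \<le> ennreal (real DIM('a)) * emeasure lborel (cball 0 1 :: 'a set)"
    by (intro mult_left_mono emeasure_mono) auto
  also have "\<dots> < top"
    using emeasure_lborel_cball_finite[of "0::'a" 1]
        by (intro ennreal_mult_less_top[THEN iffD2]) (simp add: less_top[symmetric])
  finally show ?thesis .
qed

interpretation sphere: finite_measure "sphere_measure :: 'a::euclidean_space measure"
  by (rule finite_measureI) (use emeasure_sphere_measure_finite[where 'a='a] in \<open>simp only: less_top infinity_ennreal_def\<close>)

text \<open>The substitution \<open>r = l * norm x\<close> turns radial averages over the cone measure into integrals of dilates by \<open>l \<ge> R\<close>.\<close>

lemma nn_integral_radial_average:
  fixes F :: "'a::euclidean_space \<Rightarrow> ennreal"
  assumes [measurable]: "F \<in> borel_measurable borel" and R: "R \<ge> 1"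
  shows "(\<integral>\<^sup>+\<omega>. (\<integral>\<^sup>+r. indicator {R..R+1} r * F (r *\<^sub>R \<omega>) \<partial>lborel) \<partial>sphere_measure)
    \<le> ennreal (2 * R / R ^ DIM('a))
        * (\<integral>\<^sup>+\<xi>. indicator (cball 0 (R+1)) \<xi> * F \<xi> \<partial>lborel)"
proof -
  define d where "d = DIM('a)"
  have d: "d > 0" by (simp add: d_def)
  have [measurable]: "cball (0::'a) (R + 1) \<in> sets borel" "ball 0 1 - {0::'a} \<in> sets borel"
    by auto
  define F' where "F' \<xi> = indicator (cball 0 (R+1)) \<xi> * F \<xi>" for \<xi>
  have [measurable]: "F' \<in> borel_measurable borel" unfolding F'_def by measurable
  have [measurable]: "(\<lambda>\<omega>. \<integral>\<^sup>+r. indicator {R..R+1} r * F (r *\<^sub>R \<omega>) \<partial>lborel) \<in> borel_measurable borel"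
    by measurable
  have pt: "(\<integral>\<^sup>+r. indicator {R..R+1} r * F (r *\<^sub>R (x /\<^sub>R norm x)) \<partial>lborel) * indicator (ball 0 1 - {0}) x
    \<le> (\<integral>\<^sup>+l. ennreal ((R
        + 1) / l) * indicator {R..} l * F' (l *\<^sub>R x) \<partial>lborel)" for x :: 'a
  proof (cases "x \<in> ball 0 1 - {0}")
    case True
    then have x: "norm x > 0" "norm x < 1" by auto
    have "(\<integral>\<^sup>+r. indicator {R..R+1} r * F (r *\<^sub>R (x /\<^sub>R norm x)) \<partial>lborel)
      = ennreal \<bar>norm x\<bar> * (\<integral>\<^sup>+l. indicator {R..R+1} (0 + norm x * l) * F ((0
          + norm x * l) *\<^sub>R (x /\<^sub>R norm x)) \<partial>lborel)"
      using x by (intro nn_integral_real_affine) auto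
    also have "\<dots> = (\<integral>\<^sup>+l. ennreal (norm x)
        * (indicator {R..R+1} (norm x * l) * F (l *\<^sub>R x)) \<partial>lborel)"
    proof -
      have "norm x * l * inverse (norm x) = l" for l using x by simp
      then have eq: "(0 + norm x * l) *\<^sub>R (x /\<^sub>R norm x) = l *\<^sub>R x" for l by simp
      show ?thesis unfolding eq using x by (subst nn_integral_cmult) auto
    qed
    also have "\<dots> \<le> (\<integral>\<^sup>+l. ennreal ((R
        + 1) / l) * indicator {R..} l * F' (l *\<^sub>R x) \<partial>lborel)"
    proof (rule nn_integral_mono)
      fix l :: real
      show "ennreal (norm x) * (indicator {R..R+1} (norm x * l) * F (l *\<^sub>R x)) \<le> ennreal ((R
          + 1) / l) * indicator {R..} l * F' (l *\<^sub>R x)"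
      proof (cases "norm x * l \<in> {R..R+1}")
        case True
        then have l0: "l > 0"
          using x R zero_less_mult_pos[of "norm x" l] by auto
        \<comment> \<open>Since norm x < 1, a radius norm x * l of at least R forces l \<ge> R; this
          is the origin of \<open>indicator {R..}\<close>.\<close>
        have "norm x * l \<le> 1 * l" using x l0 by (intro mult_right_mono) auto
        then have l: "R \<le> l" using True by auto
        have "norm x \<le> (R + 1) / l" using True l0 by (simp add: field_simps)
        moreover have "l *\<^sub>R x \<in> cball 0 (R + 1)" using True l0 by (simp add: mult.commute)
        ultimately show ?thesis
          using True l by (auto simp: F'_def intro!: mult_right_mono ennreal_leI)
      next
        case False
        then show ?thesis by simp
      qed
    qed
    finally show ?thesis using True by simp
  qed simp
  have "(\<integral>\<^sup>+\<omega>. (\<integral>\<^sup>+r. indicator {R..R+1} r * F (r *\<^sub>R \<omega>) \<partial>lborel) \<partial>sphere_measure)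
    \<le> ennreal (real d) * (\<integral>\<^sup>+x. (\<integral>\<^sup>+l. ennreal ((R
        + 1) / l) * indicator {R..} l * F' (l *\<^sub>R x) \<partial>lborel) \<partial>lborel)"
    unfolding d_def
    by (rule order_trans[OF eq_refl[OF nn_integral_sphere_measure]])
      (measurable, intro mult_left_mono nn_integral_mono pt, simp)
  also have "\<dots> = ennreal (real d) * (\<integral>\<^sup>+l. (\<integral>\<^sup>+x. ennreal ((R
      + 1) / l) * indicator {R..} l * F' (l *\<^sub>R x) \<partial>lborel) \<partial>lborel)"
    by (subst lborel_pair.Fubini') auto
  also have "\<dots> = ennreal (real d) * (\<integral>\<^sup>+l. ennreal ((R + 1) / l ^ (d
      + 1)) * indicator {R..} l * (\<integral>\<^sup>+x. F' x \<partial>lborel) \<partial>lborel)"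
  proof (intro arg_cong2[where f="(*)"] refl nn_integral_cong)
    fix l :: real
    show "(\<integral>\<^sup>+x. ennreal ((R + 1) / l) * indicator {R..} l * F' (l *\<^sub>R x) \<partial>lborel)
      = ennreal ((R + 1) / l ^ (d + 1)) * indicator {R..} l * (\<integral>\<^sup>+x. F' x \<partial>lborel)"
    proof (cases "R \<le> l")
      case True
      then have l: "l > 0" using R by simp
      have "ennreal ((R + 1) / l ^ (d + 1)) * (\<integral>\<^sup>+x. F' x \<partial>lborel)
        = ennreal ((R + 1) / l ^ (d + 1)) * (ennreal (l ^ d)
            * (\<integral>\<^sup>+x. F' (l *\<^sub>R x) \<partial>lborel))"
        using nn_integral_lborel_scale[of F' l] l by (simp add: d_def)
      also have "\<dots> = ennreal ((R + 1) / l ^ (d + 1) * l ^ d)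
          * (\<integral>\<^sup>+x. F' (l *\<^sub>R x) \<partial>lborel)"
        using l R by (subst ennreal_mult) (auto simp: mult.assoc)
      also have "(R + 1) / l ^ (d + 1) * l ^ d = (R + 1) / l"
        using l by simp
      finally show ?thesis using True l
        by (simp add: nn_integral_cmult)
    qed simp
  qed
  also have "\<dots> = ennreal (real d) * ((\<integral>\<^sup>+l. ennreal ((R + 1) / l ^ (d
      + 1)) * indicator {R..} l \<partial>lborel) * (\<integral>\<^sup>+x. F' x \<partial>lborel))"
    by (subst nn_integral_multc) auto
  \<comment> \<open>The tail integral of l^(-d-1) is 1/(d R^d), and its d cancels against the factor
    d of the cone measure.\<close>
  also have "(\<integral>\<^sup>+l. ennreal ((R + 1) / l ^ (d + 1)) * indicator {R..} l \<partial>lborel)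
      = ennreal (0 - (- ((R + 1) / (real d * R ^ d))))"
  proof (rule nn_integral_FTC_atLeast[where F="\<lambda>l. - ((R + 1) / (real d * l ^ d))"])
    fix l assume "R \<le> l"
    then have l: "l > 0" using R by simp
    obtain e where e: "d = Suc e" using d by (cases d) auto
    show "((\<lambda>l. - ((R + 1) / (real d * l ^ d))) has_real_derivative (R + 1) / l ^ (d + 1)) (at l)"
    proof -
      have "((\<lambda>l. l ^ d) has_real_derivative real d * (1 * l ^ (d - Suc 0))) (at l)"
        by (rule DERIV_power) (rule DERIV_ident)
      from DERIV_cmult[OF DERIV_inverse_fun[OF this], of "- ((R + 1) / real d)"] l
      have D: "((\<lambda>l. - ((R + 1) / real d) * inverse (l ^ d)) has_real_derivative
        - ((R + 1) / real d) * - (real d * (1 * l ^ (d - Suc 0)) * inverse ((l ^ d) ^ Suc (Suc 0)))) (at l)"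
        by simp
      have "(l ^ d) ^ Suc (Suc 0) = l ^ (d - Suc 0) * l ^ (d + 1)"
        unfolding e by (simp add: power_add[symmetric])
      then have "- ((R + 1) / real d) * - (real d * (1 * l ^ (d - Suc 0)) * inverse ((l ^ d) ^ Suc (Suc 0)))
          = (R + 1) / l ^ (d + 1)"
        using l d by (simp add: divide_simps)
      moreover have "(\<lambda>l. - ((R + 1) / real d) * inverse (l ^ d)) = (\<lambda>l. - ((R
          + 1) / (real d * l ^ d)))"
        by (simp add: divide_inverse mult_ac)
      ultimately show ?thesis using D by simp
    qed
    show "0 \<le> (R + 1) / l ^ (d + 1)" using l R by simp
  next
    have "filterlim (\<lambda>l. real d * l ^ d) at_top at_top"
      using d by (intro filterlim_tendsto_pos_mult_at_top[OF tendsto_const] filterlim_pow_at_top filterlim_ident) auto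
    then have "((\<lambda>l. (R + 1) / (real d * l ^ d)) \<longlongrightarrow> 0) at_top"
      by (intro tendsto_divide_0[OF tendsto_const] filterlim_at_top_imp_at_infinity)
    from tendsto_minus[OF this] show "((\<lambda>l. - ((R + 1) / (real d * l ^ d))) \<longlongrightarrow> 0) at_top"
      by simp
  qed simp
  also have "ennreal (real d) * (ennreal (0 - (- ((R + 1) / (real d * R ^ d))))
      * (\<integral>\<^sup>+x. F' x \<partial>lborel))
    = ennreal ((R + 1) / R ^ d) * (\<integral>\<^sup>+x. F' x \<partial>lborel)"
    using d R by (simp add: mult.assoc[symmetric] ennreal_mult[symmetric])
  also have "\<dots> \<le> ennreal (2 * R / R ^ d) * (\<integral>\<^sup>+x. F' x \<partial>lborel)"
    using R by (intro mult_right_mono ennreal_leI divide_right_mono) auto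
  finally show ?thesis by (simp add: F'_def d_def)
qed

text \<open>A Herglotz wave: a superposition of plane waves of frequency R, hence a solution of the
  Helmholtz equation. As an operator on \<open>a\<close> it is the adjoint of restricting
  \<open>ft\<close> to the sphere of radius R; see \<open>herglotz_ft_duality\<close>.\<close>

definition herglotz :: "real \<Rightarrow> ('a::euclidean_space \<Rightarrow> complex) \<Rightarrow> 'a \<Rightarrow> complex" where
  "herglotz R a x = (LINT \<omega>|sphere_measure. cis (R * (\<omega> \<bullet> x)) * a \<omega>)"

text \<open>In the factor 4, one 2 comes from R + 1 \<le> 2 R and one from squaring a sum of two
  terms. The summands 1 and L^2 belong to H and to its first moments, and the rest is the constant
  of \<open>fourier_L2_bound\<close>.\<close>

definition trace_const :: "'a::euclidean_space itself \<Rightarrow> real \<Rightarrow> real" where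
  "trace_const _ L = 4 * (1 + L\<^sup>2) * (exp (1/2) * (2 * pi) ^ DIM('a))"

lemma trace_const_nonneg: "trace_const TYPE('a::euclidean_space) L \<ge> 0"
  by (simp add: trace_const_def)

section \<open>Trace inequality on the sphere of radius R\<close>

lemma norm_power2_Basis: "(norm x)\<^sup>2 = (\<Sum>b\<in>Basis. (x \<bullet> b)\<^sup>2)"
  unfolding power2_norm_eq_inner by (subst euclidean_inner) (simp add: power2_eq_square)

lemma cmod_sum_mult_le:
  fixes z :: "'b \<Rightarrow> complex" and c :: "'b \<Rightarrow> real"
  shows "(cmod (\<Sum>b\<in>A. of_real (c b) * z b))\<^sup>2 \<le> (\<Sum>b\<in>A. (c b)\<^sup>2)
      * (\<Sum>b\<in>A. (cmod (z b))\<^sup>2)"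
proof -
  have "cmod (\<Sum>b\<in>A. of_real (c b) * z b) \<le> (\<Sum>b\<in>A. \<bar>c b\<bar> * cmod (z b))"
    by (rule order_trans[OF norm_sum]) (simp add: norm_mult)
  then have "(cmod (\<Sum>b\<in>A. of_real (c b) * z b))\<^sup>2
      \<le> (\<Sum>b\<in>A. \<bar>c b\<bar> * cmod (z b))\<^sup>2"
    by (rule power_mono) simp
  also have "\<dots> \<le> (\<Sum>b\<in>A. \<bar>c b\<bar>\<^sup>2) * (\<Sum>b\<in>A. (cmod (z b))\<^sup>2)"
    by (rule Cauchy_Schwarz_ineq_sum)
  finally show ?thesis by simp
qed

text \<open>The form "integral times s" is chosen so that s = x \<bullet> \<omega> can be moved over
  to H, which produces the first moment in \<open>ft_radial_oscillation\<close>.\<close>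

lemma cis_diff_integral:
  fixes s :: real
  assumes "a \<le> b"
  shows "(LINT t|lborel. (cis (- (t * s)) * (\<i> * indicator {a..b} t))) * of_real s = cis (- (a * s))
      - cis (- (b * s))"
proof -
  have "has_bochner_integral lborel (\<lambda>t. indicator {a..b} t *\<^sub>R (- (\<i> * of_real s) * cis (- (t * s)))) (cis (- (b * s)) - cis (- (a * s)))"
  proof (rule has_bochner_integral_FTC_Icc[OF \<open>a \<le> b\<close>])
    fix t
    have "((\<lambda>t. cis (- (t * s))) has_vector_derivative (- s) *\<^sub>R (\<i> * cis (- (t * s)))) (at t within {a..b})"
      unfolding has_vector_derivative_def
      by (auto intro!: derivative_eq_intros simp: scaleR_conv_of_real fun_eq_iff)
    then show "((\<lambda>t. cis (- (t * s))) has_vector_derivative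
        - (\<i> * of_real s) * cis (- (t * s))) (at t within {a..b})"
      by (simp add: scaleR_conv_of_real mult_ac)
  qed (intro continuous_intros)
  then have "(LINT t|lborel. indicator {a..b} t *\<^sub>R (- (\<i> * of_real s) * cis (- (t * s))))
      = cis (- (b * s)) - cis (- (a * s))"
    by (rule has_bochner_integral_integral_eq)
  moreover have "(LINT t|lborel. (cis (- (t * s)) * (\<i> * indicator {a..b} t))) * of_real s
    = - (LINT t|lborel. indicator {a..b} t *\<^sub>R (- (\<i> * of_real s) * cis (- (t * s))))"
  proof -
    have "(LINT t|lborel. (cis (- (t * s)) * (\<i> * indicator {a..b} t))) * of_real s
      = (LINT t|lborel. (cis (- (t * s)) * (\<i> * indicator {a..b} t)) * of_real s)"
      by simp
    also have "\<dots> = (LINT t|lborel. - (indicator {a..b} t *\<^sub>R (- (\<i> * of_real s) * cis (- (t * s)))))"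
      by (intro Bochner_Integration.integral_cong refl) (auto simp: indicator_def)
    finally show ?thesis by simp
  qed
  ultimately show ?thesis by simp
qed

text \<open>A one-dimensional Sobolev inequality along a ray: the value at an end of a unit interval
  is controlled by the mean squares of the function and of its derivative. The radial derivative of
  \<open>ft H\<close> is, up to a unimodular factor, the transform of the moment (x \<bullet>
  \<omega>) H; expanding \<omega> in the basis replaces it by moments that do not depend on
  \<omega>, as the integration over the sphere requires.\<close>

lemma ft_radial_oscillation:
  fixes H :: "'a::euclidean_space \<Rightarrow> complex"
  assumes H: "integrable lborel H" and supp: "\<And>x. norm x > L \<Longrightarrow> H x = 0"
    and \<omega>: "norm \<omega> = 1"
  shows "ennreal ((cmod (ft H (R *\<^sub>R \<omega>)))\<^sup>2)
    \<le> (\<integral>\<^sup>+r. indicator {R..R+1} r * (2 * ennreal ((cmod (ft H (r *\<^sub>R \<omega>)))\<^sup>2)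
        + 2 * (\<Sum>b\<in>Basis. ennreal ((cmod (ft (\<lambda>x. of_real (x \<bullet> b) * H x) (r *\<^sub>R \<omega>)))\<^sup>2))) \<partial>lborel)"
proof -
  have [measurable]: "H \<in> borel_measurable borel" using H by auto
  have fint: "integrable lborel (\<lambda>x. of_real (x \<bullet> v) * H x)" for v :: 'a
  proof (rule Bochner_Integration.integrable_bound)
    show "integrable lborel (\<lambda>x. of_real (\<bar>L\<bar> * norm v) * H x)" using H by simp
    show "AE x in lborel. norm (of_real (x \<bullet> v) * H x) \<le> norm (of_real (\<bar>L\<bar> * norm v) * H x)"
    proof (intro AE_I2)
      fix x
      show "norm (of_real (x \<bullet> v) * H x) \<le> norm (of_real (\<bar>L\<bar> * norm v) * H x)"
      proof (cases "norm x > L")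
        case False
        then have "\<bar>x \<bullet> v\<bar> \<le> \<bar>L\<bar> * norm v"
          by (intro order_trans[OF Cauchy_Schwarz_ineq2] mult_right_mono) auto
        then show ?thesis by (auto simp: norm_mult abs_mult intro!: mult_right_mono)
      qed (simp add: supp)
    qed
  qed simp
  define D where "D t = ft (\<lambda>x. of_real (x \<bullet> \<omega>) * H x) (t *\<^sub>R \<omega>)" for t
  define E where "E b t = ft (\<lambda>x. of_real (x \<bullet> b) * H x) (t *\<^sub>R \<omega>)" for b t
  have [measurable]: "ft (\<lambda>x. of_real (x \<bullet> v) * H x) \<in> borel_measurable borel" "ft H \<in> borel_measurable borel" for v
    by (auto intro!: measurable_ft)
  have [measurable]: "D \<in> borel_measurable borel" unfolding D_def by measurable
  have [measurable]: "E b \<in> borel_measurable borel" for b unfolding E_def by measurable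
  have D_E: "D t = (\<Sum>b\<in>Basis. of_real (\<omega> \<bullet> b) * E b t)" for t
  proof -
    have "D t = (LINT x|lborel. (\<Sum>b\<in>Basis. of_real (\<omega> \<bullet> b)
        * (cis (- (x \<bullet> (t *\<^sub>R \<omega>))) * (of_real (x \<bullet> b) * H x))))"
      unfolding D_def ft_def
      by (intro Bochner_Integration.integral_cong refl, subst euclidean_inner)
        (simp add: sum_distrib_left sum_distrib_right mult_ac)
    also have "\<dots> = (\<Sum>b\<in>Basis. of_real (\<omega> \<bullet> b) * E b t)"
    proof (subst Bochner_Integration.integral_sum)
      fix b :: 'a
      have "integrable lborel (\<lambda>x. cis (- (x \<bullet> (t *\<^sub>R \<omega>)))
          * (of_real (x \<bullet> b) * H x))"
        by (rule Bochner_Integration.integrable_bound[OF fint[of b]]) (auto simp: norm_mult)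
      then show "integrable lborel (\<lambda>x. of_real (\<omega> \<bullet> b)
          * (cis (- (x \<bullet> (t *\<^sub>R \<omega>))) * (of_real (x \<bullet> b) * H x)))"
        by (rule integrable_mult_right)
    qed (simp add: E_def ft_def)
    finally show ?thesis .
  qed
  have D_le: "ennreal (cmod (D t)) ^ 2 \<le> (\<Sum>b\<in>Basis. ennreal ((cmod (E b t))\<^sup>2))" for t
  proof -
    have "(\<Sum>b\<in>Basis. (\<omega> \<bullet> b)\<^sup>2) = 1"
      using \<omega> euclidean_inner[of \<omega> \<omega>] by (simp add: power2_eq_square norm_eq_1)
    then have "(cmod (D t))\<^sup>2 \<le> (\<Sum>b\<in>Basis. (cmod (E b t))\<^sup>2)"
      unfolding D_E using cmod_sum_mult_le[of "\<lambda>b. \<omega> \<bullet> b" "\<lambda>b. E b t" Basis] by simp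
    then show ?thesis by (simp add: ennreal_power ennreal_leI)
  qed
  \<comment> \<open>By Cauchy-Schwarz on an interval of length at most 1 the oscillation is bounded
    by this quantity, which no longer depends on r.\<close>
  define A where "A = (\<integral>\<^sup>+t. indicator {R..R+1} t
      * (\<Sum>b\<in>Basis. ennreal ((cmod (E b t))\<^sup>2)) \<partial>lborel)"
  have osc: "ennreal (cmod (ft H (R *\<^sub>R \<omega>) - ft H (r *\<^sub>R \<omega>))) ^ 2
      \<le> A" if r: "r \<in> {R..R+1}" for r
  proof -
    have i: "integrable lborel (\<lambda>x. cis (- (x \<bullet> y)) * H x)" for y
      by (rule Bochner_Integration.integrable_bound[OF H]) (auto simp: norm_mult)
    have "ft H (R *\<^sub>R \<omega>) - ft H (r *\<^sub>R \<omega>) = (LINT x|lborel. (cis (- (R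
        * (x \<bullet> \<omega>))) - cis (- (r * (x \<bullet> \<omega>)))) * H x)"
      unfolding ft_def using i[of "R *\<^sub>R \<omega>"] i[of "r *\<^sub>R \<omega>"]
      by (subst Bochner_Integration.integral_diff[symmetric]) (auto simp: left_diff_distrib)
    also have "\<dots> = (LINT x|lborel. (of_real (x \<bullet> \<omega>) * H x) * (LINT t|lborel. cis (- (t
        * (x \<bullet> \<omega>))) * (\<i> * indicator {R..r} t)))"
      using r by (intro Bochner_Integration.integral_cong refl, subst cis_diff_integral[symmetric]) (auto simp: mult_ac)
    also have "\<dots> = (LINT t|lborel. (\<i> * indicator {R..r} t) * (LINT x|lborel. cis (- (t
        * (x \<bullet> \<omega>))) * (of_real (x \<bullet> \<omega>) * H x)))"
    proof (rule fubini_kernel[where K=1])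
      have "integrable lborel (indicator {R..r} :: real \<Rightarrow> real)"
        by (intro integrable_real_indicator) (auto simp: emeasure_lborel_Icc_eq)
      then show "integrable lborel (\<lambda>t. \<i> * indicator {R..r} t)"
        by (rule Bochner_Integration.integrable_bound) (auto simp: norm_mult split: split_indicator)
    qed (use fint in \<open>auto simp: lborel.sigma_finite_measure_axioms\<close>)
    also have "\<dots> = (LINT t|lborel. (\<i> * indicator {R..r} t) * D t)"
      by (simp add: D_def ft_def)
    finally have "ennreal (cmod (ft H (R *\<^sub>R \<omega>) - ft H (r *\<^sub>R \<omega>)))
        \<le> (\<integral>\<^sup>+t. ennreal (cmod (\<i> * indicator {R..r} t * D t)) \<partial>lborel)"
      using cmod_integral_le_nn_integral by metis
    also have "\<dots> \<le> (\<integral>\<^sup>+t. indicator {R..R+1} t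
        * (indicator {R..R+1} t * ennreal (cmod (D t))) \<partial>lborel)"
      using r by (intro nn_integral_mono) (auto simp: norm_mult split: split_indicator)
    finally have "ennreal (cmod (ft H (R *\<^sub>R \<omega>) - ft H (r *\<^sub>R \<omega>))) ^ 2
      \<le> (\<integral>\<^sup>+t. indicator {R..R+1} t
          * (indicator {R..R+1} t * ennreal (cmod (D t))) \<partial>lborel) ^ 2"
      by (rule power_mono) simp
    also have "\<dots> \<le> (\<integral>\<^sup>+t. indicator {R..R+1} t ^ 2 \<partial>lborel)
        * (\<integral>\<^sup>+t. (indicator {R..R+1} t * ennreal (cmod (D t))) ^ 2 \<partial>lborel)"
      by (rule Cauchy_Schwarz_nn_integral) measurable
    also have "(\<integral>\<^sup>+t. indicator {R..R+1} t ^ 2 \<partial>lborel)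
        = (\<integral>\<^sup>+t. indicator {R..R+1} t \<partial>lborel)"
      by (intro nn_integral_cong) (auto split: split_indicator)
    also have "\<dots> = 1" by simp
    also have "1 * (\<integral>\<^sup>+t. (indicator {R..R+1} t * ennreal (cmod (D t))) ^ 2 \<partial>lborel) \<le> A"
      unfolding A_def using D_le by (auto intro!: nn_integral_mono split: split_indicator)
    finally show ?thesis .
  qed
  have step: "ennreal ((cmod (ft H (R *\<^sub>R \<omega>)))\<^sup>2)
      \<le> 2 * ennreal ((cmod (ft H (r *\<^sub>R \<omega>)))\<^sup>2) + 2 * A" if r: "r \<in> {R..R+1}" for r
  proof -
    have "cmod (ft H (R *\<^sub>R \<omega>)) \<le> cmod (ft H (r *\<^sub>R \<omega>))
        + cmod (ft H (R *\<^sub>R \<omega>) - ft H (r *\<^sub>R \<omega>))"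
      using norm_triangle_ineq[of "ft H (r *\<^sub>R \<omega>)" "ft H (R *\<^sub>R \<omega>)
          - ft H (r *\<^sub>R \<omega>)"] by simp
    then have "(cmod (ft H (R *\<^sub>R \<omega>)))\<^sup>2 \<le> (cmod (ft H (r *\<^sub>R \<omega>))
        + cmod (ft H (R *\<^sub>R \<omega>) - ft H (r *\<^sub>R \<omega>)))\<^sup>2"
      by (rule power_mono) simp
    also have "\<dots> \<le> 2 * (cmod (ft H (r *\<^sub>R \<omega>)))\<^sup>2 + 2
        * (cmod (ft H (R *\<^sub>R \<omega>) - ft H (r *\<^sub>R \<omega>)))\<^sup>2"
      using sum_squares_bound[of "cmod (ft H (r *\<^sub>R \<omega>))" "cmod (ft H (R *\<^sub>R \<omega>)
          - ft H (r *\<^sub>R \<omega>))"]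
      by (simp add: power2_sum)
    finally have "ennreal ((cmod (ft H (R *\<^sub>R \<omega>)))\<^sup>2) \<le> ennreal (2
        * (cmod (ft H (r *\<^sub>R \<omega>)))\<^sup>2 + 2 * (cmod (ft H (R *\<^sub>R \<omega>)
        - ft H (r *\<^sub>R \<omega>)))\<^sup>2)"
      by (rule ennreal_leI)
    also have "\<dots> = 2 * ennreal ((cmod (ft H (r *\<^sub>R \<omega>)))\<^sup>2)
        + 2 * ennreal (cmod (ft H (R *\<^sub>R \<omega>) - ft H (r *\<^sub>R \<omega>))) ^ 2"
      by (simp add: ennreal_plus ennreal_mult ennreal_power)
    also have "\<dots> \<le> 2 * ennreal ((cmod (ft H (r *\<^sub>R \<omega>)))\<^sup>2) + 2 * A"
      by (intro add_left_mono mult_left_mono osc r) simp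
    finally show ?thesis .
  qed
  \<comment> \<open>The interval has length 1, so averaging over r leaves the terms that do not
    depend on r unchanged.\<close>
  have one: "(\<integral>\<^sup>+r. indicator {R..R+1} r * c \<partial>lborel) = c" for c :: ennreal
    by (subst nn_integral_multc) auto
  have "ennreal ((cmod (ft H (R *\<^sub>R \<omega>)))\<^sup>2)
      = (\<integral>\<^sup>+r. indicator {R..R+1} r * ennreal ((cmod (ft H (R *\<^sub>R \<omega>)))\<^sup>2) \<partial>lborel)"
    by (simp add: one)
  also have "\<dots> \<le> (\<integral>\<^sup>+r. indicator {R..R+1} r
      * (2 * ennreal ((cmod (ft H (r *\<^sub>R \<omega>)))\<^sup>2)) + indicator {R..R+1} r * (2 * A) \<partial>lborel)"
    by (intro nn_integral_mono) (use step in \<open>auto split: split_indicator\<close>)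
  also have "\<dots> = (\<integral>\<^sup>+r. indicator {R..R+1} r
      * (2 * ennreal ((cmod (ft H (r *\<^sub>R \<omega>)))\<^sup>2)) \<partial>lborel) + 2 * A"
    by (subst nn_integral_add) (auto simp: one)
  also have "2 * A = (\<integral>\<^sup>+r. indicator {R..R+1} r * (2
      * (\<Sum>b\<in>Basis. ennreal ((cmod (E b r))\<^sup>2))) \<partial>lborel)"
    unfolding A_def by (subst nn_integral_cmult[symmetric]) (auto simp: mult_ac)
  also have "(\<integral>\<^sup>+r. indicator {R..R+1} r
      * (2 * ennreal ((cmod (ft H (r *\<^sub>R \<omega>)))\<^sup>2)) \<partial>lborel) + \<dots>
    = (\<integral>\<^sup>+r. indicator {R..R+1} r
        * (2 * ennreal ((cmod (ft H (r *\<^sub>R \<omega>)))\<^sup>2) + 2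
        * (\<Sum>b\<in>Basis. ennreal ((cmod (E b r))\<^sup>2))) \<partial>lborel)"
    by (subst nn_integral_add[symmetric]) (auto simp: distrib_left)
  finally show ?thesis by (simp add: E_def)
qed

section \<open>Herglotz waves and their duality with the trace\<close>

lemma borel_measurable_herglotz [measurable]:
  assumes [measurable]: "a \<in> borel_measurable borel"
  shows "herglotz R a \<in> borel_measurable borel"
proof -
  have [measurable]: "(\<lambda>p::'a \<times> 'a. cis (R
      * (snd p \<bullet> fst p)) * a (snd p)) \<in> borel_measurable (borel \<Otimes>\<^sub>M sphere_measure)"
  proof -
    have "(\<lambda>p::'a \<times> 'a. cis (R
        * (snd p \<bullet> fst p)) * a (snd p)) \<in> borel_measurable (borel \<Otimes>\<^sub>M restrict_space borel (sphere 0 1))"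
      by (intro borel_measurable_times measurable_compose[OF _ measurable_cis] borel_measurable_inner
          measurable_compose[OF measurable_snd] measurable_compose[OF measurable_fst] borel_measurable_const measurable_restrict_space1) auto
    then show ?thesis
      by (subst measurable_cong_sets[OF sets_pair_measure_cong[OF refl sets_sphere_measure] refl])
  qed
  have "(\<lambda>x. LINT \<omega>|sphere_measure. cis (R
      * (\<omega> \<bullet> x)) * a \<omega>) \<in> borel_measurable borel"
    by (rule sigma_finite_measure.borel_measurable_lebesgue_integral[OF sphere.sigma_finite_measure]) (simp add: case_prod_beta')
  then show ?thesis by (simp add: herglotz_def[abs_def])
qed

lemma sphere_integrable:
  fixes a :: "'a::euclidean_space \<Rightarrow> complex"
  assumes "a \<in> borel_measurable borel" and "\<And>\<omega>. norm \<omega> = 1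
      \<Longrightarrow> cmod (a \<omega>) \<le> K"
  shows "integrable sphere_measure a"
  by (rule sphere.integrable_const_bound[of _ K]) (use assms in auto)

lemma cmod_herglotz_le:
  fixes a :: "'a::euclidean_space \<Rightarrow> complex"
  assumes "a \<in> borel_measurable borel" and "\<And>\<omega>. norm \<omega> = 1
      \<Longrightarrow> cmod (a \<omega>) \<le> K"
  shows "cmod (herglotz R a x) \<le> (LINT \<omega>|sphere_measure. cmod (a \<omega>))"
  unfolding herglotz_def using integral_norm_bound[of sphere_measure "\<lambda>\<omega>. cis (R
      * (\<omega> \<bullet> x)) * a \<omega>"]
  by (simp add: norm_mult)

lemma herglotz_ft_duality:
  fixes H :: "'a::euclidean_space \<Rightarrow> complex" and a :: "'a \<Rightarrow> complex"
  assumes H: "integrable lborel H"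
    and a: "a \<in> borel_measurable borel" "\<And>\<omega>. norm \<omega> = 1
        \<Longrightarrow> cmod (a \<omega>) \<le> K"
  shows "(LINT x|lborel. cnj (H x) * herglotz R a x)
      = (LINT \<omega>|sphere_measure. a \<omega> * cnj (ft H (R *\<^sub>R \<omega>)))"
proof -
  have H' [measurable]: "H \<in> borel_measurable borel" using H by auto
  have m: "(\<lambda>(x, \<omega>). cis (R
      * (\<omega> \<bullet> x))) \<in> borel_measurable (lborel \<Otimes>\<^sub>M (sphere_measure :: 'a measure))"
  proof -
    have "(\<lambda>(x, \<omega>). cis (R
        * (\<omega> \<bullet> x))) \<in> borel_measurable (borel \<Otimes>\<^sub>M restrict_space borel (sphere (0::'a) 1))"
      unfolding case_prod_beta'
      by (intro measurable_compose[OF _ measurable_cis] borel_measurable_inner borel_measurable_times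
          measurable_compose[OF measurable_snd] measurable_compose[OF measurable_fst] borel_measurable_const measurable_restrict_space1) auto
    then show ?thesis
      by (subst measurable_cong_sets[OF sets_pair_measure_cong[OF sets_lborel sets_sphere_measure] refl])
  qed
  have "(LINT x|lborel. cnj (H x) * herglotz R a x)
    = (LINT \<omega>|sphere_measure. a \<omega> * (LINT x|lborel. cis (R * (\<omega> \<bullet> x)) * cnj (H x)))"
    unfolding herglotz_def
    by (rule fubini_kernel[where K=1]) (use H a m in \<open>auto intro: sphere_integrable simp: lborel.sigma_finite_measure_axioms sphere.sigma_finite_measure\<close>)
  also have "\<dots> = (LINT \<omega>|sphere_measure. a \<omega> * cnj (ft H (R *\<^sub>R \<omega>)))"
    unfolding ft_def Bochner_Integration.integral_cnj[symmetric]
    by (simp add: cis_cnj inner_commute)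
  finally show ?thesis .
qed

text \<open>H lives in a fixed ball, so \<open>ft H\<close> varies on unit scale and the sphere may
  be thickened to a shell of unit width. There Plancherel applies to H and to its first moments, the
  latter costing at most L^2. The factor R/R^d is what remains of the radial averaging.\<close>

lemma sphere_trace_L2:
  fixes H :: "'a::euclidean_space \<Rightarrow> complex"
  assumes H: "integrable lborel H" and supp: "\<And>x. norm x > L \<Longrightarrow> H x = 0" and R: "R \<ge> 1"
  shows "sphere_energy R H
    \<le> ennreal (trace_const TYPE('a) L * (R / R ^ DIM('a))) * energy H"
proof -
  have [measurable]: "H \<in> borel_measurable borel" using H by auto
  define B where "B b x = of_real (x \<bullet> b) * H x" for b x :: 'a
  have B_meas [measurable]: "B b \<in> borel_measurable borel" for b unfolding B_def by measurable
  have B_int: "integrable lborel (B b)" if b: "b \<in> Basis" for b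
  proof (rule Bochner_Integration.integrable_bound)
    show "integrable lborel (\<lambda>x. of_real \<bar>L\<bar> * H x)" using H by simp
    have "norm (B b x) \<le> norm (of_real \<bar>L\<bar> * H x)" for x
    proof (cases "norm x > L")
      case False
      then have "\<bar>x \<bullet> b\<bar> \<le> \<bar>L\<bar>" using Basis_le_norm[OF b, of x] by auto
      then show ?thesis by (auto simp: B_def norm_mult intro!: mult_right_mono)
    qed (simp add: supp B_def)
    then show "AE x in lborel. norm (B b x) \<le> norm (of_real \<bar>L\<bar> * H x)" by simp
  qed simp
  define \<Phi> where "\<Phi> \<xi> = 2 * ennreal ((cmod (ft H \<xi>))\<^sup>2) + 2
      * (\<Sum>b\<in>Basis. ennreal ((cmod (ft (B b) \<xi>))\<^sup>2))" for \<xi>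
  define N where "N = energy H"
  define c where "c = exp (1/2) * (2 * pi) ^ DIM('a)"
  have c0: "c \<ge> 0" by (simp add: c_def)
  have [measurable]: "ft H \<in> borel_measurable borel" "ft (B b) \<in> borel_measurable borel" for b
    by (auto intro!: measurable_ft)
  have [measurable]: "cball (0::'a) (R + 1) \<in> sets borel" by auto
  have [measurable]: "\<Phi> \<in> borel_measurable borel" unfolding \<Phi>_def by measurable
  have "sphere_energy R H
    \<le> (\<integral>\<^sup>+\<omega>. (\<integral>\<^sup>+r. indicator {R..R+1} r * \<Phi> (r *\<^sub>R \<omega>) \<partial>lborel) \<partial>sphere_measure)"
    using ft_radial_oscillation[OF H supp] unfolding \<Phi>_def B_def
    by (intro nn_integral_mono) simp
  also have "\<dots> \<le> ennreal (2 * R / R ^ DIM('a))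
      * (\<integral>\<^sup>+\<xi>. indicator (cball 0 (R+1)) \<xi> * \<Phi> \<xi> \<partial>lborel)"
    by (rule nn_integral_radial_average) (use R in auto)
  also have "(\<integral>\<^sup>+\<xi>. indicator (cball 0 (R+1)) \<xi> * \<Phi> \<xi> \<partial>lborel)
    = 2 * (\<integral>\<^sup>+\<xi>. indicator (cball 0 (R+1)) \<xi> * ennreal ((cmod (ft H \<xi>))\<^sup>2) \<partial>lborel)
      + 2 * (\<Sum>b\<in>Basis. \<integral>\<^sup>+\<xi>. indicator (cball 0 (R+1)) \<xi> * ennreal ((cmod (ft (B b) \<xi>))\<^sup>2) \<partial>lborel)"
    unfolding \<Phi>_def
    by (simp add: distrib_left nn_integral_add nn_integral_cmult nn_integral_sum sum_distrib_left mult.left_commute del: sum_ennreal)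
  also have "\<dots> \<le> 2 * (ennreal c * N) + 2 * (\<Sum>b\<in>Basis. ennreal c
      * (\<integral>\<^sup>+x. ennreal ((cmod (B b x))\<^sup>2) \<partial>lborel))"
    unfolding N_def c_def
    by (intro add_mono mult_left_mono sum_mono fourier_L2_bound H B_int) (use R in auto)
  also have "\<dots> = 2 * (ennreal c * N) + 2 * (ennreal c
      * (\<integral>\<^sup>+x. (\<Sum>b\<in>Basis. ennreal ((cmod (B b x))\<^sup>2)) \<partial>lborel))"
    by (simp add: sum_distrib_left[symmetric] nn_integral_sum del: sum_ennreal)
  also have "(\<integral>\<^sup>+x. (\<Sum>b\<in>Basis. ennreal ((cmod (B b x))\<^sup>2)) \<partial>lborel) \<le> ennreal (L\<^sup>2) * N"
  proof -
    have "(\<Sum>b\<in>Basis. ennreal ((cmod (B b x))\<^sup>2))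
        \<le> ennreal (L\<^sup>2) * ennreal ((cmod (H x))\<^sup>2)" for x
    proof -
      have "(\<Sum>b\<in>Basis. (cmod (B b x))\<^sup>2) = (\<Sum>b\<in>Basis. (x \<bullet> b)\<^sup>2)
          * (cmod (H x))\<^sup>2"
        by (simp add: B_def norm_mult power_mult_distrib sum_distrib_right)
      also have "(\<Sum>b\<in>Basis. (x \<bullet> b)\<^sup>2) = (norm x)\<^sup>2"
        by (simp add: norm_power2_Basis)
      also have "(norm x)\<^sup>2 * (cmod (H x))\<^sup>2 \<le> L\<^sup>2 * (cmod (H x))\<^sup>2"
      proof (cases "norm x > L")
        case False
        then show ?thesis by (intro mult_right_mono power_mono) auto
      qed (simp add: supp)
      finally have "ennreal (\<Sum>b\<in>Basis. (cmod (B b x))\<^sup>2) \<le> ennreal (L\<^sup>2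
          * (cmod (H x))\<^sup>2)"
        by (rule ennreal_leI)
      then show ?thesis by (simp add: ennreal_mult sum_ennreal)
    qed
    then have "(\<integral>\<^sup>+x. (\<Sum>b\<in>Basis. ennreal ((cmod (B b x))\<^sup>2)) \<partial>lborel) \<le> (\<integral>\<^sup>+x. ennreal (L\<^sup>2) * ennreal ((cmod (H x))\<^sup>2) \<partial>lborel)"
      by (intro nn_integral_mono)
    also have "\<dots> = ennreal (L\<^sup>2) * N" unfolding N_def by (rule nn_integral_cmult) simp
    finally show ?thesis .
  qed
  finally have "sphere_energy R H
    \<le> ennreal (2 * R / R ^ DIM('a)) * (2 * (ennreal c * N) + 2 * (ennreal c * (ennreal (L\<^sup>2) * N)))"
    by (simp add: mult_left_mono add_left_mono)
  also have "2 * (ennreal c * N) + 2 * (ennreal c * (ennreal (L\<^sup>2) * N)) = ennreal (2 * c * (1 + L\<^sup>2)) * N"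
  proof -
    have "ennreal (2 * c * (1 + L\<^sup>2)) = 2 * ennreal c * (1 + ennreal (L\<^sup>2))"
      using c0 by (simp add: ennreal_mult ennreal_plus[symmetric])
    then show ?thesis by (simp add: distrib_left distrib_right mult_ac)
  qed
  also have "ennreal (2 * R / R ^ DIM('a)) * (ennreal (2 * c * (1 + L\<^sup>2)) * N)
    = ennreal (trace_const TYPE('a) L * (R / R ^ DIM('a))) * N"
  proof -
    have "trace_const TYPE('a) L * (R / R ^ DIM('a)) = (2 * R / R ^ DIM('a)) * (2 * c * (1 + L\<^sup>2))"
      by (simp add: trace_const_def c_def)
    then have "ennreal (trace_const TYPE('a) L * (R / R ^ DIM('a)))
        = ennreal (2 * R / R ^ DIM('a)) * ennreal (2 * c * (1 + L\<^sup>2))"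
      using R c0 by (simp only:) (rule ennreal_mult, auto)
    then show ?thesis by (simp only: mult.assoc)
  qed
  finally show ?thesis unfolding N_def .
qed

text \<open>Cancels one factor N, which is why N must be known to be finite beforehand.\<close>

lemma ennreal_le_of_square_le:
  fixes N A K :: ennreal
  assumes "N ^ 2 \<le> A * (K * N)" "N < top"
  shows "N \<le> A * K"
proof (cases "N = 0")
  case False
  have "N * N \<le> N * (A * K)" using assms(1) by (simp add: power2_eq_square mult_ac)
  then show ?thesis
    by (subst (asm) ennreal_mult_le_mult_iff) (use False assms(2) in auto)
qed simp

text \<open>Duality applied to the wave itself: with H the wave cut off to the ball, its energy N is
  the pairing of \<open>a\<close> with \<open>ft H\<close> on the sphere. Hence N^2 is at most the
  squared norm of \<open>a\<close> times the trace bound for H, which is linear in N.\<close>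

lemma herglotz_local_L2:
  fixes a :: "'a::euclidean_space \<Rightarrow> complex"
  assumes a [measurable]: "a \<in> borel_measurable borel" and a_bd: "\<And>\<omega>. norm \<omega>
      = 1 \<Longrightarrow> cmod (a \<omega>) \<le> K"
    and R: "R \<ge> 1"
  shows "(\<integral>\<^sup>+x. indicator (cball 0 L) x * ennreal ((cmod (herglotz R a x))\<^sup>2) \<partial>lborel)
    \<le> (\<integral>\<^sup>+\<omega>. ennreal ((cmod (a \<omega>))\<^sup>2) \<partial>sphere_measure) * ennreal (trace_const TYPE('a) L * (R / R ^ DIM('a)))"
proof (rule ennreal_le_of_square_le)
  have [measurable]: "cball (0::'a) L \<in> sets borel" "herglotz R a \<in> borel_measurable borel" by auto
  define B where "B = (LINT \<omega>|sphere_measure. cmod (a \<omega>))"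
  have u_bd: "cmod (herglotz R a x) \<le> B" for x
    unfolding B_def by (rule cmod_herglotz_le[OF a a_bd])
  then have B0: "B \<ge> 0" using norm_ge_zero order_trans by blast
  define H where "H x = indicator (cball 0 L) x * herglotz R a x" for x
  have [measurable]: "H \<in> borel_measurable borel" unfolding H_def by measurable
  have cb: "integrable lborel (\<lambda>x::'a. indicator (cball 0 L) x * c)" for c :: real
    by (rule integrable_mult_left) (auto intro!: integrable_real_indicator emeasure_lborel_cball_finite)
  have H_int: "integrable lborel H"
    by (rule Bochner_Integration.integrable_bound[OF cb[of B]])
      (use u_bd B0 in \<open>auto simp: H_def norm_mult split: split_indicator\<close>)
  define N where "N = energy H"
  have N_eq: "N = (\<integral>\<^sup>+x. indicator (cball 0 L) x * ennreal ((cmod (herglotz R a x))\<^sup>2) \<partial>lborel)"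
    unfolding N_def H_def by (intro nn_integral_cong) (auto split: split_indicator)
  have H2_int: "integrable lborel (\<lambda>x. (cmod (H x))\<^sup>2)"
    by (rule Bochner_Integration.integrable_bound[OF cb[of "B\<^sup>2"]])
      (use u_bd B0 in \<open>auto simp: H_def norm_mult power_mono split: split_indicator\<close>)
  have N_real: "N = ennreal (LINT x|lborel. (cmod (H x))\<^sup>2)"
    unfolding N_def by (rule nn_integral_eq_integral[OF H2_int]) auto
  show "(\<integral>\<^sup>+x. indicator (cball 0 L) x * ennreal ((cmod (herglotz R a x))\<^sup>2) \<partial>lborel) < top"
    unfolding N_eq[symmetric] N_real by simp
  have "complex_of_real (LINT x|lborel. (cmod (H x))\<^sup>2) = (LINT x|lborel. cnj (H x) * herglotz R a x)"
    unfolding integral_complex_of_real[symmetric]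
    by (intro Bochner_Integration.integral_cong refl)
      (auto simp: H_def complex_norm_square[symmetric] mult.commute split: split_indicator)
  also have "\<dots> = (LINT \<omega>|sphere_measure. a \<omega> * cnj (ft H (R *\<^sub>R \<omega>)))"
    by (rule herglotz_ft_duality[OF H_int a a_bd])
  finally have "cmod (complex_of_real (LINT x|lborel. (cmod (H x))\<^sup>2))
      = cmod (LINT \<omega>|sphere_measure. a \<omega> * cnj (ft H (R *\<^sub>R \<omega>)))"
    by simp
  then have "N = ennreal (cmod (LINT \<omega>|sphere_measure. a \<omega> * cnj (ft H (R *\<^sub>R \<omega>))))"
    unfolding N_real by simp
  also have "\<dots> \<le> (\<integral>\<^sup>+\<omega>. ennreal (cmod (a \<omega>)) * ennreal (cmod (ft H (R *\<^sub>R \<omega>))) \<partial>sphere_measure)"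
    by (rule order_trans[OF cmod_integral_le_nn_integral]) (simp add: norm_mult ennreal_mult)
  finally have "N ^ 2 \<le> (\<integral>\<^sup>+\<omega>. ennreal (cmod (a \<omega>)) * ennreal (cmod (ft H (R *\<^sub>R \<omega>))) \<partial>sphere_measure) ^ 2"
    by (rule power_mono) simp
  also have "\<dots> \<le> (\<integral>\<^sup>+\<omega>. ennreal (cmod (a \<omega>)) ^ 2 \<partial>sphere_measure) * (\<integral>\<^sup>+\<omega>. ennreal (cmod (ft H (R *\<^sub>R \<omega>))) ^ 2 \<partial>sphere_measure)"
  proof -
    have [measurable]: "ft H \<in> borel_measurable borel" by (rule measurable_ft) simp
    show ?thesis
      by (rule Cauchy_Schwarz_nn_integral) (rule measurable_sphere_measure, measurable)+
  qed
  also have "(\<integral>\<^sup>+\<omega>. ennreal (cmod (ft H (R *\<^sub>R \<omega>))) ^ 2 \<partial>sphere_measure) \<le> ennreal (trace_const TYPE('a) L * (R / R ^ DIM('a))) * N"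
    using sphere_trace_L2[OF H_int _ R, of L] by (simp add: N_def ennreal_power H_def)
  finally show "(\<integral>\<^sup>+x. indicator (cball 0 L) x * ennreal ((cmod (herglotz R a x))\<^sup>2) \<partial>lborel)\<^sup>2
    \<le> (\<integral>\<^sup>+\<omega>. ennreal ((cmod (a \<omega>))\<^sup>2) \<partial>sphere_measure)
        * (ennreal (trace_const TYPE('a) L * (R / R ^ DIM('a)))
      * (\<integral>\<^sup>+x. indicator (cball 0 L) x * ennreal ((cmod (herglotz R a x))\<^sup>2) \<partial>lborel))"
    unfolding N_eq[symmetric] by (simp add: ennreal_power mult_left_mono)
qed

section \<open>The Rellich identity\<close>

lemma lborel_integral_shift:
  fixes f :: "'a::euclidean_space \<Rightarrow> 'b::{banach, second_countable_topology}"
  assumes [measurable]: "f \<in> borel_measurable borel"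
  shows "(LINT x|lborel. f (x + h)) = (LINT x|lborel. f x)"
proof -
  have "(LINT x|lborel. f x) = (LINT x|distr lborel borel ((+) h). f x)"
    using lborel_distr_plus[of h] by simp
  also have "\<dots> = (LINT x|lborel. f (x + h))"
    by (subst integral_distr) (auto simp: add.commute)
  finally show ?thesis by simp
qed

lemma lborel_integrable_shift:
  fixes f :: "'a::euclidean_space \<Rightarrow> 'b::{banach, second_countable_topology}"
  assumes f: "integrable lborel f"
  shows "integrable lborel (\<lambda>x. f (x + h))"
proof -
  have [measurable]: "f \<in> borel_measurable borel" using f by auto
  have "integrable (distr lborel borel ((+) h)) f"
    using f lborel_distr_plus[of h] by simp
  then show ?thesis
    by (subst (asm) integrable_distr_eq) (auto simp: add.commute)
qed

lemma ft_shift: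
  fixes H :: "'a::euclidean_space \<Rightarrow> complex"
  assumes [measurable]: "H \<in> borel_measurable borel"
  shows "ft (\<lambda>x. H (x + h)) \<xi> = cis (h \<bullet> \<xi>) * ft H \<xi>"
proof -
  have "ft H \<xi> = (LINT x|lborel. cis (- ((x + h) \<bullet> \<xi>)) * H (x + h))"
    unfolding ft_def using lborel_integral_shift[of "\<lambda>x. cis (- (x \<bullet> \<xi>)) * H x" h] by simp
  also have "\<dots> = (LINT x|lborel. cis (- (h \<bullet> \<xi>)) * (cis (- (x \<bullet> \<xi>)) * H (x + h)))"
    by (simp add: inner_add_left cis_mult[symmetric] mult_ac minus_add_distrib del: cis_mult)
       (simp add: mult.assoc[symmetric] cis_mult)
  also have "\<dots> = cis (- (h \<bullet> \<xi>)) * ft (\<lambda>x. H (x + h)) \<xi>"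
    by (simp add: ft_def)
  finally show ?thesis
    by (simp add: mult.assoc[symmetric] cis_mult)
qed

lemma ft_cong_integrable:
  assumes "integrable lborel H"
  shows "integrable lborel (\<lambda>x. cis (- (x \<bullet> \<xi>)) * H x)"
proof -
  have [measurable]: "H \<in> borel_measurable borel" using assms by auto
  show ?thesis by (rule Bochner_Integration.integrable_bound[OF assms]) (auto simp: norm_mult)
qed

lemma integrable_bounded_support:
  fixes f :: "'a::euclidean_space \<Rightarrow> 'b::{banach, second_countable_topology}"
  assumes "f \<in> borel_measurable borel" and "\<And>x. norm (f x) \<le> K"
      and "\<And>x. norm x > L \<Longrightarrow> f x = 0"
  shows "integrable lborel f"
proof (rule Bochner_Integration.integrable_bound)
  show "integrable lborel (\<lambda>x::'a. indicator (cball 0 L) x * K)"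
    by (rule integrable_mult_left) (auto intro!: integrable_real_indicator emeasure_lborel_cball_finite)
  have "norm (f x) \<le> norm (indicator (cball 0 L) x * K :: real)" for x
    using assms(2)[of x] assms(3)[of x] by (cases "norm x \<le> L") auto
  then show "AE x in lborel. norm (f x) \<le> norm (indicator (cball 0 L) x * K :: real)" by simp
qed (use assms in simp)

text \<open>The steps are the fixed sequence 1/(n+1) because both applications are limits of
  sequences: Borel measurability of a gradient, and dominated convergence in
  \<open>ft_gradient\<close>.\<close>

lemma gradient_difference_quotient:
  assumes "GDERIV \<psi> x :> D"
  shows "(\<lambda>n. (\<psi> (x + (1 / real (Suc n)) *\<^sub>R v)
      - \<psi> x) * real (Suc n)) \<longlonglongrightarrow> D \<bullet> v"
proof -
  have D: "(\<psi> has_derivative (\<lambda>h. D \<bullet> h)) (at x)"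
    using assms by (simp add: gderiv_def inner_commute)
  have l: "((\<lambda>t. x + t *\<^sub>R v) has_derivative (\<lambda>t. t *\<^sub>R v)) (at 0)"
    by (auto intro!: derivative_eq_intros)
  have "((\<lambda>t. \<psi> (x + t *\<^sub>R v)) has_derivative (\<lambda>t. D \<bullet> (t *\<^sub>R v))) (at 0)"
    using has_derivative_compose[OF l, of \<psi> "\<lambda>h. D \<bullet> h"] D by simp
  then have "((\<lambda>t. \<psi> (x + t *\<^sub>R v)) has_real_derivative (D \<bullet> v)) (at 0)"
    unfolding has_field_derivative_def by (rule has_derivative_eq_rhs) (simp add: fun_eq_iff mult.commute)
  then have "(\<lambda>t. (\<psi> (x + t *\<^sub>R v) - \<psi> x) / t) \<midarrow>0\<rightarrow> D \<bullet> v"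
    by (simp add: DERIV_def)
  moreover have "(\<lambda>n. 1 / real (Suc n)) \<longlonglongrightarrow> 0" by (rule LIMSEQ_Suc[OF lim_1_over_n])
  ultimately have "((\<lambda>t. (\<psi> (x + t *\<^sub>R v)
      - \<psi> x) / t) \<circ> (\<lambda>n. 1 / real (Suc n))) \<longlonglongrightarrow> D \<bullet> v"
    unfolding tendsto_at_iff_sequentially by fastforce
  then show ?thesis by (simp add: o_def)
qed

text \<open>Integration by parts for a differentiable \<psi> with bounded gradient. The mean value
  theorem bounds the difference quotients uniformly, so their transforms converge to the transform
  of the derivative. On the other hand each of them is the transform of \<psi> times a difference
  quotient of \<open>cis\<close> at 0, whose limit is i (v \<bullet> \<xi>).\<close>

lemma
  fixes \<psi> :: "'a::euclidean_space \<Rightarrow> real"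
  assumes D: "\<And>x. GDERIV \<psi> x :> D x" and D_bd: "\<And>x. norm (D x) \<le> K"
    and supp: "\<And>x. norm x > L \<Longrightarrow> \<psi> x = 0"
  shows borel_measurable_gradient: "D \<in> borel_measurable borel"
    and gradient_support: "norm x > L \<Longrightarrow> D x = 0"
    and ft_gradient: "ft (\<lambda>x. of_real (D x \<bullet> v)) \<xi>
        = \<i> * of_real (v \<bullet> \<xi>) * ft (\<lambda>x. of_real (\<psi> x)) \<xi>"
proof -
  have cont: "continuous_on UNIV \<psi>"
    using D by (auto simp: continuous_on_eq_continuous_at gderiv_def intro: has_derivative_continuous)
  then have [measurable]: "\<psi> \<in> borel_measurable borel" by (rule borel_measurable_continuous_onI)
  have Dv_meas [measurable]: "(\<lambda>x. D x \<bullet> v) \<in> borel_measurable borel" for v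
    by (rule borel_measurable_LIMSEQ_real[OF gradient_difference_quotient[OF D]]) measurable
  show "D \<in> borel_measurable borel"
  proof -
    have "(\<lambda>x. \<Sum>b\<in>Basis. (D x \<bullet> b) *\<^sub>R b) \<in> borel_measurable borel" by measurable
    then show ?thesis by (simp add: euclidean_representation)
  qed
  show D_supp: "D x = 0" if "norm x > L" for x
  proof -
    have "open {x::'a. norm x > L}" by (intro open_Collect_less continuous_intros)
    then have "GDERIV \<psi> x :> 0"
      unfolding gderiv_def inner_zero_right
      by (rule has_derivative_transform_within_open[OF has_derivative_const[of 0]]) (use that supp in auto)
    then have "(\<lambda>h. h \<bullet> D x) = (\<lambda>h. h \<bullet> 0)"
      using D[of x] unfolding gderiv_def by (rule has_derivative_unique[rotated])
    then show ?thesis by (metis inner_eq_zero_iff inner_zero_right)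
  qed
  have lip: "\<bar>\<psi> y - \<psi> x\<bar> \<le> K * norm (y - x)" for x y
  proof -
    have "norm (\<psi> y - \<psi> x) \<le> K * norm (y - x)"
    proof (rule differentiable_bound[of UNIV \<psi> "\<lambda>x h. h \<bullet> D x"])
      show "(\<psi> has_derivative (\<lambda>h. h \<bullet> D x)) (at x within UNIV)" for x
        using D[of x] by (simp add: gderiv_def)
      show "onorm (\<lambda>h. h \<bullet> D x) \<le> K" for x
      proof (rule onorm_le)
        fix h
        have "norm (h \<bullet> D x) \<le> norm h * norm (D x)" by (simp add: Cauchy_Schwarz_ineq2)
        also have "\<dots> \<le> K * norm h" using mult_right_mono[OF D_bd[of x], of "norm h"]
            by (simp add: mult.commute)
        finally show "norm (h \<bullet> D x) \<le> K * norm h" .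
      qed
    qed auto
    then show ?thesis by simp
  qed
  have K0: "K \<ge> 0" using D_bd[of 0] norm_ge_zero order_trans by blast
  have \<psi>_bd: "\<exists>M. \<forall>x. \<bar>\<psi> x\<bar> \<le> M"
  proof -
    have "bounded (\<psi> ` cball 0 L)"
      by (intro compact_imp_bounded compact_continuous_image continuous_on_subset[OF cont]) auto
    then obtain M where M: "\<forall>x\<in>cball 0 L. \<bar>\<psi> x\<bar> \<le> M" by (auto simp: bounded_iff)
    have "\<bar>\<psi> x\<bar> \<le> max M 0" for x
      using bspec[OF M, of x] supp[of x] by (cases "norm x > L") auto
    then show ?thesis by blast
  qed
  then obtain M where M: "\<And>x. \<bar>\<psi> x\<bar> \<le> M" by blast
  have \<psi>_int: "integrable lborel (\<lambda>x. complex_of_real (\<psi> x))"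
    by (rule integrable_bounded_support[of _ M L]) (use M supp in auto)
  define s where "s n = 1 / real (Suc n)" for n
  have s: "s n > 0" "s n \<le> 1" for n by (auto simp: s_def)
  define q where "q n x = complex_of_real ((\<psi> (x + s n *\<^sub>R v) - \<psi> x) * real (Suc n))" for n x
  have q_lim: "(\<lambda>n. q n x) \<longlonglongrightarrow> of_real (D x \<bullet> v)" for x
    unfolding q_def s_def by (intro tendsto_of_real gradient_difference_quotient D)
  have q_supp: "q n x = 0" if "norm x > L + norm v" for n x
  proof -
    have "norm (s n *\<^sub>R v) \<le> norm v" using s[of n] by (simp add: mult_left_le_one_le)
    then have "norm (x + s n *\<^sub>R v) > L" using that norm_triangle_ineq4[of "x
        + s n *\<^sub>R v" "s n *\<^sub>R v"] by simp
    moreover have "norm x > L" using that norm_ge_zero[of v] by linarith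
    ultimately show ?thesis using supp by (simp add: q_def)
  qed
  have q_bd: "norm (q n x) \<le> K * norm v" for n x
  proof -
    have "norm (q n x) = \<bar>\<psi> (x + s n *\<^sub>R v) - \<psi> x\<bar> * real (Suc n)"
      unfolding q_def norm_of_real by (simp add: abs_mult)
    also have "\<dots> \<le> (K * norm (s n *\<^sub>R v)) * real (Suc n)"
      using lip[of "x + s n *\<^sub>R v" x] by (intro mult_right_mono) auto
    also have "\<dots> = K * norm v" by (simp add: s_def)
    finally show ?thesis .
  qed
  have q_meas [measurable]: "q n \<in> borel_measurable borel" for n
    unfolding q_def by measurable
  have "(\<lambda>n. ft (q n) \<xi>) \<longlonglongrightarrow> ft (\<lambda>x. of_real (D x \<bullet> v)) \<xi>"
    unfolding ft_def
  proof (rule integral_dominated_convergence[where w="\<lambda>x. indicator (cball 0 (L + norm v)) x * (K * norm v)"])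
    show "integrable lborel (\<lambda>x::'a. indicator (cball 0 (L + norm v)) x * (K * norm v))"
      by (rule integrable_mult_left) (auto intro!: integrable_real_indicator emeasure_lborel_cball_finite)
    show "AE x in lborel. (\<lambda>n. cis (- (x \<bullet> \<xi>)) * q n x) \<longlonglongrightarrow> cis (- (x \<bullet> \<xi>)) * of_real (D x \<bullet> v)"
      by (intro AE_I2 tendsto_mult_left q_lim)
    show "AE x in lborel. norm (cis (- (x \<bullet> \<xi>)) * q n x) \<le> indicator (cball 0 (L
        + norm v)) x * (K * norm v)" for n
    proof (intro AE_I2)
      fix x :: 'a
      show "norm (cis (- (x \<bullet> \<xi>)) * q n x) \<le> indicator (cball 0 (L + norm v)) x * (K * norm v)"
        using q_bd[of n x] q_supp[of x n] by (cases "norm x > L + norm v") (auto simp: norm_mult)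
    qed
  qed measurable
  moreover have "(\<lambda>n. ft (q n) \<xi>) \<longlonglongrightarrow> \<i> * of_real (v \<bullet> \<xi>) * ft (\<lambda>x. of_real (\<psi> x)) \<xi>"
  proof -
    have "ft (q n) \<xi> = (cis (s n * (v \<bullet> \<xi>))
        - 1) * real (Suc n) * ft (\<lambda>x. of_real (\<psi> x)) \<xi>" for n
    proof -
      let ?\<Psi> = "\<lambda>x. complex_of_real (\<psi> x)"
      have sh: "integrable lborel (\<lambda>x. ?\<Psi> (x + s n *\<^sub>R v))"
          by (rule lborel_integrable_shift[OF \<psi>_int])
      have "ft (q n) \<xi> = (LINT x|lborel. real (Suc n) * (cis (- (x \<bullet> \<xi>)) * ?\<Psi> (x
          + s n *\<^sub>R v) - cis (- (x \<bullet> \<xi>)) * ?\<Psi> x))"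
        unfolding ft_def q_def by (simp add: algebra_simps)
      also have "\<dots> = real (Suc n) * (ft (\<lambda>x. ?\<Psi> (x + s n *\<^sub>R v)) \<xi> - ft ?\<Psi> \<xi>)"
        unfolding integral_mult_right_zero ft_def
        by (subst Bochner_Integration.integral_diff) (auto intro!: ft_cong_integrable sh \<psi>_int)
      also have "ft (\<lambda>x. ?\<Psi> (x + s n *\<^sub>R v)) \<xi> = cis (s n
          * (v \<bullet> \<xi>)) * ft ?\<Psi> \<xi>"
        by (subst ft_shift) auto
      finally show ?thesis by (simp add: algebra_simps)
    qed
    moreover have "(\<lambda>n. (cis (s n * (v \<bullet> \<xi>))
        - 1) * real (Suc n)) \<longlonglongrightarrow> \<i> * of_real (v \<bullet> \<xi>)"
    proof -
      have "(\<lambda>n. Complex ((cos (s n * c)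
          - 1) * real (Suc n)) (sin (s n * c) * real (Suc n))) \<longlonglongrightarrow> Complex 0 c" for c
      proof (rule tendsto_Complex)
        have "((\<lambda>t. cos (t * c)) has_real_derivative 0) (at 0)" "((\<lambda>t. sin (t * c)) has_real_derivative c) (at 0)"
          by (auto intro!: derivative_eq_intros)
        then have "(\<lambda>t. (cos (t * c)
            - 1) / t) \<midarrow>0\<rightarrow> 0" "(\<lambda>t. sin (t * c) / t) \<midarrow>0\<rightarrow> c"
          by (simp_all add: DERIV_def)
        moreover have "s \<longlonglongrightarrow> 0" unfolding s_def[abs_def] by (rule LIMSEQ_Suc[OF lim_1_over_n])
        ultimately have "((\<lambda>t. (cos (t * c)
            - 1) / t) \<circ> s) \<longlonglongrightarrow> 0" "((\<lambda>t. sin (t * c) / t) \<circ> s) \<longlonglongrightarrow> c"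
          unfolding tendsto_at_iff_sequentially using s(1) by (auto simp: less_imp_neq[symmetric])
        then show "(\<lambda>n. (cos (s n * c)
            - 1) * real (Suc n)) \<longlonglongrightarrow> 0" "(\<lambda>n. sin (s n * c) * real (Suc n)) \<longlonglongrightarrow> c"
          by (simp_all add: o_def s_def del: of_nat_Suc)
      qed
      moreover have "(cis (s n * c) - 1) * real (Suc n) = Complex ((cos (s n * c)
          - 1) * real (Suc n)) (sin (s n * c) * real (Suc n))" for n c
        by (simp add: complex_eq_iff)
      moreover have "\<i> * of_real c = Complex 0 c" for c by (simp add: complex_eq_iff)
      ultimately show ?thesis by simp
    qed
    ultimately show ?thesis by (simp add: tendsto_mult_right)
  qed
  ultimately show "ft (\<lambda>x. of_real (D x \<bullet> v)) \<xi>
      = \<i> * of_real (v \<bullet> \<xi>) * ft (\<lambda>x. of_real (\<psi> x)) \<xi>"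
    by (rule LIMSEQ_unique)
qed

section \<open>Products of two Herglotz waves\<close>

abbreviation (input) sphere_pair :: "('a::euclidean_space \<times> 'a) measure" where
  "sphere_pair \<equiv> sphere_measure \<Otimes>\<^sub>M sphere_measure"

interpretation sphere_pair: pair_sigma_finite "sphere_measure :: 'a::euclidean_space measure" "sphere_measure :: 'a measure"
  by (intro pair_sigma_finite.intro sphere.sigma_finite_measure)

lemma finite_measure_sphere_pair: "finite_measure (sphere_pair :: ('a::euclidean_space \<times> 'a) measure)"
  by (intro finite_measure_pair_measure sphere.finite_measure_axioms)

lemma measurable_sphere_pair_fst [measurable]: "fst \<in> borel_measurable (sphere_pair :: ('a::euclidean_space \<times> 'a) measure)"
  using measurable_compose[OF measurable_fst measurable_sphere_measure[of "\<lambda>x. x"]] by simp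

lemma measurable_sphere_pair_snd [measurable]: "snd \<in> borel_measurable (sphere_pair :: ('a::euclidean_space \<times> 'a) measure)"
  using measurable_compose[OF measurable_snd measurable_sphere_measure[of "\<lambda>x. x"]] by simp

lemma sphere_pair_norm: "p \<in> space sphere_pair \<Longrightarrow> norm (fst p) = 1 \<and> norm (snd p) = 1"
  by (auto simp: space_pair_measure)

lemma sphere_pair_integrable:
  fixes f :: "'a::euclidean_space \<times> 'a \<Rightarrow> complex"
  assumes "f \<in> borel_measurable sphere_pair" "\<And>p. norm (fst p) = 1 \<Longrightarrow> norm (snd p)
      = 1 \<Longrightarrow> cmod (f p) \<le> K"
  shows "integrable sphere_pair f"
proof (rule finite_measure.integrable_const_bound[OF finite_measure_sphere_pair, of _ K])
  show "AE p in sphere_pair. cmod (f p) \<le> K"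
    using sphere_pair_norm assms(2) by (intro AE_I2) blast
qed (rule assms(1))

lemma herglotz_mult:
  fixes b c :: "'a::euclidean_space \<Rightarrow> complex"
  assumes b [measurable]: "b \<in> borel_measurable borel" and b_bd: "\<And>\<omega>. norm \<omega>
      = 1 \<Longrightarrow> cmod (b \<omega>) \<le> K"
    and c [measurable]: "c \<in> borel_measurable borel" and c_bd: "\<And>\<omega>. norm \<omega>
        = 1 \<Longrightarrow> cmod (c \<omega>) \<le> M"
  shows "herglotz R b x * cnj (herglotz R c x)
    = (LINT p|sphere_pair. cis (R * ((fst p - snd p) \<bullet> x)) * (b (fst p) * cnj (c (snd p))))"
proof -
  have K0: "cmod (b (fst p)) * cmod (c (snd p)) \<le> K * M" if "norm (fst p) = 1" "norm (snd p) = 1" for p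
    using b_bd[OF that(1)] c_bd[OF that(2)] by (intro mult_mono) (auto intro: order_trans[OF norm_ge_zero])
  have int: "integrable sphere_pair (\<lambda>(\<omega>, \<sigma>). cis (R * ((\<omega>
      - \<sigma>) \<bullet> x)) * (b \<omega> * cnj (c \<sigma>)))"
    unfolding case_prod_beta'
    by (rule sphere_pair_integrable[of _ "K * M"]) (use K0 in \<open>auto simp: norm_mult\<close>)
  have "(LINT p|sphere_pair. cis (R * ((fst p - snd p) \<bullet> x)) * (b (fst p) * cnj (c (snd p))))
    = (LINT p|sphere_pair. (case p of (\<omega>, \<sigma>) \<Rightarrow> cis (R * ((\<omega>
        - \<sigma>) \<bullet> x)) * (b \<omega> * cnj (c \<sigma>))))"
    by (simp add: case_prod_beta')
  also have "\<dots> = (LINT \<omega>|sphere_measure. LINT \<sigma>|sphere_measure. cis (R * ((\<omega>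
      - \<sigma>) \<bullet> x)) * (b \<omega> * cnj (c \<sigma>)))"
    by (rule sphere_pair.integral_fst[OF int, symmetric])
  also have "\<dots> = (LINT \<omega>|sphere_measure. LINT \<sigma>|sphere_measure. (cis (R
      * (\<omega> \<bullet> x)) * b \<omega>) * cnj (cis (R * (\<sigma> \<bullet> x)) * c \<sigma>))"
  proof -
    have "cis (R * ((\<omega> - \<sigma>) \<bullet> x)) = cis (R * (\<omega> \<bullet> x)) * cnj (cis (R
        * (\<sigma> \<bullet> x)))" for \<omega> \<sigma>
      by (simp add: cis_cnj cis_mult inner_diff_left right_diff_distrib)
    then show ?thesis by (simp only: complex_cnj_mult mult_ac)
  qed
  also have "\<dots> = herglotz R b x * cnj (herglotz R c x)"
    unfolding herglotz_def Bochner_Integration.integral_cnj[symmetric] by simp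
  finally show ?thesis ..
qed

text \<open>Quadratic integrals of waves become double integrals over pairs of frequencies, with the
  transform of the weight evaluated at R (\<sigma> - \<omega>). Identities between such integrals
  can then be checked pointwise in (\<omega>, \<sigma>).\<close>

lemma herglotz_mult_integral:
  fixes b c :: "'a::euclidean_space \<Rightarrow> complex"
  assumes g: "integrable lborel g"
    and b [measurable]: "b \<in> borel_measurable borel" and b_bd: "\<And>\<omega>. norm \<omega>
        = 1 \<Longrightarrow> cmod (b \<omega>) \<le> K"
    and c [measurable]: "c \<in> borel_measurable borel" and c_bd: "\<And>\<omega>. norm \<omega>
        = 1 \<Longrightarrow> cmod (c \<omega>) \<le> M"
  shows "(LINT x|lborel. g x * (herglotz R b x * cnj (herglotz R c x)))
    = (LINT p|sphere_pair. (b (fst p) * cnj (c (snd p))) * ft g (R *\<^sub>R (snd p - fst p)))"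
proof -
  have K0: "cmod (b (fst p)) * cmod (c (snd p)) \<le> K * M" if "norm (fst p) = 1" "norm (snd p) = 1" for p
    using b_bd[OF that(1)] c_bd[OF that(2)] by (intro mult_mono) (auto intro: order_trans[OF norm_ge_zero])
  have "(LINT x|lborel. g x * (herglotz R b x * cnj (herglotz R c x)))
    = (LINT x|lborel. g x * (LINT p|sphere_pair. cis (R * ((fst p - snd p) \<bullet> x))
        * (b (fst p) * cnj (c (snd p)))))"
    by (simp only: herglotz_mult[OF assms(2-5)])
  also have "\<dots> = (LINT p|sphere_pair. (b (fst p) * cnj (c (snd p))) * (LINT x|lborel. cis (R * ((fst p
      - snd p) \<bullet> x)) * g x))"
  proof (rule fubini_kernel[where K=1])
    show "sigma_finite_measure (sphere_pair :: ('a \<times> 'a) measure)"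
      by (rule finite_measure.sigma_finite_measure[OF finite_measure_sphere_pair])
    show "integrable sphere_pair (\<lambda>p. b (fst p) * cnj (c (snd p)))"
      by (rule sphere_pair_integrable[of _ "K * M"]) (use K0 in \<open>auto simp: norm_mult\<close>)
    show "(\<lambda>(x, p). cis (R * ((fst p
        - snd p) \<bullet> x))) \<in> borel_measurable (lborel \<Otimes>\<^sub>M (sphere_pair :: ('a \<times> 'a) measure))"
      by measurable
  qed (use g in \<open>auto simp: lborel.sigma_finite_measure_axioms\<close>)
  also have "\<dots> = (LINT p|sphere_pair. (b (fst p) * cnj (c (snd p))) * ft g (R *\<^sub>R (snd p - fst p)))"
    unfolding ft_def by (simp add: inner_diff_left inner_diff_right inner_commute algebra_simps)
  finally show ?thesis .
qed

text \<open>\<open>u v\<close> is the derivative of the wave in the direction v divided by i R. The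
  classical proof tests the Helmholtz equation against the normal derivative; here the identity is
  verified in frequency space, where every term carries the transform of \<psi> at R (\<sigma> -
  \<omega>) and the coefficients cancel because \<omega> and \<sigma> both have length 1.\<close>

lemma rellich_identity:
  fixes \<psi> :: "'a::euclidean_space \<Rightarrow> real" and a :: "'a \<Rightarrow> complex" and R :: real
  assumes D: "\<And>x. GDERIV \<psi> x :> D x" and D_bd: "\<And>x. norm (D x) \<le> K"
    and supp: "\<And>x. norm x > L \<Longrightarrow> \<psi> x = 0"
    and a [measurable]: "a \<in> borel_measurable borel" and a_bd: "\<And>\<omega>. norm \<omega>
        = 1 \<Longrightarrow> cmod (a \<omega>) \<le> A"
  defines "u \<equiv> \<lambda>v. herglotz R (\<lambda>\<omega>. of_real (\<omega> \<bullet> v) * a \<omega>)"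
  shows "(LINT x|lborel. (\<Sum>b\<in>Basis. (D x \<bullet> b) * (2 * Re (cnj (u n x) * u b x)))
      + (D x \<bullet> n) * ((cmod (herglotz R a x))\<^sup>2 - (\<Sum>b\<in>Basis. (cmod (u b x))\<^sup>2))) = 0"
proof -
  have A0: "A \<ge> 0" using a_bd[of "SOME b. b \<in> Basis"] norm_ge_zero order_trans some_in_eq[of Basis] nonempty_Basis
    by (metis norm_Basis)
  define o' where "o' v = (\<lambda>\<omega>. of_real (\<omega> \<bullet> v) * a \<omega>)" for v
  define Dv where "Dv v = (\<lambda>x. complex_of_real (D x \<bullet> v))" for v
  have [measurable]: "D \<in> borel_measurable borel" by (rule borel_measurable_gradient[OF D D_bd supp])
  have o'_meas [measurable]: "o' v \<in> borel_measurable borel" for v unfolding o'_def by measurable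
  have o'_bd: "cmod (o' v \<omega>) \<le> norm v * A" if "norm \<omega> = 1" for v \<omega>
    unfolding o'_def norm_mult norm_of_real
    using Cauchy_Schwarz_ineq2[of \<omega> v] that a_bd[OF that] by (intro mult_mono) auto
  have Dv_meas [measurable]: "Dv v \<in> borel_measurable borel" for v unfolding Dv_def by measurable
  have Dv_bd: "cmod (Dv v x) \<le> K * norm v" for v x
    unfolding Dv_def norm_of_real
    by (rule order_trans[OF Cauchy_Schwarz_ineq2]) (intro mult_right_mono D_bd norm_ge_zero)
  have Dv_int: "integrable lborel (Dv v)" for v
    by (rule integrable_bounded_support[OF Dv_meas Dv_bd, of L])
      (simp add: Dv_def gradient_support[OF D D_bd supp])
  define T where "T v b c = (\<lambda>x. Dv v x * (herglotz R b x * cnj (herglotz R c x)))" for v b c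
  define k where "k v b c = (\<lambda>p. (b (fst p) * cnj (c (snd p))) * ft (Dv v) (R *\<^sub>R (snd p
      - fst p)))" for v and b c :: "'a \<Rightarrow> complex"
  \<comment> \<open>Bounded Borel densities: the class in which every use of Fubini is
    legitimate.\<close>
  define good where "good b \<longleftrightarrow> b \<in> borel_measurable borel
      \<and> (\<exists>M. \<forall>\<omega>. norm \<omega> = 1 \<longrightarrow> cmod (b \<omega>)
      \<le> M)" for b :: "'a \<Rightarrow> complex"
  have good: "good a" "good (o' v)" for v
    unfolding good_def using a_bd o'_bd by auto
  have T_int: "integrable lborel (T v b c)" if "good b" "good c" for v b c
  proof -
    from that obtain M N where [measurable]: "b \<in> borel_measurable borel" "c \<in> borel_measurable borel"
      and M: "\<And>\<omega>. norm \<omega> = 1 \<Longrightarrow> cmod (b \<omega>) \<le> M"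
          and N: "\<And>\<omega>. norm \<omega> = 1 \<Longrightarrow> cmod (c \<omega>) \<le> N"
      unfolding good_def by blast
    have [measurable]: "herglotz R b \<in> borel_measurable borel" "herglotz R c \<in> borel_measurable borel" by auto
    show ?thesis
    proof (rule integrable_bounded_support[of _ "(K * norm v)
        * ((LINT \<omega>|sphere_measure. cmod (b \<omega>)) * (LINT \<omega>|sphere_measure. cmod (c \<omega>)))" L])
      show "T v b c \<in> borel_measurable borel" unfolding T_def by measurable
      show "norm (T v b c x) \<le> (K * norm v) * ((LINT \<omega>|sphere_measure. cmod (b \<omega>))
          * (LINT \<omega>|sphere_measure. cmod (c \<omega>)))" for x
      proof -
        have "cmod (herglotz R b x)
            \<le> (LINT \<omega>|sphere_measure. cmod (b \<omega>))" "cmod (herglotz R c x)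
            \<le> (LINT \<omega>|sphere_measure. cmod (c \<omega>))"
          by (auto intro!: cmod_herglotz_le M N)
        then show ?thesis
          unfolding T_def norm_mult complex_mod_cnj
          by (intro mult_mono Dv_bd) (auto intro: order_trans[OF norm_ge_zero Dv_bd])
      qed
      show "T v b c x = 0" if "norm x > L" for x
        using gradient_support[OF D D_bd supp that] by (simp add: T_def Dv_def)
    qed
  qed
  have k_int: "integrable sphere_pair (k v b c)" if "good b" "good c" for v b c
  proof -
    from that obtain M N where [measurable]: "b \<in> borel_measurable borel" "c \<in> borel_measurable borel"
      and M: "\<And>\<omega>. norm \<omega> = 1 \<Longrightarrow> cmod (b \<omega>) \<le> M"
          and N: "\<And>\<omega>. norm \<omega> = 1 \<Longrightarrow> cmod (c \<omega>) \<le> N"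
      unfolding good_def by blast
    have [measurable]: "ft (Dv v) \<in> borel_measurable borel" by (rule measurable_ft) simp
    show ?thesis
    proof (rule sphere_pair_integrable[of _ "(M * N) * (LINT x|lborel. cmod (Dv v x))"])
      show "k v b c \<in> borel_measurable sphere_pair" unfolding k_def by measurable
      show "cmod (k v b c p) \<le> (M * N) * (LINT x|lborel. cmod (Dv v x))" if "norm (fst p)
          = 1" "norm (snd p) = 1" for p
        unfolding k_def norm_mult complex_mod_cnj using M[OF that(1)] N[OF that(2)]
        by (intro mult_mono cmod_ft_le) (auto intro: order_trans[OF norm_ge_zero] intro!: mult_nonneg_nonneg)
    qed
  qed
  have T_k: "(LINT x|lborel. T v b c x) = (LINT p|sphere_pair. k v b c p)" if "good b" "good c" for v b c
    using that unfolding good_def T_def k_def by (auto intro!: herglotz_mult_integral[OF Dv_int])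
  let ?X = "\<lambda>Y x. (\<Sum>b\<in>Basis. Y b (o' b) (o' n) x + Y b (o' n) (o' b) x) + (Y n a a x
      - (\<Sum>b\<in>Basis. Y n (o' b) (o' b) x)) :: complex"
  have "(LINT x|lborel. ?X T x) = (\<Sum>b\<in>Basis. (LINT x|lborel. T b (o' b) (o' n) x)
      + (LINT x|lborel. T b (o' n) (o' b) x))
      + ((LINT x|lborel. T n a a x) - (\<Sum>b\<in>Basis. LINT x|lborel. T n (o' b) (o' b) x))"
    by (simp add: Bochner_Integration.integral_add Bochner_Integration.integral_diff Bochner_Integration.integral_sum
        Bochner_Integration.integrable_sum T_int good)
  also have "\<dots> = (\<Sum>b\<in>Basis. (LINT x|sphere_pair. k b (o' b) (o' n) x)
      + (LINT x|sphere_pair. k b (o' n) (o' b) x))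
      + ((LINT x|sphere_pair. k n a a x) - (\<Sum>b\<in>Basis. LINT x|sphere_pair. k n (o' b) (o' b) x))"
    by (simp add: T_k good)
  also have "\<dots> = (LINT p|sphere_pair. ?X k p)"
    by (simp add: Bochner_Integration.integral_add Bochner_Integration.integral_diff Bochner_Integration.integral_sum
        Bochner_Integration.integrable_sum k_int good)
  also have "\<dots> = (LINT p|(sphere_pair :: ('a \<times> 'a) measure). 0)"
  proof (rule Bochner_Integration.integral_cong[OF refl])
    fix p :: "'a \<times> 'a" assume p: "p \<in> space sphere_pair"
    obtain \<omega> \<sigma> where [simp]: "p = (\<omega>, \<sigma>)" by (cases p)
    have nm: "\<omega> \<bullet> \<omega> = 1" "\<sigma> \<bullet> \<sigma> = 1"
        using sphere_pair_norm[OF p] by (auto simp: norm_eq_1)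
    define \<delta> where "\<delta> = \<sigma> - \<omega>"
    \<comment> \<open>The factor common to all terms; the derivative of \<psi> in the direction v
      contributes v \<bullet> \<delta> on top of it.\<close>
    define Z where "Z = \<i> * of_real R * ft (\<lambda>x. of_real (\<psi> x)) (R *\<^sub>R \<delta>) * a \<omega> * cnj (a \<sigma>)"
    have ftD: "ft (Dv v) (R *\<^sub>R \<delta>)
        = \<i> * of_real R * of_real (v \<bullet> \<delta>) * ft (\<lambda>x. of_real (\<psi> x)) (R *\<^sub>R \<delta>)" for v
      unfolding Dv_def using ft_gradient[OF D D_bd supp, where v=v and \<xi>="R *\<^sub>R \<delta>"] by simp
    have kk: "k v (o' b) (o' c) p = Z * of_real ((v \<bullet> \<delta>) * ((\<omega> \<bullet> b)
        * (\<sigma> \<bullet> c)))"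
      "k v a a p = Z * of_real (v \<bullet> \<delta>)" for v b c
      by (simp_all add: k_def o'_def ftD Z_def \<delta>_def[symmetric] mult_ac)
    have "?X k p = Z * of_real ((\<Sum>b\<in>Basis. (b \<bullet> \<delta>) * ((\<omega> \<bullet> b)
        * (\<sigma> \<bullet> n)) + (b \<bullet> \<delta>) * ((\<omega> \<bullet> n) * (\<sigma> \<bullet> b)))
        + ((n \<bullet> \<delta>) - (\<Sum>b\<in>Basis. (n \<bullet> \<delta>) * ((\<omega> \<bullet> b)
            * (\<sigma> \<bullet> b)))))"
      unfolding kk by (simp only: of_real_add of_real_diff of_real_sum distrib_left right_diff_distrib sum_distrib_left)
    also have "(\<Sum>b\<in>Basis. (b \<bullet> \<delta>) * ((\<omega> \<bullet> b) * (\<sigma> \<bullet> n))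
        + (b \<bullet> \<delta>) * ((\<omega> \<bullet> n) * (\<sigma> \<bullet> b)))
      = (\<delta> \<bullet> \<omega>) * (\<sigma> \<bullet> n) + (\<delta> \<bullet> \<sigma>) * (\<omega> \<bullet> n)"
    proof -
      have "(\<delta> \<bullet> \<omega>) = (\<Sum>b\<in>Basis. (b \<bullet> \<delta>)
          * (\<omega> \<bullet> b))" "(\<delta> \<bullet> \<sigma>)
          = (\<Sum>b\<in>Basis. (b \<bullet> \<delta>) * (\<sigma> \<bullet> b))"
        by (subst euclidean_inner, simp add: inner_commute)+
      then show ?thesis
        by (simp add: sum.distrib sum_distrib_left sum_distrib_right mult_ac)
    qed
    also have "(\<Sum>b\<in>Basis. (n \<bullet> \<delta>) * ((\<omega> \<bullet> b)
        * (\<sigma> \<bullet> b))) = (n \<bullet> \<delta>) * (\<omega> \<bullet> \<sigma>)"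
      by (subst (2) euclidean_inner) (simp add: sum_distrib_left)
    \<comment> \<open>For unit vectors \<delta> \<bullet> \<omega> = - (\<delta> \<bullet> \<sigma>)
      = \<omega> \<bullet> \<sigma> - 1, so the first two terms combine to (\<omega> \<bullet>
      \<sigma> - 1) (n \<bullet> \<delta>).\<close>
    also have "(\<delta> \<bullet> \<omega>) * (\<sigma> \<bullet> n) + (\<delta> \<bullet> \<sigma>)
        * (\<omega> \<bullet> n) + ((n \<bullet> \<delta>) - (n \<bullet> \<delta>)
        * (\<omega> \<bullet> \<sigma>)) = 0"
      using nm by (simp add: \<delta>_def inner_diff_left inner_diff_right inner_commute algebra_simps)
    finally show "?X k p = 0" by simp
  qed
  also have "\<dots> = 0" by simp
  finally have X0: "(LINT x|lborel. ?X T x) = 0" .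
  have u_o': "u v = herglotz R (o' v)" for v by (simp add: u_def o'_def)
  have "complex_of_real ((\<Sum>b\<in>Basis. (D x \<bullet> b) * (2 * Re (cnj (u n x) * u b x)))
      + (D x \<bullet> n) * ((cmod (herglotz R a x))\<^sup>2 - (\<Sum>b\<in>Basis. (cmod (u b x))\<^sup>2)))
          = ?X T x" for x
  proof -
    have re: "complex_of_real (2 * Re (cnj z * w)) = w * cnj z + z * cnj w" for z w
      using complex_add_cnj[of "w * cnj z"] by (simp add: mult.commute)
    show ?thesis
      unfolding T_def Dv_def u_o' of_real_add of_real_sum of_real_mult[of "D x \<bullet> _"] of_real_diff re complex_norm_square
      by (simp only: distrib_left right_diff_distrib sum_distrib_left)
  qed
  then have "complex_of_real (LINT x|lborel. (\<Sum>b\<in>Basis. (D x \<bullet> b) * (2 * Re (cnj (u n x) * u b x)))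
      + (D x \<bullet> n) * ((cmod (herglotz R a x))\<^sup>2 - (\<Sum>b\<in>Basis. (cmod (u b x))\<^sup>2))) = 0"
    unfolding integral_complex_of_real[symmetric] X0[symmetric] by simp
  then show ?thesis by (simp only: of_real_eq_0_iff)
qed

section \<open>Frequencies transversal to the boundary\<close>

lemma DERIV_positive_part_square: "((\<lambda>t::real. (max 0 t)\<^sup>2) has_real_derivative 2 * max 0 t) (at t)"
proof -
  consider "t > 0" | "t < 0" | "t = 0" by linarith
  then show ?thesis
  proof cases
    case 1
    have "((\<lambda>t::real. t\<^sup>2) has_real_derivative 2 * max 0 t) (at t)"
      using 1 by (auto intro!: derivative_eq_intros)
    then show ?thesis
      by (rule has_field_derivative_transform_within_open[of _ _ _ "{0<..}"]) (use 1 in auto)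
  next
    case 2
    have "((\<lambda>t::real. 0) has_real_derivative 2 * max 0 t) (at t)"
      using 2 by (auto intro!: derivative_eq_intros)
    then show ?thesis
      by (rule has_field_derivative_transform_within_open[of _ _ _ "{..<0}"]) (use 2 in auto)
  next
    case 3
    have "(\<lambda>h. (max 0 h)\<^sup>2 / h) \<midarrow>0\<rightarrow> (0::real)"
    proof (rule Lim_null_comparison)
      have "norm ((max 0 h)\<^sup>2 / h) \<le> \<bar>h\<bar>" for h :: real
        by (cases "h > 0") (auto simp: power2_eq_square max_def)
      then show "\<forall>\<^sub>F h in at 0. norm ((max 0 h)\<^sup>2 / h) \<le> \<bar>h :: real\<bar>" by simp
      show "((\<lambda>h::real. \<bar>h\<bar>) \<longlongrightarrow> 0) (at 0)"
        by (rule tendsto_rabs_zero[OF tendsto_ident_at])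
    qed
    then show ?thesis using 3 by (simp add: DERIV_def)
  qed
qed

text \<open>Squaring the positive part makes the function differentiable across the edge of the
  ball, with gradient at most 4/\<rho>; a multiplier differentiable everywhere is what
  \<open>rellich_identity\<close> requires.\<close>

definition bump :: "real \<Rightarrow> 'a::euclidean_space \<Rightarrow> 'a \<Rightarrow> real" where
  "bump \<rho> c x = (max 0 (1 - ((x - c) \<bullet> (x - c)) / \<rho>\<^sup>2))\<^sup>2"

definition bump_grad :: "real \<Rightarrow> 'a::euclidean_space \<Rightarrow> 'a \<Rightarrow> 'a" where
  "bump_grad \<rho> c x = (2 * max 0 (1 - ((x - c) \<bullet> (x
      - c)) / \<rho>\<^sup>2)) *\<^sub>R (- (2 / \<rho>\<^sup>2)) *\<^sub>R (x - c)"

lemma GDERIV_bump: "GDERIV (bump \<rho> c) x :> bump_grad \<rho> c x"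
proof -
  have "GDERIV (\<lambda>x. 1 - ((x - c) \<bullet> (x
      - c)) / \<rho>\<^sup>2) x :> (- (2 / \<rho>\<^sup>2)) *\<^sub>R (x - c)"
    unfolding gderiv_def
    by (auto intro!: derivative_eq_intros simp: fun_eq_iff inner_commute divide_inverse algebra_simps)
  then show ?thesis
    unfolding bump_def[abs_def] bump_grad_def
    by (rule GDERIV_DERIV_compose[OF _ DERIV_positive_part_square])
qed

lemma bump_range: "0 \<le> bump \<rho> c x" "bump \<rho> c x \<le> 1"
  by (auto simp: bump_def intro!: power_le_one)

lemma bump_eq_0:
  assumes "\<rho> > 0" "\<rho> \<le> norm (x - c)"
  shows "bump \<rho> c x = 0" "bump_grad \<rho> c x = 0"
proof -
  have "\<rho>\<^sup>2 \<le> (x - c) \<bullet> (x - c)"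
    using power_mono[OF assms(2), of 2] assms(1) by (simp add: power2_norm_eq_inner)
  then have "max 0 (1 - ((x - c) \<bullet> (x - c)) / \<rho>\<^sup>2) = 0"
    using assms(1) by (simp add: max_def field_simps)
  then show "bump \<rho> c x = 0" "bump_grad \<rho> c x = 0" by (simp_all add: bump_def bump_grad_def)
qed

lemma bump_ge:
  assumes "\<rho> > 0" "norm (x - c) \<le> \<rho> / 2"
  shows "9/16 \<le> bump \<rho> c x"
proof -
  have "(x - c) \<bullet> (x - c) \<le> (\<rho> / 2)\<^sup>2"
    using power_mono[OF assms(2), of 2] by (simp add: power2_norm_eq_inner)
  then have "3/4 \<le> 1 - ((x - c) \<bullet> (x - c)) / \<rho>\<^sup>2"
    using assms(1) by (simp add: field_simps power2_eq_square)
  then have "3/4 \<le> max 0 (1 - ((x - c) \<bullet> (x - c)) / \<rho>\<^sup>2)" by (rule max.coboundedI2)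
  then have "(3/4)\<^sup>2 \<le> (max 0 (1 - ((x - c) \<bullet> (x - c)) / \<rho>\<^sup>2))\<^sup>2"
      by (rule power_mono) simp
  then show ?thesis by (simp add: bump_def power2_eq_square)
qed

lemma norm_bump_grad_le:
  assumes "\<rho> > 0"
  shows "norm (bump_grad \<rho> c x) \<le> 4 / \<rho>"
proof (cases "\<rho> \<le> norm (x - c)")
  case True
  then show ?thesis using assms by (simp add: bump_eq_0)
next
  case False
  define t where "t = max 0 (1 - ((x - c) \<bullet> (x - c)) / \<rho>\<^sup>2)"
  have t: "0 \<le> t" "t \<le> 1" by (auto simp: t_def)
  have "norm (bump_grad \<rho> c x) = 2 * t * (2 / \<rho>\<^sup>2 * norm (x - c))"
    using assms t(1) by (simp add: bump_grad_def t_def[symmetric])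
  also have "\<dots> \<le> 2 * 1 * (2 / \<rho>\<^sup>2 * \<rho>)"
    using assms t False by (intro mult_mono mult_left_mono) auto
  also have "\<dots> = 4 / \<rho>" using assms by (simp add: power2_eq_square)
  finally show ?thesis .
qed

text \<open>With m = n, w = 1 and y = 0 the right-hand side is |u0|^2 + |un|^2 minus the squared
  tangential part of U. Replacing n by m costs 1/20 of |u0|^2 and 3/20 of the full square of U: 2/20
  from the cross term and 1/20 from m \<bullet> n. This gives 19/20 and 23/20, and the nonnegative
  multiple of |un|^2 that remains is dropped.\<close>

lemma rellich_pointwise:
  fixes U :: "'a::euclidean_space \<Rightarrow> complex" and n m y :: 'a
  assumes n: "norm n = 1" and m: "norm (m - n) \<le> 1/20" and w: "w \<ge> 0"
  defines "un \<equiv> (\<Sum>b\<in>Basis. of_real (n \<bullet> b) * U b)"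
  shows "w * (19/20 * (cmod u0)\<^sup>2 - 23/20 * (\<Sum>b\<in>Basis. (cmod (U b
      - of_real (n \<bullet> b) * un))\<^sup>2))
      - norm y * (3 * (\<Sum>b\<in>Basis. (cmod (U b))\<^sup>2) + (cmod u0)\<^sup>2)
    \<le> (\<Sum>b\<in>Basis. ((w *\<^sub>R m + y) \<bullet> b) * (2 * Re (cnj un * U b)))
      + ((w *\<^sub>R m + y) \<bullet> n) * ((cmod u0)\<^sup>2 - (\<Sum>b\<in>Basis. (cmod (U b))\<^sup>2))"
proof -
  define Z where "Z p = (\<Sum>b\<in>Basis. of_real (p \<bullet> b) * U b)" for p :: 'a
  define V where "V = (\<Sum>b\<in>Basis. (cmod (U b))\<^sup>2)"
  define k where "k = m - n"
  have V0: "V \<ge> 0" by (simp add: V_def sum_nonneg)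
  have Z_le: "cmod (Z p) \<le> norm p * sqrt V" for p
  proof -
    have "(cmod (Z p))\<^sup>2 \<le> (norm p)\<^sup>2 * V"
      unfolding Z_def V_def norm_power2_Basis[of p] by (rule cmod_sum_mult_le)
    then show ?thesis using V0
      by (metis abs_norm_cancel norm_ge_zero power_mult_distrib real_le_rsqrt real_sqrt_abs real_sqrt_mult)
  qed
  have un: "un = Z n" by (simp add: un_def Z_def)
  have un_le: "cmod un \<le> sqrt V" using Z_le[of n] n by (simp add: un)
  have cross: "\<bar>2 * Re (cnj un * Z p)\<bar> \<le> 2 * norm p * V" for p
  proof -
    have "\<bar>Re (cnj un * Z p)\<bar> \<le> cmod un * cmod (Z p)"
      using abs_Re_le_cmod[of "cnj un * Z p"] by (simp add: norm_mult)
    also have "\<dots> \<le> sqrt V * (norm p * sqrt V)"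
      using V0 by (intro mult_mono un_le Z_le) auto
    also have "\<dots> = norm p * V" using V0 by (simp add: mult.left_commute)
    finally show ?thesis by simp
  qed
  have sumZ: "(\<Sum>b\<in>Basis. (p \<bullet> b) * (2 * Re (cnj un * U b))) = 2 * Re (cnj un * Z p)" for p
    unfolding Z_def sum_distrib_left Re_sum
    by (intro sum.cong refl) (simp add: algebra_simps)
  have Z_add: "Z (p + q) = Z p + Z q" and Z_scale: "Z (t *\<^sub>R p) = of_real t * Z p" for p q t
    by (simp_all add: Z_def inner_add_left distrib_right sum.distrib sum_distrib_left mult.assoc)
  have V': "(\<Sum>b\<in>Basis. (cmod (U b - of_real (n \<bullet> b) * un))\<^sup>2) = V - (cmod un)\<^sup>2"
  proof -
    have "(cmod (U b - of_real (n \<bullet> b) * un))\<^sup>2 = (cmod (U b))\<^sup>2 - (n \<bullet> b)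
        * (2 * Re (cnj un * U b)) + (n \<bullet> b)\<^sup>2 * (cmod un)\<^sup>2" for b
      unfolding cmod_power2 by (simp add: algebra_simps power2_eq_square)
    then have "(\<Sum>b\<in>Basis. (cmod (U b - of_real (n \<bullet> b) * un))\<^sup>2) = V
        - 2 * Re (cnj un * Z n) + (\<Sum>b\<in>Basis. (n \<bullet> b)\<^sup>2) * (cmod un)\<^sup>2"
      by (simp only: sum.distrib sum_subtractf sumZ V_def sum_distrib_right)
    also have "(\<Sum>b\<in>Basis. (n \<bullet> b)\<^sup>2) = 1" using n by (simp add: norm_power2_Basis[symmetric])
    also have "Re (cnj un * Z n) = (cmod un)\<^sup>2"
      unfolding un[symmetric] cmod_power2 by (simp add: power2_eq_square)
    finally show ?thesis by simp
  qed
  have kn: "\<bar>k \<bullet> n\<bar> \<le> 1/20"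
    using Cauchy_Schwarz_ineq2[of k n] m n by (simp add: k_def)
  have mn: "m \<bullet> n = 1 + k \<bullet> n"
    using n by (simp add: k_def inner_diff_left norm_eq_1)
  have m_part: "2 * Re (cnj un * Z m) + (m \<bullet> n) * ((cmod u0)\<^sup>2 - V)
    \<ge> 19/20 * (cmod u0)\<^sup>2 - 23/20 * (V - (cmod un)\<^sup>2)"
  proof -
    have "Z m = un + Z k" using Z_add[of n k] by (simp add: un k_def)
    then have "2 * Re (cnj un * Z m) = 2 * (cmod un)\<^sup>2 + 2 * Re (cnj un * Z k)"
      unfolding cmod_power2 by (simp add: algebra_simps power2_eq_square)
    moreover have "2 * Re (cnj un * Z k) \<ge> - (2 * (1/20) * V)"
    proof -
      have "2 * norm k * V \<le> 2 * (1/20) * V" using m V0 by (intro mult_right_mono) (auto simp: k_def)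
      then show ?thesis using cross[of k] by linarith
    qed
    moreover have "(k \<bullet> n) * (cmod u0)\<^sup>2 \<ge> - ((1/20) * (cmod u0)\<^sup>2)"
      using kn mult_right_mono[of "- (1/20)" "k \<bullet> n" "(cmod u0)\<^sup>2"] by (simp add: abs_le_iff)
    moreover have "(k \<bullet> n) * V \<le> (1/20) * V"
      using kn V0 by (intro mult_right_mono) auto
    moreover have "(cmod un)\<^sup>2 \<ge> 0" by simp
    moreover have e: "2 * Re (cnj un * Z m) + (m \<bullet> n) * ((cmod u0)\<^sup>2 - V)
        = 2 * Re (cnj un * Z m) + (cmod u0)\<^sup>2 - V + (k \<bullet> n) * (cmod u0)\<^sup>2 - (k \<bullet> n) * V"
      unfolding mn by (simp add: algebra_simps)
    ultimately show ?thesis unfolding e by argo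
  qed
  \<comment> \<open>Of the three units of V, two come from the cross term and one from y \<bullet>
    n.\<close>
  have y_part: "2 * Re (cnj un * Z y) + (y \<bullet> n) * ((cmod u0)\<^sup>2 - V) \<ge> - norm y * (3 * V
      + (cmod u0)\<^sup>2)"
  proof -
    have "\<bar>y \<bullet> n\<bar> \<le> norm y" using Cauchy_Schwarz_ineq2[of y n] n by simp
    then have "\<bar>(y \<bullet> n) * ((cmod u0)\<^sup>2 - V)\<bar> \<le> norm y * ((cmod u0)\<^sup>2 + V)"
      unfolding abs_mult using V0 by (intro mult_mono) (auto simp: abs_le_iff)
    then show ?thesis using cross[of y] by (simp add: algebra_simps abs_le_iff)
  qed
  have "w * (2 * Re (cnj un * Z m) + (m \<bullet> n) * ((cmod u0)\<^sup>2 - V)) \<ge> w * (19/20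
      * (cmod u0)\<^sup>2 - 23/20 * (V - (cmod un)\<^sup>2))"
    by (rule mult_left_mono[OF m_part w])
  moreover have "2 * Re (cnj un * Z (w *\<^sub>R m + y)) = w * (2 * Re (cnj un * Z m)) + 2 * Re (cnj un * Z y)"
    by (simp add: Z_add Z_scale algebra_simps)
  ultimately show ?thesis
    unfolding sumZ V' V_def[symmetric] using y_part by (simp add: inner_add_left algebra_simps)
qed

section \<open>Bounded densities on the sphere\<close>

definition sphere_fun :: "('a::euclidean_space \<Rightarrow> complex) \<Rightarrow> bool" where
  "sphere_fun a \<longleftrightarrow> a \<in> borel_measurable borel
      \<and> (\<exists>K. \<forall>\<omega>. norm \<omega> = 1 \<longrightarrow> cmod (a \<omega>) \<le> K)"

definition sphere_L2 :: "('a::euclidean_space \<Rightarrow> complex) \<Rightarrow> real" where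
  "sphere_L2 a = (LINT \<omega>|sphere_measure. (cmod (a \<omega>))\<^sup>2)"

lemma sphere_fun_scale:
  assumes "sphere_fun a"
  shows "sphere_fun (\<lambda>\<omega>. of_real (\<omega> \<bullet> v) * a \<omega>)"
proof -
  from assms obtain K where [measurable]: "a \<in> borel_measurable borel"
      and K: "\<And>\<omega>. norm \<omega> = 1 \<Longrightarrow> cmod (a \<omega>) \<le> K"
    unfolding sphere_fun_def by blast
  have "cmod (of_real (\<omega> \<bullet> v) * a \<omega>) \<le> norm v * K" if "norm \<omega> = 1" for \<omega>
    unfolding norm_mult norm_of_real
    using Cauchy_Schwarz_ineq2[of \<omega> v] that K[OF that] by (intro mult_mono) auto
  then show ?thesis unfolding sphere_fun_def by auto
qed

lemma sphere_integrable_sq: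
  assumes "sphere_fun a"
  shows "integrable sphere_measure (\<lambda>\<omega>. (cmod (a \<omega>))\<^sup>2)"
proof -
  from assms obtain K where [measurable]: "a \<in> borel_measurable borel"
      and K: "\<And>\<omega>. norm \<omega> = 1 \<Longrightarrow> cmod (a \<omega>) \<le> K"
    unfolding sphere_fun_def by blast
  show ?thesis
    by (rule sphere.integrable_const_bound[of _ "K\<^sup>2"]) (auto intro!: AE_I2 power_mono K)
qed

lemma sphere_L2_nonneg: "sphere_L2 a \<ge> 0"
  by (simp add: sphere_L2_def)

lemma sphere_L2_nn:
  assumes "sphere_fun a"
  shows "(\<integral>\<^sup>+\<omega>. ennreal ((cmod (a \<omega>))\<^sup>2) \<partial>sphere_measure)
      = ennreal (sphere_L2 a)"
  unfolding sphere_L2_def by (rule nn_integral_eq_integral[OF sphere_integrable_sq[OF assms]]) simp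

lemma herglotz_measurable': "sphere_fun a \<Longrightarrow> herglotz R a \<in> borel_measurable borel"
  by (rule borel_measurable_herglotz) (simp add: sphere_fun_def)

lemma herglotz_bounded: "sphere_fun a \<Longrightarrow> cmod (herglotz R a x)
    \<le> (LINT \<omega>|sphere_measure. cmod (a \<omega>))"
  unfolding sphere_fun_def using cmod_herglotz_le[of a] by blast

lemma herglotz_sq_integrable:
  assumes a: "sphere_fun a" and g: "g \<in> borel_measurable borel" "\<And>x. \<bar>g x\<bar>
      \<le> K" "\<And>x. norm x > L \<Longrightarrow> g x = 0"
  shows "integrable lborel (\<lambda>x. g x * (cmod (herglotz R a x))\<^sup>2)"
proof (rule integrable_bounded_support)
  have [measurable]: "herglotz R a \<in> borel_measurable borel" "g \<in> borel_measurable borel"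
    using a g by (auto intro: herglotz_measurable')
  show "(\<lambda>x. g x * (cmod (herglotz R a x))\<^sup>2) \<in> borel_measurable borel" by measurable
  show "norm (g x * (cmod (herglotz R a x))\<^sup>2) \<le> K
      * (LINT \<omega>|sphere_measure. cmod (a \<omega>))\<^sup>2" for x
    unfolding norm_mult using g(2)[of x] herglotz_bounded[OF a, of R x]
    by (intro mult_mono) (auto intro!: power_mono intro: order_trans[OF abs_ge_zero])
  show "g x * (cmod (herglotz R a x))\<^sup>2 = 0" if "norm x > L" for x using g(3)[OF that] by simp
qed

lemma herglotz_local_L2_real:
  fixes a :: "'a::euclidean_space \<Rightarrow> complex"
  assumes a: "sphere_fun a" and R: "R \<ge> 1"
  shows "(LINT x|lborel. indicator (cball 0 L) x * (cmod (herglotz R a x))\<^sup>2)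
    \<le> trace_const TYPE('a) L * (R / R ^ DIM('a)) * sphere_L2 a"
proof -
  from a obtain K where K: "a \<in> borel_measurable borel" "\<And>\<omega>. norm \<omega>
      = 1 \<Longrightarrow> cmod (a \<omega>) \<le> K"
    unfolding sphere_fun_def by blast
  have nn: "0 \<le> trace_const TYPE('a) L * (R / R ^ DIM('a)) * sphere_L2 a"
    using R by (intro mult_nonneg_nonneg trace_const_nonneg sphere_L2_nonneg divide_nonneg_nonneg) auto
  have int: "integrable lborel (\<lambda>x. indicator (cball 0 L) x * (cmod (herglotz R a x))\<^sup>2)"
    by (rule herglotz_sq_integrable[OF a, of _ 1 L]) (auto split: split_indicator intro!: borel_measurable_indicator)
  have "ennreal (LINT x|lborel. indicator (cball 0 L) x * (cmod (herglotz R a x))\<^sup>2)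
      = (\<integral>\<^sup>+x. ennreal (indicator (cball 0 L) x * (cmod (herglotz R a x))\<^sup>2) \<partial>lborel)"
    by (rule nn_integral_eq_integral[OF int, symmetric]) auto
  also have "\<dots> = (\<integral>\<^sup>+x. indicator (cball 0 L) x * ennreal ((cmod (herglotz R a x))\<^sup>2) \<partial>lborel)"
    by (intro nn_integral_cong) (auto split: split_indicator)
  also have "\<dots> \<le> ennreal (sphere_L2 a) * ennreal (trace_const TYPE('a) L * (R / R ^ DIM('a)))"
    using herglotz_local_L2[OF K R] by (simp only: sphere_L2_nn[OF a])
  also have "\<dots> = ennreal (trace_const TYPE('a) L * (R / R ^ DIM('a)) * sphere_L2 a)"
    using R by (subst ennreal_mult[symmetric]) (auto simp: sphere_L2_nonneg trace_const_nonneg mult.commute)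
  finally show ?thesis using nn by (simp only: ennreal_le_iff)
qed

lemma herglotz_linear:
  assumes a: "\<And>b. b \<in> B \<Longrightarrow> sphere_fun (a b)"
  shows "herglotz R (\<lambda>\<omega>. \<Sum>b\<in>B. of_real (t b) * a b \<omega>) x
      = (\<Sum>b\<in>B. of_real (t b) * herglotz R (a b) x)"
proof -
  have int: "integrable sphere_measure (\<lambda>\<omega>. cis (R
      * (\<omega> \<bullet> x)) * a b \<omega>)" if b: "b \<in> B" for b
  proof -
    from a[OF b] obtain K where [measurable]: "a b \<in> borel_measurable borel"
        and K: "\<And>\<omega>. norm \<omega> = 1 \<Longrightarrow> cmod (a b \<omega>) \<le> K"
      unfolding sphere_fun_def by blast
    show ?thesis by (rule sphere_integrable[of _ K]) (auto simp: norm_mult K)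
  qed
  have "herglotz R (\<lambda>\<omega>. \<Sum>b\<in>B. of_real (t b) * a b \<omega>) x
    = (LINT \<omega>|sphere_measure. (\<Sum>b\<in>B. of_real (t b) * (cis (R
        * (\<omega> \<bullet> x)) * a b \<omega>)))"
    unfolding herglotz_def by (simp add: sum_distrib_left mult_ac)
  also have "\<dots> = (\<Sum>b\<in>B. of_real (t b) * herglotz R (a b) x)"
    unfolding herglotz_def by (subst Bochner_Integration.integral_sum) (auto intro!: int)
  finally show ?thesis .
qed

text \<open>The boundary piece is represented as the zero set of F in the ball, with a nearly
  constant gradient m. The tolerance 1/20 is small enough for 23/20 * 3/4 to stay below 19/20, which
  is the absorption in \<open>Q_near_bound\<close>.\<close>

locale near_graph =
  fixes F :: "'a::euclidean_space \<Rightarrow> real" and m :: "'a \<Rightarrow> 'a" and n c :: 'a and r :: real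
  assumes r: "r > 0" and n: "norm n = 1"
    and F_deriv: "\<And>x. x \<in> ball c r \<Longrightarrow> GDERIV F x :> m x"
    and m_close: "\<And>x. x \<in> ball c r \<Longrightarrow> norm (m x - n) \<le> 1/20"
begin

definition "L = norm c + r"
definition "bmp = bump (r/2) c"
definition "dbmp = bump_grad (r/2) c"
text \<open>\<open>psi\<close> is the multiplier of the Rellich identity: arctan (R F) stays bounded
  while its gradient concentrates on the layer where F is O(1/R), with the weight \<open>W\<close>
  of height R. The cutoff of radius r/2 makes everything vanish well inside the ball where F is
  controlled, and \<open>Y\<close>, the product of 2 and 4/(r/2), bounds the part of the gradient
  that falls on the cutoff.\<close>

definition "W R x = (if x \<in> ball c r then bmp x * (R / (1 + (R * F x)\<^sup>2)) else 0)"
definition "psi R x = (if x \<in> ball c r then bmp x * arctan (R * F x) else 0)"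
definition "Dpsi R x = W R x *\<^sub>R m x + (if x \<in> ball c r then arctan (R * F x) *\<^sub>R dbmp x else 0)"
definition "Y = 16 / r"

lemma not_ball: "norm x > L \<Longrightarrow> x \<notin> ball c r"
  using norm_triangle_ineq2[of x c] by (auto simp: L_def dist_norm norm_minus_commute)

lemma GDERIV_psi: "GDERIV (psi R) x :> Dpsi R x"
proof (cases "x \<in> ball c r")
  case True
  have "GDERIV (\<lambda>x. arctan (R * F x)) x :> (R / (1 + (R * F x)\<^sup>2)) *\<^sub>R m x"
    by (rule GDERIV_DERIV_compose[OF F_deriv[OF True]])
      (auto intro!: derivative_eq_intros simp: divide_inverse)
  from GDERIV_mult[OF GDERIV_bump[of "r/2" c x] this]
  have "GDERIV (\<lambda>x. bmp x * arctan (R * F x)) x :> Dpsi R x"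
    using True by (simp add: bmp_def dbmp_def Dpsi_def W_def)
  then show ?thesis
    unfolding gderiv_def by (rule has_derivative_transform_within_open[OF _ open_ball True]) (simp add: psi_def)
next
  case False
  have "open {x. r/2 < norm (x - c)}" by (intro open_Collect_less continuous_intros)
  moreover have "x \<in> {x. r/2 < norm (x - c)}"
    using False r by (auto simp: dist_norm norm_minus_commute)
  moreover have "psi R y = 0" if "y \<in> {x. r/2 < norm (x - c)}" for y
    using that r by (simp add: psi_def bmp_def bump_eq_0)
  ultimately show ?thesis
    using False unfolding gderiv_def Dpsi_def W_def
    by (simp, intro has_derivative_transform_within_open[OF has_derivative_const[of 0]]) auto
qed

lemma bmp_range: "0 \<le> bmp x" "bmp x \<le> 1" by (simp_all add: bmp_def bump_range)

lemma W_nonneg: "R \<ge> 0 \<Longrightarrow> W R x \<ge> 0"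
  by (auto simp: W_def bmp_range add_nonneg_nonneg intro!: mult_nonneg_nonneg divide_nonneg_nonneg)

lemma W_le:
  assumes R: "R \<ge> 0"
  shows "W R x \<le> R"
proof (cases "x \<in> ball c r")
  case True
  have "R / (1 + (R * F x)\<^sup>2) \<le> R / 1"
    using R by (intro divide_left_mono) (auto simp: add_pos_nonneg)
  then have "bmp x * (R / (1 + (R * F x)\<^sup>2)) \<le> 1 * R"
    using R bmp_range[of x] by (intro mult_mono) (auto simp: add_nonneg_nonneg)
  then show ?thesis using True by (simp add: W_def)
qed (use R in \<open>simp add: W_def\<close>)

lemma W_supp: "norm x > L \<Longrightarrow> W R x = 0"
  using not_ball by (simp add: W_def)

lemma abs_arctan_le_2: "\<bar>arctan t\<bar> \<le> 2"
  using arctan_bounded[of t] pi_less_4 by (auto simp: abs_le_iff)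

lemma norm_dbmp_le: "norm (arctan t *\<^sub>R dbmp x) \<le> Y"
proof -
  have "norm (dbmp x) \<le> 4 / (r/2)"
    unfolding dbmp_def using r by (intro norm_bump_grad_le) simp
  then have "\<bar>arctan t\<bar> * norm (dbmp x) \<le> 2 * (4 / (r/2))"
    using abs_arctan_le_2 by (intro mult_mono) auto
  then show ?thesis by (simp add: Y_def)
qed

lemma Y_pos: "Y > 0" using r by (simp add: Y_def)

lemma norm_Dpsi_le:
  assumes R: "R \<ge> 0"
  shows "norm (Dpsi R x) \<le> R * 2 + Y"
proof (cases "x \<in> ball c r")
  case True
  have "norm (m x) \<le> 2" using norm_triangle_ineq2[of "m x" n] m_close[OF True] n by simp
  then have "norm (W R x *\<^sub>R m x) \<le> R * 2"
    using W_le[OF R] W_nonneg[OF R] R by (auto intro!: mult_mono)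
  then show ?thesis
    unfolding Dpsi_def using True norm_dbmp_le by (auto intro!: norm_triangle_le add_mono)
next
  case False
  then show ?thesis using R Y_pos by (simp add: Dpsi_def W_def)
qed

lemma psi_supp: "norm x > L \<Longrightarrow> psi R x = 0"
  using not_ball by (simp add: psi_def)

lemma W_measurable [measurable]: "W R \<in> borel_measurable borel"
proof -
  have "continuous_on (ball c r) F"
    using F_deriv unfolding gderiv_def
    by (intro continuous_at_imp_continuous_on ballI) (rule has_derivative_continuous)
  moreover have "continuous_on A bmp" for A
    using GDERIV_bump unfolding bmp_def
    by (intro continuous_at_imp_continuous_on) (auto simp: gderiv_def intro: has_derivative_continuous)
  ultimately have "continuous_on (ball c r) (\<lambda>x. bmp x * (R / (1 + (R * F x)\<^sup>2)))"
    by (intro continuous_intros) (auto simp: add_pos_nonneg less_imp_neq[symmetric])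
  then have "(\<lambda>x. indicator (ball c r) x *\<^sub>R (bmp x * (R / (1
      + (R * F x)\<^sup>2)))) \<in> borel_measurable borel"
    by (intro borel_measurable_continuous_on_indicator) auto
  moreover have "(\<lambda>x. indicator (ball c r) x *\<^sub>R (bmp x * (R / (1 + (R * F x)\<^sup>2)))) = W R"
    by (auto simp: W_def fun_eq_iff)
  ultimately show ?thesis by simp
qed

lemma integrable_W: "R \<ge> 0 \<Longrightarrow> integrable lborel (W R)"
  by (rule integrable_bounded_support[of _ R L]) (use W_nonneg W_le W_supp in auto)

definition "vol = measure lborel (cball (0::'a) L)"

lemma integrable_cball: "integrable lborel (\<lambda>x. indicator (cball 0 L) x * (t::real))"
  by (rule integrable_mult_left) (auto intro!: integrable_real_indicator emeasure_lborel_cball_finite)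

text \<open>The gradient of \<open>psi\<close> integrates to zero, being a transform evaluated at
  the origin. So the integral of W (m \<bullet> n) is balanced by the cutoff part, which is at most
  Y on the ball, and m \<bullet> n \<ge> 19/20 bounds the mass of W uniformly in R. In effect the
  layer has volume O(1/R).\<close>

lemma integral_W_le:
  assumes R: "R \<ge> 0"
  shows "(LINT x|lborel. W R x) \<le> 2 * Y * vol"
proof -
  have [measurable]: "Dpsi R \<in> borel_measurable borel"
    by (rule borel_measurable_gradient[OF GDERIV_psi norm_Dpsi_le[OF R] psi_supp])
  have int: "integrable lborel (\<lambda>x. Dpsi R x \<bullet> n)"
  proof (rule integrable_bounded_support[of _ "R * 2 + Y" L])
    show "norm (Dpsi R x \<bullet> n) \<le> R * 2 + Y" for x
      using Cauchy_Schwarz_ineq2[of "Dpsi R x" n] norm_Dpsi_le[OF R, of x] n by simp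
    show "Dpsi R x \<bullet> n = 0" if "norm x > L" for x
      using gradient_support[OF GDERIV_psi norm_Dpsi_le[OF R] psi_supp that] by simp
  qed simp
  have "complex_of_real (LINT x|lborel. Dpsi R x \<bullet> n) = ft (\<lambda>x. of_real (Dpsi R x \<bullet> n)) 0"
    by (simp add: ft_def integral_complex_of_real)
  also have "\<dots> = 0"
    using ft_gradient[OF GDERIV_psi norm_Dpsi_le[OF R] psi_supp, where \<xi>=0]
    by (simp add: inner_zero_right)
  finally have 0: "(LINT x|lborel. Dpsi R x \<bullet> n) = 0" by (simp only: of_real_eq_0_iff)
  have "(LINT x|lborel. W R x * (19/20)) \<le> (LINT x|lborel. Dpsi R x \<bullet> n + indicator (cball 0 L) x * Y)"
  proof (rule integral_mono)
    fix x
    show "W R x * (19/20) \<le> Dpsi R x \<bullet> n + indicator (cball 0 L) x * Y"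
    proof (cases "x \<in> ball c r")
      case True
      then have x: "norm x \<le> L" using not_ball[of x] by linarith
      have "m x \<bullet> n = 1 + (m x - n) \<bullet> n" using n by (simp add: inner_diff_left norm_eq_1)
      moreover have "\<bar>(m x - n) \<bullet> n\<bar> \<le> 1/20"
        using Cauchy_Schwarz_ineq2[of "m x - n" n] m_close[OF True] n by simp
      ultimately have "W R x * (19/20) \<le> W R x * (m x \<bullet> n)"
        using W_nonneg[OF R] by (intro mult_left_mono) (auto simp: abs_le_iff)
      moreover have "\<bar>(arctan (R * F x) *\<^sub>R dbmp x) \<bullet> n\<bar> \<le> Y"
        using Cauchy_Schwarz_ineq2[of "arctan (R * F x) *\<^sub>R dbmp x" n] norm_dbmp_le[of "R * F x" x] n by simp
      ultimately show ?thesis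
        using True x by (simp add: Dpsi_def inner_add_left abs_le_iff)
    next
      case False
      then show ?thesis using Y_pos by (simp add: Dpsi_def W_def)
    qed
  qed (intro integrable_mult_left integrable_W[OF R] Bochner_Integration.integrable_add int integrable_cball)+
  also have "\<dots> = vol * Y"
    by (subst Bochner_Integration.integral_add) (use int integrable_cball 0 in \<open>auto simp: vol_def\<close>)
  finally have "(LINT x|lborel. W R x) * (19/20) \<le> vol * Y" by simp
  moreover have "vol * Y \<ge> 0" using Y_pos by (simp add: vol_def)
  moreover have "2 * Y * vol = 2 * (vol * Y)" by simp
  ultimately show ?thesis by linarith
qed

definition "Q R a = (LINT x|lborel. W R x * (cmod (herglotz R a x))\<^sup>2)"

text \<open>The density whose wave is the derivative in the direction v divided by i R.\<close>

definition dirn :: "'a \<Rightarrow> ('a \<Rightarrow> complex) \<Rightarrow> 'a \<Rightarrow> complex" where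
  "dirn v a \<omega> = complex_of_real (\<omega> \<bullet> v) * a \<omega>"

lemma sphere_fun_dirn: "sphere_fun a \<Longrightarrow> sphere_fun (dirn v a)"
  unfolding dirn_def[abs_def] by (rule sphere_fun_scale)

lemma W_sq_integrable: "sphere_fun a \<Longrightarrow> R \<ge> 0
    \<Longrightarrow> integrable lborel (\<lambda>x. W R x * (cmod (herglotz R a x))\<^sup>2)"
  by (rule herglotz_sq_integrable[of _ _ R L]) (use W_nonneg W_le W_supp in auto)

lemma herglotz_dirn_sum: "sphere_fun a \<Longrightarrow> herglotz R (dirn v a) x
    = (\<Sum>b\<in>Basis. of_real (v \<bullet> b) * herglotz R (dirn b a) x)"
proof -
  assume a: "sphere_fun a"
  have "dirn v a = (\<lambda>\<omega>. \<Sum>b\<in>Basis. of_real (v \<bullet> b) * dirn b a \<omega>)"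
    unfolding dirn_def by (rule ext, subst euclidean_inner) (simp add: sum_distrib_left sum_distrib_right mult_ac)
  then show ?thesis using herglotz_linear[of Basis "\<lambda>b. dirn b a" R "\<lambda>b. v \<bullet> b" x] sphere_fun_dirn[OF a] by simp
qed

lemma sphere_L2_dirn_sum:
  assumes a: "sphere_fun a"
  shows "(\<Sum>b\<in>Basis. sphere_L2 (dirn b a)) = sphere_L2 a"
proof -
  have "(\<Sum>b\<in>Basis. sphere_L2 (dirn b a))
      = (LINT \<omega>|sphere_measure. (\<Sum>b\<in>Basis. (cmod (dirn b a \<omega>))\<^sup>2))"
    unfolding sphere_L2_def by (subst Bochner_Integration.integral_sum) (auto intro!: sphere_integrable_sq sphere_fun_dirn a)
  also have "\<dots> = sphere_L2 a"
    unfolding sphere_L2_def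
  proof (rule Bochner_Integration.integral_cong[OF refl])
    fix \<omega> :: 'a assume "\<omega> \<in> space sphere_measure"
    then have "norm \<omega> = 1" by simp
    then have "(\<Sum>b\<in>Basis. (\<omega> \<bullet> b)\<^sup>2) = 1" by (simp add: norm_power2_Basis[symmetric])
    then show "(\<Sum>b\<in>Basis. (cmod (dirn b a \<omega>))\<^sup>2) = (cmod (a \<omega>))\<^sup>2"
      by (simp add: dirn_def norm_mult power_mult_distrib sum_distrib_right[symmetric])
  qed
  finally show ?thesis .
qed

definition "tang b = b - (b \<bullet> n) *\<^sub>R n"

lemma inner_tang: "\<omega> \<bullet> tang b = (\<omega> - (\<omega> \<bullet> n) *\<^sub>R n) \<bullet> b"
  by (simp add: tang_def inner_diff_right inner_diff_left inner_commute)

text \<open>Densities on frequencies that keep away from the tangent plane. Closure under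
  \<open>dirn\<close> lets one best constant serve a wave and its tangential derivatives
  alike.\<close>

definition "near a \<longleftrightarrow> sphere_fun a \<and> (\<forall>\<omega>. norm \<omega>
    = 1 \<longrightarrow> \<bar>\<omega> \<bullet> n\<bar> < 1/2 \<longrightarrow> a \<omega> = 0)"

lemma near_dirn: "near a \<Longrightarrow> near (dirn v a)"
  by (auto simp: near_def sphere_fun_dirn) (simp add: dirn_def)

lemma sphere_L2_tang_sum:
  assumes a: "near a"
  shows "(\<Sum>b\<in>Basis. sphere_L2 (dirn (tang b) a)) \<le> 3/4 * sphere_L2 a"
proof -
  have sf: "sphere_fun a" using a by (simp add: near_def)
  have "(\<Sum>b\<in>Basis. sphere_L2 (dirn (tang b) a))
      = (LINT \<omega>|sphere_measure. (\<Sum>b\<in>Basis. (cmod (dirn (tang b) a \<omega>))\<^sup>2))"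
    unfolding sphere_L2_def by (subst Bochner_Integration.integral_sum) (auto intro!: sphere_integrable_sq sphere_fun_dirn sf)
  also have "\<dots> \<le> (LINT \<omega>|sphere_measure. 3/4 * (cmod (a \<omega>))\<^sup>2)"
  proof (rule integral_mono)
    fix \<omega> :: 'a assume "\<omega> \<in> space sphere_measure"
    then have \<omega>: "norm \<omega> = 1" by simp
    have "(\<Sum>b\<in>Basis. (\<omega> \<bullet> tang b)\<^sup>2) = (norm (\<omega>
        - (\<omega> \<bullet> n) *\<^sub>R n))\<^sup>2"
      unfolding inner_tang by (rule norm_power2_Basis[symmetric])
    also have "\<dots> = 1 - (\<omega> \<bullet> n)\<^sup>2"
      using \<omega> n unfolding power2_norm_eq_inner
      by (simp add: inner_diff_left inner_diff_right norm_eq_1 inner_commute power2_eq_square)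
    finally have S: "(\<Sum>b\<in>Basis. (\<omega> \<bullet> tang b)\<^sup>2) = 1 - (\<omega> \<bullet> n)\<^sup>2" .
    show "(\<Sum>b\<in>Basis. (cmod (dirn (tang b) a \<omega>))\<^sup>2) \<le> 3/4 * (cmod (a \<omega>))\<^sup>2"
    proof (cases "\<bar>\<omega> \<bullet> n\<bar> < 1/2")
      case True
      then show ?thesis using a \<omega> by (simp add: near_def dirn_def)
    next
      case False
      then have "(1/2)\<^sup>2 \<le> \<bar>\<omega> \<bullet> n\<bar>\<^sup>2" by (intro power_mono) auto
      then have "1 - (\<omega> \<bullet> n)\<^sup>2 \<le> 3/4" by (simp add: power2_eq_square)
      then have "(1 - (\<omega> \<bullet> n)\<^sup>2) * (cmod (a \<omega>))\<^sup>2 \<le> 3/4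
          * (cmod (a \<omega>))\<^sup>2" by (intro mult_right_mono) auto
      then show ?thesis
        by (simp add: dirn_def norm_mult power_mult_distrib sum_distrib_right[symmetric] S)
    qed
  next
    show "integrable sphere_measure (\<lambda>\<omega>. \<Sum>b\<in>Basis. (cmod (dirn (tang b) a \<omega>))\<^sup>2)"
      by (auto intro!: sphere_integrable_sq sphere_fun_dirn sf)
    show "integrable sphere_measure (\<lambda>\<omega>. 3/4 * (cmod (a \<omega>))\<^sup>2)"
      by (intro integrable_mult_right sphere_integrable_sq sf)
  qed
  also have "\<dots> = 3/4 * sphere_L2 a" by (simp add: sphere_L2_def)
  finally show ?thesis .
qed

text \<open>The integral of \<open>rellich_pointwise\<close> with w = W. The cutoff error is
  estimated by the bound for waves on a ball; its factor 4 is 3 + 1, because the squared norms of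
  the densities of all basis derivatives add up to that of \<open>a\<close>.\<close>

lemma rellich_inequality:
  assumes a: "sphere_fun a" and R: "R \<ge> 1"
  shows "19/20 * Q R a \<le> 23/20 * (\<Sum>b\<in>Basis. Q R (dirn (tang b) a))
    + Y * (4 * (trace_const TYPE('a) L * (R / R ^ DIM('a)))) * sphere_L2 a"
proof -
  let ?u = "\<lambda>v. herglotz R (dirn v a)"
  let ?TC = "trace_const TYPE('a) L * (R / R ^ DIM('a))"
  have R0: "R \<ge> 0" using R by simp
  from a obtain A where A: "a \<in> borel_measurable borel" "\<And>\<omega>. norm \<omega>
      = 1 \<Longrightarrow> cmod (a \<omega>) \<le> A"
    unfolding sphere_fun_def by blast
  define E where "E x = (\<Sum>b\<in>Basis. (Dpsi R x \<bullet> b) * (2 * Re (cnj (?u n x) * ?u b x)))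
      + (Dpsi R x \<bullet> n) * ((cmod (herglotz R a x))\<^sup>2 - (\<Sum>b\<in>Basis. (cmod (?u b x))\<^sup>2))" for x
  have E0: "(LINT x|lborel. E x) = 0"
    unfolding E_def dirn_def[abs_def]
    by (rule rellich_identity[OF GDERIV_psi norm_Dpsi_le[OF R0] psi_supp A])
  have Dpsi_meas [measurable]: "Dpsi R \<in> borel_measurable borel"
    by (rule borel_measurable_gradient[OF GDERIV_psi norm_Dpsi_le[OF R0] psi_supp])
  have u_meas [measurable]: "?u v \<in> borel_measurable borel" for v
    by (intro herglotz_measurable' sphere_fun_dirn a)
  have u0_meas [measurable]: "herglotz R a \<in> borel_measurable borel"
    by (intro herglotz_measurable' a)
  define B where "B v = (LINT \<omega>|sphere_measure. cmod (dirn v a \<omega>))" for v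
  have u_bd: "cmod (?u v x) \<le> B v" for v x unfolding B_def by (intro herglotz_bounded sphere_fun_dirn a)
  have B0: "B v \<ge> 0" for v by (simp add: B_def)
  have E_int: "integrable lborel E"
    unfolding E_def
  proof (intro Bochner_Integration.integrable_add Bochner_Integration.integrable_sum)
    have Db: "\<bar>Dpsi R x \<bullet> v\<bar> \<le> (R * 2 + Y) * norm v" for x v
      by (rule order_trans[OF Cauchy_Schwarz_ineq2]) (intro mult_right_mono norm_Dpsi_le R0 norm_ge_zero)
    have D0: "Dpsi R x = 0" if "norm x > L" for x
      by (rule gradient_support[OF GDERIV_psi norm_Dpsi_le[OF R0] psi_supp that])
    show "integrable lborel (\<lambda>x. (Dpsi R x \<bullet> b) * (2 * Re (cnj (?u n x) * ?u b x)))" for b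
    proof (rule integrable_bounded_support[of _ "((R * 2 + Y) * norm b) * (2 * (B n * B b))" L])
      show "norm ((Dpsi R x \<bullet> b) * (2 * Re (cnj (?u n x) * ?u b x))) \<le> ((R * 2 + Y) * norm b)
          * (2 * (B n * B b))" for x
      proof -
        have "\<bar>Re (cnj (?u n x) * ?u b x)\<bar> \<le> cmod (?u n x) * cmod (?u b x)"
          using abs_Re_le_cmod[of "cnj (?u n x) * ?u b x"] by (simp only: norm_mult complex_mod_cnj)
        also have "\<dots> \<le> B n * B b" by (intro mult_mono u_bd B0) auto
        finally have "\<bar>2 * Re (cnj (?u n x) * ?u b x)\<bar> \<le> 2 * (B n * B b)" by simp
        then show ?thesis
          unfolding real_norm_def abs_mult[of "Dpsi R x \<bullet> b"] using Db[of x b]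
          by (intro mult_mono) (auto intro: order_trans[OF abs_ge_zero])
      qed
    qed (use D0 in auto)
    have *: "integrable lborel (\<lambda>x. (Dpsi R x \<bullet> n) * (cmod (herglotz R a' x))\<^sup>2)"
        if "sphere_fun a'" for a'
      by (rule herglotz_sq_integrable[OF that _ _, of _ "(R * 2 + Y) * norm n" L]) (use Db D0 in auto)
    have "integrable lborel (\<lambda>x. (Dpsi R x \<bullet> n) * (cmod (herglotz R a x))\<^sup>2
        - (\<Sum>b\<in>Basis. (Dpsi R x \<bullet> n) * (cmod (?u b x))\<^sup>2))"
      by (intro Bochner_Integration.integrable_diff Bochner_Integration.integrable_sum * sphere_fun_dirn a)
    then show "integrable lborel (\<lambda>x. (Dpsi R x \<bullet> n) * ((cmod (herglotz R a x))\<^sup>2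
        - (\<Sum>b\<in>Basis. (cmod (?u b x))\<^sup>2)))"
      by (simp add: right_diff_distrib sum_distrib_left)
  qed
  define I :: "'a \<Rightarrow> real" where "I = indicator (cball 0 L)"
  \<comment> \<open>A pointwise minorant of E: inside the ball by \<open>rellich_pointwise\<close>,
    outside because E vanishes there while M is nonpositive.\<close>
  define M where "M x = W R x * (19/20 * (cmod (herglotz R a x))\<^sup>2 - 23/20
      * (\<Sum>b\<in>Basis. (cmod (?u (tang b) x))\<^sup>2))
      - Y * (I x * (3 * (\<Sum>b\<in>Basis. (cmod (?u b x))\<^sup>2) + (cmod (herglotz R a x))\<^sup>2))" for x
  have tang_eq: "?u (tang b) x = ?u b x - of_real (n \<bullet> b) * ?u n x" if b: "b \<in> Basis" for b x
  proof -
    have "?u (tang b) x = (\<Sum>v\<in>Basis. of_real (b \<bullet> v) * ?u v x) - of_real (n \<bullet> b)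
        * (\<Sum>v\<in>Basis. of_real (n \<bullet> v) * ?u v x)"
    proof -
      have "tang b \<bullet> v = b \<bullet> v - (n \<bullet> b) * (n \<bullet> v)" for v
        by (simp add: tang_def inner_diff_left inner_commute[of n b])
      then show ?thesis
        unfolding herglotz_dirn_sum[OF a, of _ "tang b"]
        by (simp add: left_diff_distrib sum_subtractf sum_distrib_left mult.assoc)
    qed
    then show ?thesis by (simp only: herglotz_dirn_sum[OF a, symmetric])
  qed
  have ME: "M x \<le> E x" for x
  proof (cases "x \<in> ball c r")
    case True
    then have x: "norm x \<le> L" using not_ball[of x] by linarith
    define y where "y = arctan (R * F x) *\<^sub>R dbmp x"
    have Dy: "Dpsi R x = W R x *\<^sub>R m x + y" using True by (simp add: Dpsi_def y_def)
    have un: "?u n x = (\<Sum>b\<in>Basis. of_real (n \<bullet> b) * ?u b x)" by (rule herglotz_dirn_sum[OF a])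
    have "M x \<le> W R x * (19/20 * (cmod (herglotz R a x))\<^sup>2 - 23/20
        * (\<Sum>b\<in>Basis. (cmod (?u b x - of_real (n \<bullet> b) * ?u n x))\<^sup>2))
      - norm y * (3 * (\<Sum>b\<in>Basis. (cmod (?u b x))\<^sup>2) + (cmod (herglotz R a x))\<^sup>2)"
    proof -
      have "norm y * (3 * (\<Sum>b\<in>Basis. (cmod (?u b x))\<^sup>2) + (cmod (herglotz R a x))\<^sup>2)
        \<le> Y * (3 * (\<Sum>b\<in>Basis. (cmod (?u b x))\<^sup>2) + (cmod (herglotz R a x))\<^sup>2)"
        unfolding y_def by (intro mult_right_mono norm_dbmp_le) (auto simp: sum_nonneg)
      then show ?thesis using x by (simp add: M_def tang_eq I_def)
    qed
    also have "\<dots> \<le> E x"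
      unfolding E_def Dy un by (rule rellich_pointwise[OF n m_close[OF True] W_nonneg[OF R0]])
    finally show ?thesis .
  next
    case False
    then have "E x = 0" by (simp add: E_def Dpsi_def W_def)
    moreover have "M x \<le> 0"
      using False Y_pos by (simp add: M_def W_def I_def sum_nonneg)
    ultimately show ?thesis by simp
  qed
  have I_int: "integrable lborel (\<lambda>x. I x * (cmod (herglotz R a' x))\<^sup>2)" if "sphere_fun a'" for a'
    unfolding I_def
    by (rule herglotz_sq_integrable[OF that, of _ 1 L]) (auto split: split_indicator intro!: borel_measurable_indicator)
  have M_eq: "M x = 19/20 * (W R x * (cmod (herglotz R a x))\<^sup>2) - 23/20 * (\<Sum>b\<in>Basis. W R x
      * (cmod (?u (tang b) x))\<^sup>2)
      - Y * (3 * (\<Sum>b\<in>Basis. I x * (cmod (?u b x))\<^sup>2) + I x * (cmod (herglotz R a x))\<^sup>2)" for x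
    unfolding M_def by (simp add: algebra_simps sum_distrib_left)
  have M_int: "integrable lborel M"
    unfolding M_eq[abs_def]
    by (intro Bochner_Integration.integrable_diff Bochner_Integration.integrable_add integrable_mult_right
        Bochner_Integration.integrable_sum W_sq_integrable I_int sphere_fun_dirn a R0)
  have "(LINT x|lborel. M x) = 19/20 * Q R a - 23/20 * (\<Sum>b\<in>Basis. Q R (dirn (tang b) a))
      - Y * (3 * (\<Sum>b\<in>Basis. LINT x|lborel. I x * (cmod (?u b x))\<^sup>2) + (LINT x|lborel. I x
          * (cmod (herglotz R a x))\<^sup>2))"
    unfolding M_eq Q_def
    by (simp add: Bochner_Integration.integral_diff Bochner_Integration.integral_add Bochner_Integration.integral_sum
        Bochner_Integration.integrable_sum W_sq_integrable I_int sphere_fun_dirn a R0)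
  moreover have "(LINT x|lborel. M x) \<le> 0"
    using integral_mono[OF M_int E_int ME] E0 by simp
  moreover have "3 * (\<Sum>b\<in>Basis. LINT x|lborel. I x * (cmod (?u b x))\<^sup>2) + (LINT x|lborel. I x
      * (cmod (herglotz R a x))\<^sup>2)
    \<le> 3 * (\<Sum>b\<in>Basis. ?TC * sphere_L2 (dirn b a)) + ?TC * sphere_L2 a"
    unfolding I_def by (intro add_mono mult_left_mono sum_mono herglotz_local_L2_real sphere_fun_dirn a R) auto
  moreover have "3 * (\<Sum>b\<in>Basis. ?TC * sphere_L2 (dirn b a)) + ?TC * sphere_L2 a = 4 * ?TC * sphere_L2 a"
    unfolding sum_distrib_left[symmetric] sphere_L2_dirn_sum[OF a] by (simp add: algebra_simps)
  ultimately have "19/20 * Q R a - 23/20 * (\<Sum>b\<in>Basis. Q R (dirn (tang b) a)) \<le> Y * (4 * ?TC * sphere_L2 a)"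
    using Y_pos mult_left_mono[of "3 * (\<Sum>b\<in>Basis. LINT x|lborel. I x * (cmod (?u b x))\<^sup>2)
        + (LINT x|lborel. I x * (cmod (herglotz R a x))\<^sup>2)" "4 * ?TC * sphere_L2 a" Y]
    by linarith
  moreover have "Y * (4 * ?TC * sphere_L2 a) = Y * (4 * ?TC) * sphere_L2 a"
    by (simp only: mult.assoc)
  ultimately show ?thesis by linarith
qed

end

section \<open>Absorption and the transversal estimate\<close>

context near_graph
begin

definition "K1 = 4 * Y * trace_const TYPE('a) L"

lemma K1_nonneg: "K1 \<ge> 0"
  using Y_pos by (simp add: K1_def trace_const_nonneg)

text \<open>Let q be the least constant for which the bound holds on \<open>near\<close> densities.
  By the Rellich inequality (69/80 q + K1 s) 20/19 works as well, with 69/80 = 23/20 * 3/4, so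
  minimality gives q \<le> 69/76 q + 20/19 K1 s. Solving yields the factor 80/7, rounded up to
  12.\<close>

lemma Q_near_bound:
  assumes a: "near a" and R: "R \<ge> 1"
  shows "Q R a \<le> 12 * K1 * (R / R ^ DIM('a)) * sphere_L2 a"
proof -
  define s where "s = R / R ^ DIM('a)"
  have s0: "s \<ge> 0" using R by (simp add: s_def)
  define A where "A = {q. \<forall>a. near a \<longrightarrow> Q R a \<le> q * sphere_L2 a} \<inter> {0..}"
  \<comment> \<open>Some finite constant must exist for the infimum to make sense; W \<le> R and the
    bound on a ball provide one, too large by a factor R.\<close>
  have "R * (trace_const TYPE('a) L * s) \<in> A"
  proof -
    have "Q R a \<le> R * (trace_const TYPE('a) L * s) * sphere_L2 a" if "near a" for a
    proof -
      have sf: "sphere_fun a" using that by (simp add: near_def)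
      have [measurable]: "cball (0::'a) L \<in> sets borel" by simp
      have "Q R a \<le> (LINT x|lborel. R * (indicator (cball 0 L) x * (cmod (herglotz R a x))\<^sup>2))"
        unfolding Q_def
      proof (rule integral_mono)
        show "integrable lborel (\<lambda>x. W R x * (cmod (herglotz R a x))\<^sup>2)" using sf R
            by (intro W_sq_integrable) auto
        show "integrable lborel (\<lambda>x. R * (indicator (cball 0 L) x * (cmod (herglotz R a x))\<^sup>2))"
          by (intro integrable_mult_right herglotz_sq_integrable[OF sf, of _ 1 L]) (auto split: split_indicator)
        show "W R x * (cmod (herglotz R a x))\<^sup>2 \<le> R * (indicator (cball 0 L) x
            * (cmod (herglotz R a x))\<^sup>2)" for x
          using W_le[of R x] W_supp[of x R] R by (cases "norm x \<le> L") (auto intro!: mult_right_mono)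
      qed
      also have "\<dots> \<le> R * (trace_const TYPE('a) L * s * sphere_L2 a)"
        using herglotz_local_L2_real[OF sf R, of L] R unfolding s_def integral_mult_right_zero
        by (intro mult_left_mono) auto
      finally show ?thesis by (simp only: mult.assoc)
    qed
    moreover have "R * (trace_const TYPE('a) L * s) \<ge> 0"
      using R s0 trace_const_nonneg by (intro mult_nonneg_nonneg) auto
    ultimately show ?thesis by (simp add: A_def)
  qed
  then have ne: "A \<noteq> {}" by blast
  have bdd: "bdd_below A" by (auto simp: A_def intro!: bdd_belowI[of _ 0])
  define q where "q = Inf A"
  have q0: "q \<ge> 0" unfolding q_def using ne by (intro cInf_greatest) (auto simp: A_def)
  \<comment> \<open>The infimum is itself admissible. A density of norm zero cannot be divided out
    and is covered by any member of \<open>A\<close>.\<close>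
  have q: "Q R a \<le> q * sphere_L2 a" if "near a" for a
  proof (cases "sphere_L2 a = 0")
    case True
    obtain p where "p \<in> A" using ne by blast
    then show ?thesis using that True unfolding A_def by auto
  next
    case False
    then have pos: "sphere_L2 a > 0" using sphere_L2_nonneg[of a] by linarith
    have "Q R a / sphere_L2 a \<le> q"
      unfolding q_def using ne
    proof (rule cInf_greatest)
      fix p assume "p \<in> A"
      then have "Q R a \<le> p * sphere_L2 a" using that by (simp add: A_def)
      then show "Q R a / sphere_L2 a \<le> p" using pos by (simp add: divide_le_eq)
    qed
    then show ?thesis using pos by (simp add: divide_le_eq)
  qed
  have "(69/80 * q + K1 * s) * (20/19) \<in> A"
  proof -
    have "Q R a \<le> (69/80 * q + K1 * s) * (20/19) * sphere_L2 a" if na: "near a" for a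
    proof -
      have sf: "sphere_fun a" using na by (simp add: near_def)
      have "(\<Sum>b\<in>Basis. Q R (dirn (tang b) a)) \<le> (\<Sum>b\<in>Basis. q * sphere_L2 (dirn (tang b) a))"
        by (intro sum_mono q near_dirn na)
      also have "\<dots> = q * (\<Sum>b\<in>Basis. sphere_L2 (dirn (tang b) a))" by (simp add: sum_distrib_left)
      also have "\<dots> \<le> q * (3/4 * sphere_L2 a)"
        by (intro mult_left_mono sphere_L2_tang_sum na q0)
      finally have "(\<Sum>b\<in>Basis. Q R (dirn (tang b) a)) \<le> 3/4 * (q * sphere_L2 a)" by simp
      moreover have "19/20 * Q R a \<le> 23/20 * (\<Sum>b\<in>Basis. Q R (dirn (tang b) a)) + K1 * s * sphere_L2 a"
        using rellich_inequality[OF sf R] by (simp add: K1_def s_def mult_ac)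
      moreover have e: "(69/80 * q + K1 * s) * (20/19) * sphere_L2 a = (20/19) * (69/80 * (q * sphere_L2 a)
          + K1 * s * sphere_L2 a)"
        by (simp add: algebra_simps)
      ultimately show ?thesis unfolding e by argo
    qed
    moreover have "(69/80 * q + K1 * s) * (20/19) \<ge> 0" using q0 K1_nonneg s0 by simp
    ultimately show ?thesis by (simp add: A_def)
  qed
  then have "q \<le> (69/80 * q + K1 * s) * (20/19)"
    unfolding q_def by (rule cInf_lower[OF _ bdd])
  moreover have "K1 * s \<ge> 0" using K1_nonneg s0 by simp
  moreover have "(69/80 * q + K1 * s) * (20/19) = 69/76 * q + 20/19 * (K1 * s)" by (simp add: algebra_simps)
  ultimately have "q \<le> 12 * (K1 * s)" by argo
  then have "q * sphere_L2 a \<le> 12 * (K1 * s) * sphere_L2 a"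
    by (rule mult_right_mono[OF _ sphere_L2_nonneg])
  with q[OF a] show ?thesis by (simp add: s_def)
qed

text \<open>Duality with the density a = ft G restricted to these frequencies: its squared norm Z is
  the pairing of G with the wave of \<open>a\<close>. On the support of G the weight W is at least
  9/160 R, since the bump is at least 9/16 and 1 + 3^2 = 10. Hence |G| \<le> (40/R) W, and the
  pairing splits into the mass of W and \<open>Q\<close>, balanced by a parameter t.\<close>

lemma near_estimate:
  assumes R: "R \<ge> 1" and [measurable]: "G \<in> borel_measurable borel" and G_bd: "\<And>x. cmod (G x) \<le> 2"
    and G_supp: "\<And>x. G x \<noteq> 0 \<Longrightarrow> norm (x - c) \<le> r/4 \<and> \<bar>R * F x\<bar> \<le> 3"
  shows "(\<integral>\<^sup>+\<omega>. indicator {\<omega>. 1/2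
      \<le> \<bar>\<omega> \<bullet> n\<bar>} \<omega> * ennreal ((cmod (ft G (R *\<^sub>R \<omega>)))\<^sup>2) \<partial>sphere_measure)
    \<le> ennreal (38400 * (K1 + 1) * Y * vol * (1 / (R * R ^ DIM('a))))"
proof -
  have R0: "R > 0" using R by simp
  define N where "N = {\<omega>::'a. 1/2 \<le> \<bar>\<omega> \<bullet> n\<bar>}"
  have [measurable]: "N \<in> sets borel" unfolding N_def by measurable
  have ft_meas [measurable]: "ft G \<in> borel_measurable borel" by (rule measurable_ft) simp
  have G0: "G x = 0" if "norm x > L" for x
  proof (rule ccontr)
    assume "G x \<noteq> 0"
    then have "norm (x - c) \<le> r/4" using G_supp by blast
    then show False using not_ball[OF that] r by (simp add: dist_norm norm_minus_commute)
  qed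
  have G_int: "integrable lborel G"
    by (rule integrable_bounded_support[of _ 2 L]) (use G_bd G0 in auto)
  define a where "a \<omega> = indicator N \<omega> * ft G (R *\<^sub>R \<omega>)" for \<omega>
  have a_bd: "cmod (a \<omega>) \<le> (LINT x|lborel. cmod (G x))" for \<omega>
    using cmod_ft_le[of G "R *\<^sub>R \<omega>"] by (auto simp: a_def norm_mult split: split_indicator)
  have a_meas [measurable]: "a \<in> borel_measurable borel" unfolding a_def by measurable
  have sf: "sphere_fun a" unfolding sphere_fun_def using a_meas a_bd by blast
  have na: "near a" using sf by (auto simp: near_def a_def N_def)
  define Z where "Z = sphere_L2 a"
  \<comment> \<open>K1 + 1 in place of K1 keeps s positive, so that division by t is
    possible.\<close>
  define s where "s = 12 * (K1 + 1) * (R / R ^ DIM('a))"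
  have s_pos: "s > 0" using K1_nonneg R0 by (simp add: s_def)
  \<comment> \<open>Chosen so that the coefficient of Z on the right becomes 1/2 and can be
    absorbed.\<close>
  define t where "t = 40 * s / R"
  have t_pos: "t > 0" using s_pos R0 by (simp add: t_def)
  let ?u = "herglotz R a"
  have u_meas [measurable]: "?u \<in> borel_measurable borel" by (rule herglotz_measurable'[OF sf])
  have "complex_of_real Z = (LINT \<omega>|sphere_measure. a \<omega> * cnj (ft G (R *\<^sub>R \<omega>)))"
    unfolding Z_def sphere_L2_def integral_complex_of_real[symmetric] complex_norm_square
    by (intro Bochner_Integration.integral_cong refl) (auto simp: a_def split: split_indicator)
  also have "\<dots> = (LINT x|lborel. cnj (G x) * ?u x)"
    by (rule herglotz_ft_duality[OF G_int a_meas a_bd, symmetric])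
  finally have Zeq: "complex_of_real Z = (LINT x|lborel. cnj (G x) * ?u x)" .
  have Z0: "Z \<ge> 0" by (simp add: Z_def sphere_L2_nonneg)
  have "Z = cmod (complex_of_real Z)" using Z0 by simp
  also have "\<dots> \<le> (LINT x|lborel. cmod (cnj (G x) * ?u x))"
    unfolding Zeq by (rule integral_norm_bound)
  also have "\<dots> \<le> (LINT x|lborel. 20 / R * (t * W R x + 1 / t * (W R x * (cmod (?u x))\<^sup>2)))"
  proof (rule integral_mono)
    show "integrable lborel (\<lambda>x. cmod (cnj (G x) * ?u x))"
      by (rule integrable_bounded_support[of _ "2 * (LINT \<omega>|sphere_measure. cmod (a \<omega>))" L])
        (use G_bd G0 herglotz_bounded[OF sf] in \<open>auto simp: norm_mult intro!: mult_mono\<close>)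
    show "integrable lborel (\<lambda>x. 20 / R * (t * W R x + 1 / t * (W R x * (cmod (?u x))\<^sup>2)))"
      using R0 by (intro integrable_mult_right Bochner_Integration.integrable_add integrable_W W_sq_integrable sf) auto
    fix x
    show "cmod (cnj (G x) * ?u x) \<le> 20 / R * (t * W R x + 1 / t * (W R x * (cmod (?u x))\<^sup>2))"
    proof (cases "G x = 0")
      case True
      then show ?thesis using R0 t_pos W_nonneg[of R x] by simp
    next
      case False
      then have nc: "norm (x - c) \<le> (r/2)/2" and RF: "\<bar>R * F x\<bar> \<le> 3" using G_supp by auto
      have b: "9/16 \<le> bmp x" unfolding bmp_def using r nc by (intro bump_ge) auto
      have "(R * F x)\<^sup>2 \<le> 3\<^sup>2" using power_mono[OF RF, of 2] by simp
      then have "R / 10 \<le> R / (1 + (R * F x)\<^sup>2)"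
        using R0 by (intro divide_left_mono) (auto simp: add_pos_nonneg)
      then have "9/16 * (R / 10) \<le> bmp x * (R / (1 + (R * F x)\<^sup>2))"
        using b R0 by (intro mult_mono) auto
      moreover have "x \<in> ball c r" using nc r by (simp add: dist_norm norm_minus_commute)
      ultimately have "9/160 * R \<le> W R x" by (simp add: W_def)
      then have "2 \<le> 40 / R * W R x" using R0 by (simp add: field_simps)
      then have "cmod (G x) \<le> 40 / R * W R x" using G_bd[of x] by linarith
      then have "cmod (cnj (G x) * ?u x) \<le> (40 / R * W R x) * cmod (?u x)"
        unfolding norm_mult complex_mod_cnj by (rule mult_right_mono) simp
      also have "\<dots> = 20 / R * W R x * (2 * cmod (?u x))" by simp
      also have "\<dots> \<le> 20 / R * W R x * (t + 1 / t * (cmod (?u x))\<^sup>2)"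
      proof (rule mult_left_mono)
        have "0 \<le> (t - cmod (?u x))\<^sup>2" by simp
        then have "2 * cmod (?u x) * t \<le> t * t + (cmod (?u x))\<^sup>2"
          by (simp add: power2_diff power2_eq_square algebra_simps)
        then show "2 * cmod (?u x) \<le> t + 1 / t * (cmod (?u x))\<^sup>2"
          using t_pos by (simp add: field_simps)
        show "0 \<le> 20 / R * W R x" using R0 W_nonneg[of R x] by simp
      qed
      also have "\<dots> = 20 / R * (t * W R x + 1 / t * (W R x * (cmod (?u x))\<^sup>2))"
        by (simp only: distrib_left mult_ac)
      finally show ?thesis .
    qed
  qed
  also have "\<dots> = 20 / R * (t * (LINT x|lborel. W R x) + 1 / t * Q R a)"
    unfolding Q_def integral_mult_right_zero using R0
    by (subst Bochner_Integration.integral_add) (auto intro!: integrable_W W_sq_integrable sf)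
  also have "\<dots> \<le> 20 / R * (t * (2 * Y * vol) + 1 / t * (s * Z))"
  proof (intro mult_left_mono add_mono)
    show "(LINT x|lborel. W R x) \<le> 2 * Y * vol" using R0 by (intro integral_W_le) simp
    have "12 * K1 * (R / R ^ DIM('a)) \<le> s" using R0 unfolding s_def by (intro mult_right_mono) auto
    then have "12 * K1 * (R / R ^ DIM('a)) * Z \<le> s * Z" by (rule mult_right_mono[OF _ Z0])
    then show "Q R a \<le> s * Z" using Q_near_bound[OF na R] by (simp add: Z_def)
  qed (use R0 t_pos in auto)
  also have "\<dots> = 20 / R * t * (2 * Y * vol) + (20 / R * (1 / t) * s) * Z"
    by (simp add: algebra_simps)
  also have "20 / R * (1 / t) * s = 1/2" using s_pos R0 by (simp add: t_def)
  finally have "Z \<le> 2 * (20 / R * t * (2 * Y * vol))" by simp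
  also have "\<dots> = 38400 * (K1 + 1) * Y * vol * (1 / (R * R ^ DIM('a)))"
    using R0 by (simp add: t_def s_def divide_simps)
  finally have "ennreal Z \<le> ennreal (38400 * (K1 + 1) * Y * vol * (1 / (R * R ^ DIM('a))))"
    by (rule ennreal_leI)
  moreover have "ennreal Z = (\<integral>\<^sup>+\<omega>. indicator N \<omega> * ennreal ((cmod (ft G (R *\<^sub>R \<omega>)))\<^sup>2) \<partial>sphere_measure)"
    unfolding Z_def sphere_L2_nn[OF sf, symmetric] a_def
    by (intro nn_integral_cong) (auto split: split_indicator)
  ultimately show ?thesis by (simp add: N_def)
qed

end

section \<open>Frequencies tangential to the boundary\<close>

lemma lipschitz_borel:
  fixes p :: "'a::euclidean_space \<Rightarrow> real"
  assumes lip: "\<And>x y. \<bar>p x - p y\<bar> \<le> K * norm (x - y)"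
  shows "p \<in> borel_measurable borel"
proof (rule borel_measurable_continuous_onI, rule continuous_onI)
  fix x :: 'a and e :: real assume e: "e > 0"
  show "\<exists>d>0. \<forall>x'\<in>UNIV. dist x' x < d \<longrightarrow> dist (p x') (p x) \<le> e"
  proof (intro exI[of _ "e / (\<bar>K\<bar> + 1)"] conjI ballI impI)
    fix x' assume "dist x' x < e / (\<bar>K\<bar> + 1)"
    then have "(\<bar>K\<bar> + 1) * norm (x' - x) < e" by (simp add: dist_norm field_simps)
    moreover have "K * norm (x' - x) \<le> (\<bar>K\<bar> + 1) * norm (x' - x)" by (intro mult_right_mono) auto
    ultimately show "dist (p x') (p x) \<le> e" using lip[of x' x] by (simp add: dist_real_def)
  qed (use e in simp)
qed

lemma cos_ge_half: "\<bar>t\<bar> \<le> 1 \<Longrightarrow> 1/2 \<le> cos (t :: real)"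
proof -
  assume t: "\<bar>t\<bar> \<le> 1"
  have "\<bar>sin (t / 2)\<bar> \<le> 1/2" using abs_sin_x_le_abs_x[of "t / 2"] t by simp
  then have "(sin (t / 2))\<^sup>2 \<le> (1/2)\<^sup>2" using power_mono[of "\<bar>sin (t / 2)\<bar>" "1/2" 2] by simp
  then show ?thesis using cos_double_sin[of "t / 2"] by (simp add: power2_eq_square)
qed

lemma second_difference_step_integral:
  fixes \<zeta> :: "real \<Rightarrow> real"
  assumes lip: "\<And>v w. \<bar>\<zeta> v - \<zeta> w\<bar> \<le> K * \<bar>v - w\<bar>"
      and bd: "\<And>w. \<bar>\<zeta> w\<bar> \<le> 1"
    and supp: "\<And>w. \<rho> < \<bar>w\<bar> \<Longrightarrow> \<zeta> w = 0"
    and w: "\<bar>wa\<bar> \<le> \<rho>" "\<bar>wb\<bar> \<le> \<rho>" "\<bar>wc\<bar>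
        \<le> \<rho>" "\<bar>wa - wb\<bar> \<le> \<eta>" "\<bar>wc - wb\<bar> \<le> \<eta>"
    and sec: "\<bar>wc - 2 * wb + wa\<bar> \<le> \<sigma>"
    and g: "\<And>w. w \<noteq> wa \<Longrightarrow> w \<noteq> wb
        \<Longrightarrow> w \<noteq> wc \<Longrightarrow> \<bar>w\<bar> \<le> \<rho> \<Longrightarrow>
      g w = \<theta> * (indicator {wc<..} w - 2 * indicator {wb<..} w + indicator {wa<..} w)"
    and g_meas [measurable]: "g \<in> borel_measurable borel"
  shows "\<bar>LINT w|lborel. \<zeta> w * g w\<bar> \<le> \<bar>\<theta>\<bar> * (4 * K * \<eta>\<^sup>2 + \<sigma>)"
proof -
  have K: "K \<ge> 0" using lip[of 0 1] by simp
  have \<eta>: "\<eta> \<ge> 0" using w by linarith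
  have \<rho>: "\<rho> \<ge> 0" using w by linarith
  \<comment> \<open>Cutting the half-lines off at \<rho> makes them integrable; \<zeta> vanishes
    beyond \<rho>, so the pairing is unchanged.\<close>
  define S where "S w = (indicator {wc<..\<rho>} w - 2 * indicator {wb<..\<rho>} w
      + indicator {wa<..\<rho>} w :: real)" for w
  have [measurable]: "S \<in> borel_measurable borel" unfolding S_def by measurable
  have [measurable]: "\<zeta> \<in> borel_measurable borel" by (rule lipschitz_borel) (use lip in simp)
  have S_bd: "\<bar>S w\<bar> \<le> 2" for w by (auto simp: S_def split: split_indicator)
  have S_supp: "S w = 0" if "\<eta> < \<bar>w - wb\<bar>" for w
    using w that by (auto simp: S_def abs_real_def split: split_indicator if_splits)
  have S_supp2: "S w = 0" if "\<rho> < \<bar>w\<bar>" for w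
    using w that by (auto simp: S_def abs_real_def split: split_indicator if_splits)
  have S_int: "integrable lborel S"
    by (rule integrable_bounded_support[of _ 2 \<rho>]) (use S_bd S_supp2 in auto)
  have S_val: "(LINT w|lborel. S w) = - (wc - 2 * wb + wa)"
  proof -
    have i: "integrable lborel (indicator {v<..\<rho>} :: real \<Rightarrow> real)" "(LINT w|lborel. indicator {v<..\<rho>} w) = \<rho> - v" if "\<bar>v\<bar> \<le> \<rho>" for v
      using that by (auto simp: abs_le_iff intro!: integrable_real_indicator)
    show ?thesis
      unfolding S_def using i w by simp
  qed
  have "(LINT w|lborel. \<zeta> w * g w) = (LINT w|lborel. \<theta> * (\<zeta> w * S w))"
  proof (rule integral_cong_AE)
    show "AE w in lborel. \<zeta> w * g w = \<theta> * (\<zeta> w * S w)"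
    proof (rule AE_mp[OF AE_conjI[OF AE_lborel_singleton[of wa] AE_conjI[OF AE_lborel_singleton[of wb] AE_lborel_singleton[of wc]]]], intro AE_I2 impI)
      fix w assume ne: "w \<noteq> wa \<and> w \<noteq> wb \<and> w \<noteq> wc"
      show "\<zeta> w * g w = \<theta> * (\<zeta> w * S w)"
      proof (cases "\<bar>w\<bar> \<le> \<rho>")
        case True
        then show ?thesis using g[of w] ne by (auto simp: S_def split: split_indicator)
      qed (simp add: supp)
    qed
  qed measurable
  also have "\<dots> = \<theta> * (LINT w|lborel. (\<zeta> w - \<zeta> wb) * S w + \<zeta> wb * S w)"
    by (simp add: algebra_simps)
  also have "\<dots> = \<theta> * ((LINT w|lborel. (\<zeta> w - \<zeta> wb) * S w) + \<zeta> wb * (LINT w|lborel. S w))"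
  proof -
    have "integrable lborel (\<lambda>w. (\<zeta> w - \<zeta> wb) * S w)"
    proof (rule integrable_bounded_support[of _ "2 * 2" \<rho>])
      show "norm ((\<zeta> w - \<zeta> wb) * S w) \<le> 2 * 2" for w
        unfolding norm_mult using bd[of w] bd[of wb] S_bd[of w] by (intro mult_mono) auto
    qed (use S_supp2 in auto)
    then show ?thesis using S_int by (subst Bochner_Integration.integral_add) auto
  qed
  finally have eq: "(LINT w|lborel. \<zeta> w * g w) = \<theta> * ((LINT w|lborel. (\<zeta> w
      - \<zeta> wb) * S w) + \<zeta> wb * (LINT w|lborel. S w))" .
  have "\<bar>LINT w|lborel. (\<zeta> w - \<zeta> wb) * S w\<bar> \<le> (LINT w|lborel. indicator {wb
      - \<eta>..wb + \<eta>} w * (K * \<eta> * 2))"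
    unfolding real_norm_def[symmetric]
  proof (rule order_trans[OF integral_norm_bound integral_mono])
    show "integrable lborel (\<lambda>w. indicator {wb - \<eta>..wb + \<eta>} w * (K * \<eta> * 2))"
      using \<eta> by (intro integrable_mult_left) (auto intro!: integrable_real_indicator)
    have *: "norm ((\<zeta> w - \<zeta> wb) * S w) \<le> indicator {wb - \<eta>..wb + \<eta>} w
        * (K * \<eta> * 2)" for w
    proof (cases "\<eta> < \<bar>w - wb\<bar>")
      case False
      then have "K * \<bar>w - wb\<bar> \<le> K * \<eta>" using K by (intro mult_left_mono) auto
      then have "\<bar>\<zeta> w - \<zeta> wb\<bar> * \<bar>S w\<bar> \<le> (K * \<eta>) * 2"
        using lip[of w wb] S_bd[of w] K \<eta> by (intro mult_mono) auto
      moreover have "w \<in> {wb - \<eta>..wb + \<eta>}" using False by (auto simp: abs_real_def split: if_splits)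
      ultimately show ?thesis by (simp add: abs_mult)
    qed (use S_supp K \<eta> in auto)
    then show "norm ((\<zeta> w - \<zeta> wb) * S w) \<le> indicator {wb - \<eta>..wb + \<eta>} w
        * (K * \<eta> * 2)" for w .
    show "integrable lborel (\<lambda>w. norm ((\<zeta> w - \<zeta> wb) * S w))"
    proof (rule integrable_bounded_support[of _ "2 * 2" \<rho>])
      have "\<bar>\<zeta> w - \<zeta> wb\<bar> * \<bar>S w\<bar> \<le> 2 * 2" for w
        using bd[of w] bd[of wb] S_bd[of w] by (intro mult_mono) auto
      then show "norm (norm ((\<zeta> w - \<zeta> wb) * S w)) \<le> 2 * 2" for w
        by (simp add: abs_mult)
    qed (use S_supp2 in auto)
  qed
  also have "\<dots> = 4 * K * \<eta>\<^sup>2"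
    using \<eta> by (simp add: power2_eq_square)
  finally have 1: "\<bar>LINT w|lborel. (\<zeta> w - \<zeta> wb) * S w\<bar> \<le> 4 * K * \<eta>\<^sup>2" .
  have 2: "\<bar>\<zeta> wb * (LINT w|lborel. S w)\<bar> \<le> \<sigma>"
    unfolding S_val abs_mult abs_minus_cancel using sec bd[of wb] mult_left_le_one_le[of "\<bar>wc - 2 * wb
        + wa\<bar>" "\<bar>\<zeta> wb\<bar>"] by linarith
  have "\<bar>(LINT w|lborel. (\<zeta> w - \<zeta> wb) * S w) + \<zeta> wb * (LINT w|lborel. S w)\<bar>
      \<le> 4 * K * \<eta>\<^sup>2 + \<sigma>"
    using 1 2 by linarith
  then show ?thesis unfolding eq abs_mult by (rule mult_left_mono) simp
qed

section \<open>Weighted X-ray transform\<close>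

definition tent :: "real \<Rightarrow> real" where "tent w = max 0 (1 - \<bar>w\<bar>)"

lemma tent_range: "0 \<le> tent w" "tent w \<le> 1" by (auto simp: tent_def)
lemma tent_supp: "1 < \<bar>w\<bar> \<Longrightarrow> tent w = 0" by (auto simp: tent_def)
lemma tent_lipschitz: "\<bar>tent v - tent w\<bar> \<le> \<bar>v - w\<bar>" by (auto simp: tent_def max_def)
lemma tent_measurable [measurable]: "tent \<in> borel_measurable borel"
  unfolding tent_def[abs_def] by measurable

text \<open>For |\<kappa>| \<le> 1 the real part of the integrand is nonnegative, and where |w|
  \<le> 1/2 both the tent and the cosine are at least 1/2.\<close>

lemma tent_fourier_lower:
  assumes "\<bar>\<kappa>\<bar> \<le> 1"
  shows "1/4 \<le> cmod (LINT w|lborel. of_real (tent w) * cis (w * \<kappa>))"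
proof -
  have i: "integrable lborel (\<lambda>w. of_real (tent w) * cis (w * \<kappa>))"
    by (rule integrable_bounded_support[of _ 1 1]) (use tent_range tent_supp in \<open>auto simp: norm_mult\<close>)
  have "1/4 = (LINT w|lborel. indicator {-(1/2)..1/2::real} w * (1/4 :: real))" by simp
  also have "\<dots> \<le> (LINT w|lborel. Re (of_real (tent w) * cis (w * \<kappa>)))"
  proof (rule integral_mono)
    show "integrable lborel (\<lambda>w. Re (of_real (tent w) * cis (w * \<kappa>)))" by (rule integrable_Re[OF i])
    show "indicator {-(1/2)..1/2} w * (1/4) \<le> Re (of_real (tent w) * cis (w * \<kappa>))" for w
    proof (cases "\<bar>w\<bar> \<le> 1")
      case True
      have "\<bar>w * \<kappa>\<bar> \<le> 1" unfolding abs_mult using True assms by (intro mult_le_one) auto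
      then have c: "1/2 \<le> cos (w * \<kappa>)" by (rule cos_ge_half)
      show ?thesis
      proof (cases "\<bar>w\<bar> \<le> 1/2")
        case True
        then have "1/2 * (1/2) \<le> tent w * cos (w * \<kappa>)"
          using c by (intro mult_mono) (auto simp: tent_def)
        then show ?thesis using True by (simp add: indicator_def)
      next
        case False
        then have "w \<notin> {-(1/2)..1/2}" by auto
        then show ?thesis using c tent_range[of w] by simp
      qed
    next
      case False
      then show ?thesis using tent_supp[of w] by (auto simp: indicator_def)
    qed
  qed (auto intro!: integrable_mult_left integrable_real_indicator)
  also have "\<dots> = Re (LINT w|lborel. of_real (tent w) * cis (w * \<kappa>))"
    by (rule integral_Re[OF i])
  also have "\<dots> \<le> cmod (LINT w|lborel. of_real (tent w) * cis (w * \<kappa>))" by (rule complex_Re_le_cmod)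
  finally show ?thesis .
qed

text \<open>An X-ray transform weighted by a tent along the line. The weight keeps the support
  bounded, as the trace inequality demands. On the transform side it acts as a multiplier that
  depends only on q \<bullet> \<xi> and is bounded below in the slab |q \<bullet> \<xi>| \<le>
  1.\<close>

definition xray :: "'a::euclidean_space \<Rightarrow> ('a \<Rightarrow> real) \<Rightarrow> 'a \<Rightarrow> real" where
  "xray q G x = (LINT w|lborel. tent w * G (x + w *\<^sub>R q))"

lemma xray_measurable [measurable]:
  assumes [measurable]: "G \<in> borel_measurable borel"
  shows "xray q G \<in> borel_measurable borel"
proof -
  have "(\<lambda>x. LINT w|lborel. tent w * G (x + w *\<^sub>R q)) \<in> borel_measurable borel"
    by (rule sigma_finite_measure.borel_measurable_lebesgue_integral[OF lborel.sigma_finite_measure_axioms]) measurable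
  then show ?thesis by (simp add: xray_def[abs_def])
qed

lemma xray_supp:
  assumes "\<And>x. norm x > L \<Longrightarrow> G x = 0" and "norm x > L + norm q"
  shows "xray q G x = 0"
proof -
  have *: "tent w * G (x + w *\<^sub>R q) = 0" for w
  proof (cases "\<bar>w\<bar> > 1")
    case False
    then have "norm (w *\<^sub>R q) \<le> norm q" by (simp add: mult_left_le_one_le)
    then have "norm (x + w *\<^sub>R q) > L" using assms(2) norm_triangle_ineq4[of "x
        + w *\<^sub>R q" "w *\<^sub>R q"] by simp
    then show ?thesis using assms(1) by simp
  qed (simp add: tent_supp)
  show ?thesis unfolding xray_def * by simp
qed

lemma ft_xray:
  fixes G :: "'a::euclidean_space \<Rightarrow> real"
  assumes [measurable]: "G \<in> borel_measurable borel" and bd: "\<And>x. \<bar>G x\<bar> \<le> K"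
      and supp: "\<And>x. norm x > L \<Longrightarrow> G x = 0"
  shows "ft (\<lambda>x. of_real (xray q G x)) \<xi> = (LINT w|lborel. of_real (tent w) * cis (w
      * (q \<bullet> \<xi>))) * ft (\<lambda>x. of_real (G x)) \<xi>"
proof -
  let ?f = "\<lambda>x w. complex_of_real (tent w) * (cis (- (x \<bullet> \<xi>)) * of_real (G (x + w *\<^sub>R q)))"
  have "integrable (lborel :: ('a \<times> real) measure) (\<lambda>p. ?f (fst p) (snd p))"
  proof (rule integrable_bounded_support[of _ K "L + norm q + 1"])
    show "norm (?f (fst p) (snd p)) \<le> K" for p
      using bd[of "fst p + snd p *\<^sub>R q"] tent_range[of "snd p"] mult_left_le_one_le[of "\<bar>G (fst p
          + snd p *\<^sub>R q)\<bar>" "tent (snd p)"]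
      by (simp add: norm_mult)
    show "?f (fst p) (snd p) = 0" if p: "norm p > L + norm q + 1" for p
    proof (cases "\<bar>snd p\<bar> > 1")
      case False
      have "norm p \<le> norm (fst p) + norm (snd p)" using norm_Pair_le[of "fst p" "snd p"] by simp
      then have "norm (fst p) > L + norm q" using p False by simp
      moreover have "norm (snd p *\<^sub>R q) \<le> norm q" using False by (simp add: mult_left_le_one_le)
      ultimately have "norm (fst p + snd p *\<^sub>R q) > L"
        using norm_triangle_ineq4[of "fst p + snd p *\<^sub>R q" "snd p *\<^sub>R q"] by simp
      then show ?thesis using supp by simp
    qed (simp add: tent_supp)
    have "(\<lambda>p. ?f (fst p) (snd p)) \<in> borel_measurable (borel \<Otimes>\<^sub>M borel)" by measurable
    then show "(\<lambda>p. ?f (fst p) (snd p)) \<in> borel_measurable borel" by (simp only: borel_prod)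
  qed
  then have int: "integrable (lborel \<Otimes>\<^sub>M lborel) (\<lambda>(x, w). ?f x w)"
    unfolding lborel_prod by (simp add: case_prod_beta')
  have "ft (\<lambda>x. of_real (xray q G x)) \<xi> = (LINT x|lborel. LINT w|lborel. ?f x w)"
  proof -
    have "cis (- (x \<bullet> \<xi>)) * of_real (xray q G x) = (LINT w|lborel. ?f x w)" for x
    proof -
      have "cis (- (x \<bullet> \<xi>)) * of_real (xray q G x)
          = (LINT w|lborel. cis (- (x \<bullet> \<xi>)) * of_real (tent w * G (x + w *\<^sub>R q)))"
        unfolding xray_def integral_mult_right_zero integral_complex_of_real ..
      then show ?thesis by (simp add: mult.left_commute)
    qed
    then show ?thesis by (simp add: ft_def)
  qed
  also have "\<dots> = (LINT w|lborel. LINT x|lborel. ?f x w)"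
    using lborel_pair.Fubini_integral[OF int] by simp
  also have "\<dots> = (LINT w|lborel. of_real (tent w) * ft (\<lambda>x. of_real (G (x + w *\<^sub>R q))) \<xi>)"
    by (simp add: ft_def)
  also have "\<dots> = (LINT w|lborel. (of_real (tent w) * cis (w
      * (q \<bullet> \<xi>))) * ft (\<lambda>x. of_real (G x)) \<xi>)"
    by (subst ft_shift[where H="\<lambda>x. of_real (G x)"]) (simp_all add: mult.assoc)
  also have "\<dots> = (LINT w|lborel. of_real (tent w) * cis (w
      * (q \<bullet> \<xi>))) * ft (\<lambda>x. of_real (G x)) \<xi>"
    by simp
  finally show ?thesis .
qed

text \<open>The mean value inequality on the convex ball for F minus its linear model, whose
  gradient m - n is small.\<close>

lemma GDERIV_ball_linear_approx:
  fixes F :: "'a::euclidean_space \<Rightarrow> real"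
  assumes F: "\<And>x. x \<in> ball c r \<Longrightarrow> GDERIV F x :> m x"
      and m: "\<And>x. x \<in> ball c r \<Longrightarrow> norm (m x - n) \<le> \<epsilon>"
    and xy: "x \<in> ball c r" "y \<in> ball c r"
  shows "\<bar>F y - F x - (y - x) \<bullet> n\<bar> \<le> \<epsilon> * norm (y - x)"
proof -
  have "norm ((F y - y \<bullet> n) - (F x - x \<bullet> n)) \<le> \<epsilon> * norm (y - x)"
  proof (rule differentiable_bound[where S="ball c r" and f="\<lambda>x. F x - x \<bullet> n"
      and f'="\<lambda>x h. h \<bullet> m x - h \<bullet> n"])
    fix z assume z: "z \<in> ball c r"
    show "((\<lambda>x. F x - x \<bullet> n) has_derivative (\<lambda>h. h \<bullet> m z
        - h \<bullet> n)) (at z within ball c r)"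
      using F[OF z] unfolding gderiv_def
      by (rule has_derivative_diff[OF has_derivative_at_withinI bounded_linear_imp_has_derivative[OF bounded_linear_inner_left]])
    show "onorm (\<lambda>h. h \<bullet> m z - h \<bullet> n) \<le> \<epsilon>"
    proof (rule onorm_le)
      fix h
      have "norm (h \<bullet> m z - h \<bullet> n) \<le> norm h * norm (m z - n)"
        using Cauchy_Schwarz_ineq2[of h "m z - n"] by (simp add: inner_diff_right)
      also have "\<dots> \<le> norm h * \<epsilon>" by (intro mult_left_mono m z) simp
      finally show "norm (h \<bullet> m z - h \<bullet> n) \<le> \<epsilon> * norm h" by (simp add: mult.commute)
    qed
  qed (use xy in auto)
  then show ?thesis by (simp add: inner_diff_left algebra_simps)
qed

text \<open>Bounds the norms of the directions \<open>n - (j/R) *\<^sub>R tang b\<close> of the X-ray transforms.\<close>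

definition dim_const :: "'a::euclidean_space itself \<Rightarrow> real" where
  "dim_const _ = 3 + sqrt (real DIM('a))"

lemma dim_const_ge: "dim_const TYPE('a::euclidean_space) \<ge> 4"
proof -
  have "1 \<le> sqrt (real DIM('a))" by (intro real_sqrt_ge_one) (simp add: Suc_leI)
  then show ?thesis by (simp add: dim_const_def)
qed

text \<open>Forward differences, so that the transform is multiplied by (cis (h \<bullet> \<xi>) -
  1)^2.\<close>

definition second_diff :: "('a::euclidean_space \<Rightarrow> real) \<Rightarrow> 'a \<Rightarrow> 'a \<Rightarrow> real" where
  "second_diff f h x = f (x + h + h) - 2 * f (x + h) + f x"

lemma second_diff_measurable [measurable]:
  assumes [measurable]: "f \<in> borel_measurable borel"
  shows "second_diff f h \<in> borel_measurable borel"
  unfolding second_diff_def[abs_def] by measurable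

text \<open>\<open>f\<close> stands for the indicator of B, known through its constant values
  \<alpha> and \<beta> on the two sides of the piece. \<open>m_close2\<close> scales the closeness
  of m to n with \<open>dim_const\<close>, because lines in directions q of that length must still
  cross the piece transversally. The cutoff \<phi> is supported in a much smaller ball, so that
  points shifted by h or 2 h and the lines through them remain where F is controlled.\<close>

locale far_graph = near_graph F m n c r
  for F :: "'a::euclidean_space \<Rightarrow> real" and m :: "'a \<Rightarrow> 'a" and n c :: 'a and r :: real +
  fixes f \<phi> :: "'a \<Rightarrow> real" and \<alpha> \<beta> C1 Lip :: real
  assumes F_c: "F c = 0"
    and m_close2: "\<And>x. x \<in> ball c r \<Longrightarrow> norm (m x - n) * (4 * dim_const TYPE('a)) \<le> 1"
    and f_meas [measurable]: "f \<in> borel_measurable borel" and f_bd: "\<And>x. 0 \<le> f x" "\<And>x. f x \<le> 1"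
    and f_pos: "\<And>x. x \<in> ball c r \<Longrightarrow> F x > 0 \<Longrightarrow> f x = \<alpha>"
    and f_neg: "\<And>x. x \<in> ball c r \<Longrightarrow> F x < 0 \<Longrightarrow> f x = \<beta>"
    and \<alpha>\<beta>: "\<bar>\<alpha>\<bar> \<le> 1" "\<bar>\<beta>\<bar> \<le> 1"
    and C1: "C1 \<ge> 0"
    and hoelder: "\<And>P Q. P \<in> ball c r \<Longrightarrow> Q \<in> ball c r \<Longrightarrow> F P
        = 0 \<Longrightarrow> F Q = 0
        \<Longrightarrow> \<bar>(P - Q) \<bullet> m Q\<bar> \<le> C1 * norm (P - Q) powr (3/2)"
    and \<phi>_bd: "\<And>x. \<bar>\<phi> x\<bar> \<le> 1" and \<phi>_lip: "\<And>x y. \<bar>\<phi> x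
        - \<phi> y\<bar> \<le> Lip * norm (x - y)"
    and \<phi>_supp: "\<And>x. \<phi> x \<noteq> 0 \<Longrightarrow> norm (x - c) \<le> r / (32 * dim_const TYPE('a))"
begin

definition "Kq = dim_const TYPE('a)"
text \<open>For parameters up to \<rho> a line of speed at most \<open>Kq\<close> moves by at most
  r/4.\<close>

definition "\<rho> = r / (4 * Kq)"

lemma Kq: "Kq \<ge> 4" unfolding Kq_def by (rule dim_const_ge)
lemma \<rho>_pos: "\<rho> > 0" using Kq r by (simp add: \<rho>_def)
lemma \<rho>_Kq: "\<rho> * Kq = r / 4" unfolding \<rho>_def using Kq by simp
lemma r32: "r / (32 * dim_const TYPE('a)) = \<rho> / 8" by (simp add: \<rho>_def Kq_def)
lemma \<rho>_le: "\<rho> \<le> r / 16" unfolding \<rho>_def using Kq r by (intro divide_left_mono) auto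

lemma Lip_nonneg: "Lip \<ge> 0"
proof -
  obtain b :: 'a where "b \<in> Basis" using nonempty_Basis by blast
  then have "0 \<le> Lip * 1" using \<phi>_lip[of b 0] by (simp add: norm_Basis)
  then show ?thesis by simp
qed

lemma \<phi>_measurable [measurable]: "\<phi> \<in> borel_measurable borel"
  by (rule lipschitz_borel[OF \<phi>_lip])

lemma F_linear_approx:
  assumes "x \<in> ball c r" "y \<in> ball c r"
  shows "\<bar>F y - F x - (y - x) \<bullet> n\<bar> * (4 * Kq) \<le> norm (y - x)"
proof -
  have m: "norm (m x - n) \<le> 1 / (4 * Kq)" if "x \<in> ball c r" for x
    using m_close2[OF that] Kq by (simp add: Kq_def[symmetric] field_simps)
  have "\<bar>F y - F x - (y - x) \<bullet> n\<bar> \<le> 1 / (4 * Kq) * norm (y - x)"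
    by (rule GDERIV_ball_linear_approx[OF F_deriv m assms])
  then show ?thesis using Kq by (simp add: field_simps)
qed

lemma F_lipschitz:
  assumes "x \<in> ball c r" "y \<in> ball c r"
  shows "\<bar>F y - F x\<bar> \<le> 2 * norm (y - x)"
proof -
  have "\<bar>F y - F x - (y - x) \<bullet> n\<bar> * 1 \<le> \<bar>F y - F x - (y - x) \<bullet> n\<bar> * (4 * Kq)"
    using Kq by (intro mult_left_mono) auto
  moreover have "\<bar>(y - x) \<bullet> n\<bar> \<le> norm (y - x)" using Cauchy_Schwarz_ineq2[of "y - x" n] n by simp
  ultimately have "\<bar>F y - F x - (y - x) \<bullet> n\<bar> \<le> norm (y - x)" "\<bar>(y
      - x) \<bullet> n\<bar> \<le> norm (y - x)"
    using F_linear_approx[OF assms] by simp_all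
  then show ?thesis unfolding abs_le_iff by auto
qed

section \<open>Boundary crossings of a transversal line\<close>

context
  fixes q :: 'a
  assumes q_n: "q \<bullet> n = 1" and q_le: "norm q \<le> Kq"
begin

text \<open>The slope of F along q is within 1/4 of q \<bullet> n = 1: the gradient error 1/(4 Kq)
  is multiplied by the length of q, which is at most Kq.\<close>

lemma F_increasing:
  assumes "p + v *\<^sub>R q \<in> ball c r" "p + w *\<^sub>R q \<in> ball c r" "v \<le> w"
  shows "3/4 * (w - v) \<le> F (p + w *\<^sub>R q) - F (p + v *\<^sub>R q)"
proof -
  have e: "(p + w *\<^sub>R q) - (p + v *\<^sub>R q) = (w - v) *\<^sub>R q" by (simp add: algebra_simps)
  have "\<bar>F (p + w *\<^sub>R q) - F (p + v *\<^sub>R q) - (w - v)\<bar> * (4 * Kq) \<le> (w - v) * norm q"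
    using F_linear_approx[OF assms(1,2)] assms(3) unfolding e by (simp add: q_n)
  also have "\<dots> \<le> (w - v) * Kq" using assms(3) by (intro mult_left_mono q_le) auto
  finally have "(4 * \<bar>F (p + w *\<^sub>R q) - F (p + v *\<^sub>R q) - (w - v)\<bar>) * Kq \<le> (w
      - v) * Kq" by (simp add: mult_ac)
  then have "4 * \<bar>F (p + w *\<^sub>R q) - F (p + v *\<^sub>R q) - (w - v)\<bar> \<le> w - v"
    using Kq by (simp add: mult_le_cancel_right)
  then have "\<bar>F (p + w *\<^sub>R q) - F (p + v *\<^sub>R q) - (w - v)\<bar> \<le> (w - v) / 4" by simp
  then show ?thesis unfolding abs_le_iff by (auto simp: field_simps)
qed

lemma line_in_ball:
  assumes p: "norm (p - c) \<le> \<rho> / 4" and w: "\<bar>w\<bar> \<le> \<rho>"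
  shows "p + w *\<^sub>R q \<in> ball c r"
proof -
  have "norm (w *\<^sub>R q) \<le> \<rho> * Kq" using w q_le \<rho>_pos by (auto intro!: mult_mono)
  then have "norm ((p - c) + w *\<^sub>R q) \<le> \<rho> / 4 + r / 4"
    using p \<rho>_Kq by (intro norm_triangle_le) simp
  also have "\<dots> < r" using \<rho>_le r by simp
  finally show ?thesis by (simp add: dist_norm norm_minus_commute algebra_simps)
qed

text \<open>|F p| \<le> \<rho>/2, while F changes by at least 3/4 \<rho> towards either end of the
  parameter interval, so its sign changes. Monotonicity makes the crossing unique and decides the
  side, hence the value of f, everywhere else.\<close>

lemma line_hits_graph:
  assumes p: "norm (p - c) \<le> \<rho> / 4"
  obtains w where "\<bar>w\<bar> \<le> \<rho>" "F (p + w *\<^sub>R q) = 0"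
    "\<And>v. \<bar>v\<bar> \<le> \<rho> \<Longrightarrow> v \<noteq> w \<Longrightarrow> f (p
        + v *\<^sub>R q) = \<beta> + (\<alpha> - \<beta>) * indicator {w<..} v"
proof -
  have in_ball: "p + w *\<^sub>R q \<in> ball c r" if "\<bar>w\<bar> \<le> \<rho>" for w
      by (rule line_in_ball[OF p that])
  have p0: "p \<in> ball c r" using in_ball[of 0] \<rho>_pos by simp
  have "c \<in> ball c r" using r by simp
  then have Fp: "\<bar>F p\<bar> \<le> \<rho> / 2" using F_lipschitz[of c p] p0 p F_c by simp
  have "continuous_on {-\<rho>..\<rho>} (\<lambda>w. F (p + w *\<^sub>R q))"
  proof (rule continuous_on_compose2[of "ball c r" F])
    show "continuous_on (ball c r) F"
      using F_deriv unfolding gderiv_def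
      by (intro continuous_at_imp_continuous_on ballI) (rule has_derivative_continuous)
  qed (auto intro!: continuous_intros in_ball simp: abs_le_iff)
  moreover have "F (p + (- \<rho>) *\<^sub>R q) \<le> 0"
    using F_increasing[of p "- \<rho>" 0] in_ball[of "- \<rho>"] in_ball[of 0] \<rho>_pos Fp by simp
  moreover have "0 \<le> F (p + \<rho> *\<^sub>R q)"
    using F_increasing[of p 0 \<rho>] in_ball[of \<rho>] in_ball[of 0] \<rho>_pos Fp by simp
  ultimately obtain w where w: "-\<rho> \<le> w" "w \<le> \<rho>" "F (p + w *\<^sub>R q) = 0"
    using IVT'[of "\<lambda>w. F (p + w *\<^sub>R q)" "- \<rho>" 0 \<rho>] \<rho>_pos by auto
  have wr: "\<bar>w\<bar> \<le> \<rho>" using w by linarith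
  show ?thesis
  proof (rule that[OF wr w(3)])
    fix v assume v: "\<bar>v\<bar> \<le> \<rho>" "v \<noteq> w"
    show "f (p + v *\<^sub>R q) = \<beta> + (\<alpha> - \<beta>) * indicator {w<..} v"
    proof (cases "v > w")
      case True
      then have "F (p + v *\<^sub>R q) > 0"
        using F_increasing[of p w v] in_ball[OF v(1)] in_ball[OF wr] w(3) by simp
      then show ?thesis using f_pos[OF in_ball[OF v(1)]] True by simp
    next
      case False
      then have "F (p + v *\<^sub>R q) < 0"
        using F_increasing[of p v w] in_ball[OF v(1)] in_ball[OF wr] w(3) v(2) by simp
      then show ?thesis using f_neg[OF in_ball[OF v(1)]] False by simp
    qed
  qed
qed

definition "Kz = 1 + Lip * Kq"
text \<open>The outer 2 bounds |\<alpha> - \<beta>|; 36 = 4 * 3^2 comes from crossings that differ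
  by at most 3/R; 8/3 = 2/(3/4) comes from two chords and the transversality 3/4; and
  \<open>Kz\<close> is the Lipschitz constant of tent times \<phi> along the line.\<close>

definition "Cx = 2 * (36 * Kz + 8/3 * C1 * (4 * Kq) powr (3/2))"

text \<open>The place where the hypothesis on the normal acts. The lines through z, z + h and z + h
  + h meet the boundary at P0, P1 and P2, and in (P2 - P1) + (P0 - P1) the shift h cancels, leaving
  q times the second difference of the crossing parameters. Both chords have length O(1/R), so their
  normal components at P1 are O(R^(-3/2)), and q is transversal there.\<close>

lemma xray_bound:
  assumes R: "R \<ge> 1" "R \<ge> 16 / \<rho>" and h: "norm h = 1 / R"
  shows "\<bar>xray q (\<lambda>x. \<phi> x * second_diff f h x) x\<bar> \<le> Cx * R powr (- (3/2))"
proof (cases "\<exists>w. \<phi> (x + w *\<^sub>R q) \<noteq> 0")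
  case False
  have "Cx \<ge> 0" using Lip_nonneg Kq C1 by (simp add: Cx_def Kz_def)
  then show ?thesis using False by (simp add: xray_def)
next
  case True
  \<comment> \<open>The base point is moved along the line to a point z where \<phi> does not
    vanish, which puts z near c; x itself may be farther away.\<close>
  then obtain ws where ws: "\<phi> (x + ws *\<^sub>R q) \<noteq> 0" by blast
  define z where "z = x + ws *\<^sub>R q"
  have zc: "norm (z - c) \<le> \<rho> / 8" using \<phi>_supp[OF ws] r32 by (simp add: z_def)
  have R0: "R > 0" using R by simp
  have hR: "1 / R \<le> \<rho> / 16" using R \<rho>_pos by (simp add: field_simps)
  have "norm (z - c) \<le> \<rho> / 4" using zc \<rho>_pos by simp
  moreover have "norm (z + h - c) \<le> \<rho> / 4"
    using norm_triangle_ineq[of "z - c" h] zc h hR \<rho>_pos by (simp add: algebra_simps)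
  moreover have "norm (z + h + h - c) \<le> \<rho> / 4"
    using norm_triangle_ineq[of "z - c" "h + h"] norm_triangle_ineq[of h h] zc h hR by (simp add: algebra_simps)
  ultimately obtain w0 w1 w2 where
    w0: "\<bar>w0\<bar> \<le> \<rho>" "F (z + w0 *\<^sub>R q) = 0" "\<And>v. \<bar>v\<bar>
        \<le> \<rho> \<Longrightarrow> v \<noteq> w0 \<Longrightarrow> f (z + v *\<^sub>R q) = \<beta>
        + (\<alpha> - \<beta>) * indicator {w0<..} v" and
    w1: "\<bar>w1\<bar> \<le> \<rho>" "F (z + h + w1 *\<^sub>R q) = 0" "\<And>v. \<bar>v\<bar>
        \<le> \<rho> \<Longrightarrow> v \<noteq> w1 \<Longrightarrow> f (z + h + v *\<^sub>R q) = \<beta>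
        + (\<alpha> - \<beta>) * indicator {w1<..} v" and
    w2: "\<bar>w2\<bar> \<le> \<rho>" "F (z + h + h + w2 *\<^sub>R q) = 0" "\<And>v. \<bar>v\<bar>
        \<le> \<rho> \<Longrightarrow> v \<noteq> w2 \<Longrightarrow> f (z + h + h + v *\<^sub>R q)
        = \<beta> + (\<alpha> - \<beta>) * indicator {w2<..} v"
    by (metis line_hits_graph)
  have b0: "z + v *\<^sub>R q \<in> ball c r" and b1: "z + h + v *\<^sub>R q \<in> ball c r" and b2: "z + h
      + h + v *\<^sub>R q \<in> ball c r"
    if "\<bar>v\<bar> \<le> \<rho>" for v
    using \<open>norm (z - c) \<le> \<rho> / 4\<close> \<open>norm (z + h - c)
        \<le> \<rho> / 4\<close> \<open>norm (z + h + h - c) \<le> \<rho> / 4\<close> that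
    by (auto intro!: line_in_ball simp del: mem_ball)
  \<comment> \<open>F changes by at most 2/R under the shift h and at rate at least 3/4 along q; the
    resulting 8/3 is rounded up to 3.\<close>
  define \<eta> where "\<eta> = 3 / R"
  have incr: "3/4 * \<bar>w - v\<bar> \<le> \<bar>F (p + w *\<^sub>R q) - F (p + v *\<^sub>R q)\<bar>"
    if "p + v *\<^sub>R q \<in> ball c r" "p + w *\<^sub>R q \<in> ball c r" for p v w
    using F_increasing[of p v w] F_increasing[of p w v] that by (cases "v \<le> w") auto
  have d0: "\<bar>w0 - w1\<bar> \<le> \<eta>"
  proof -
    have "3/4 * \<bar>w0 - w1\<bar> \<le> \<bar>F (z + w0 *\<^sub>R q) - F (z + w1 *\<^sub>R q)\<bar>"
      by (intro incr b0 w0 w1)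
    also have "\<dots> = \<bar>F (z + h + w1 *\<^sub>R q) - F (z + w1 *\<^sub>R q)\<bar>" using w0 w1 by simp
    also have "\<dots> \<le> 2 * norm ((z + h + w1 *\<^sub>R q) - (z + w1 *\<^sub>R q))" by (intro F_lipschitz b0 b1 w1)
    also have "\<dots> = 2 / R" using h by simp
    finally show ?thesis using R0 by (simp add: \<eta>_def field_simps)
  qed
  have d2': "\<bar>w2 - w1\<bar> \<le> \<eta>"
  proof -
    have "3/4 * \<bar>w2 - w1\<bar> \<le> \<bar>F (z + h + h + w2 *\<^sub>R q) - F (z + h + h + w1 *\<^sub>R q)\<bar>"
      by (intro incr b2 w2 w1)
    also have "\<dots> = \<bar>F (z + h + w1 *\<^sub>R q) - F (z + h + h + w1 *\<^sub>R q)\<bar>" using w2 w1 by simp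
    also have "\<dots> \<le> 2 * norm ((z + h + w1 *\<^sub>R q) - (z + h + h + w1 *\<^sub>R q))"
        by (intro F_lipschitz b2 b1 w1)
    also have "\<dots> = 2 / R" using h by simp
    finally show ?thesis using R0 by (simp add: \<eta>_def field_simps)
  qed
  define P0 where "P0 = z + w0 *\<^sub>R q"
  define P1 where "P1 = z + h + w1 *\<^sub>R q"
  define P2 where "P2 = z + h + h + w2 *\<^sub>R q"
  have Pb: "P0 \<in> ball c r" "P1 \<in> ball c r" "P2 \<in> ball c r"
    unfolding P0_def P1_def P2_def by (intro b0 b1 b2 w0 w1 w2)+
  have diff: "P0 - P1 = (w0 - w1) *\<^sub>R q - h" "P2 - P1 = (w2 - w1) *\<^sub>R q + h"
    by (simp_all add: P0_def P1_def P2_def algebra_simps)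
  have q_diff: "norm ((v - w1) *\<^sub>R q) + 1 / R \<le> 4 * Kq / R" if "\<bar>v - w1\<bar> \<le> \<eta>" for v
  proof -
    have "\<bar>v - w1\<bar> * norm q \<le> 3 / R * Kq"
      using that q_le R0 by (intro mult_mono) (auto simp: \<eta>_def)
    then have "norm ((v - w1) *\<^sub>R q) \<le> 3 / R * Kq" by simp
    moreover have "1 / R \<le> Kq / R" using Kq R0 by (intro divide_right_mono) auto
    ultimately show ?thesis by (simp add: add_divide_distrib[symmetric])
  qed
  have n0: "norm (P0 - P1) \<le> 4 * Kq / R"
    using q_diff[OF d0] norm_triangle_ineq4[of "(w0 - w1) *\<^sub>R q" h] h unfolding diff by linarith
  have n2: "norm (P2 - P1) \<le> 4 * Kq / R"
    using q_diff[OF d2'] norm_triangle_ineq[of "(w2 - w1) *\<^sub>R q" h] h unfolding diff by linarith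
  define T where "T = C1 * (4 * Kq / R) powr (3/2)"
  have t0: "\<bar>(P0 - P1) \<bullet> m P1\<bar> \<le> T"
  proof -
    have "\<bar>(P0 - P1) \<bullet> m P1\<bar> \<le> C1 * norm (P0 - P1) powr (3/2)"
      using Pb w0 w1 by (intro hoelder) (auto simp: P0_def P1_def)
    also have "\<dots> \<le> T" unfolding T_def using n0 C1 by (intro mult_left_mono powr_mono2) auto
    finally show ?thesis .
  qed
  have t2: "\<bar>(P2 - P1) \<bullet> m P1\<bar> \<le> T"
  proof -
    have "\<bar>(P2 - P1) \<bullet> m P1\<bar> \<le> C1 * norm (P2 - P1) powr (3/2)"
      using Pb w2 w1 by (intro hoelder) (auto simp: P2_def P1_def)
    also have "\<dots> \<le> T" unfolding T_def using n2 C1 by (intro mult_left_mono powr_mono2) auto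
    finally show ?thesis .
  qed
  \<comment> \<open>The closeness of m to n was calibrated against the length of q for this
    bound.\<close>
  have qm: "q \<bullet> m P1 \<ge> 3/4"
  proof -
    have "\<bar>q \<bullet> (m P1 - n)\<bar> \<le> Kq * norm (m P1 - n)"
      by (rule order_trans[OF Cauchy_Schwarz_ineq2]) (intro mult_right_mono q_le norm_ge_zero)
    also have "\<dots> \<le> 1/4" using m_close2[OF Pb(2)] by (simp add: Kq_def mult_ac)
    finally have "\<bar>q \<bullet> m P1 - 1\<bar> \<le> 1/4" by (simp only: inner_diff_right q_n)
    then show ?thesis by (simp only: abs_le_iff) linarith
  qed
  have sec: "\<bar>w2 - 2 * w1 + w0\<bar> \<le> 8/3 * T"
  proof -
    have "(P2 - P1) \<bullet> m P1 + (P0 - P1) \<bullet> m P1 = (w2 - 2 * w1 + w0) * (q \<bullet> m P1)"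
      unfolding diff by (simp add: inner_add_left inner_diff_left algebra_simps)
    then have "\<bar>w2 - 2 * w1 + w0\<bar> * (q \<bullet> m P1) \<le> 2 * T"
      using t0 t2 qm abs_mult[of "w2 - 2 * w1 + w0" "q \<bullet> m P1"] by simp
    moreover have "\<bar>w2 - 2 * w1 + w0\<bar> * (3/4) \<le> \<bar>w2 - 2 * w1 + w0\<bar> * (q \<bullet> m P1)"
      using qm by (intro mult_left_mono) auto
    ultimately have "\<bar>w2 - 2 * w1 + w0\<bar> * (3/4) \<le> 2 * T" by (rule order_trans[rotated])
    then show ?thesis by simp
  qed
  define \<zeta> where "\<zeta> w = tent (w + ws) * \<phi> (z + w *\<^sub>R q)" for w
  define g where "g w = second_diff f h (z + w *\<^sub>R q)" for w
  have "xray q (\<lambda>x. \<phi> x * second_diff f h x) x = (LINT w|lborel. tent (w + ws) * (\<phi> (x + (w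
      + ws) *\<^sub>R q) * second_diff f h (x + (w + ws) *\<^sub>R q)))"
  proof -
    show ?thesis
      unfolding xray_def by (rule lborel_integral_shift[symmetric]) measurable
  qed
  also have "\<dots> = (LINT w|lborel. \<zeta> w * g w)"
    by (simp add: \<zeta>_def g_def z_def scaleR_add_left add_ac mult.assoc)
  finally have xr: "xray q (\<lambda>x. \<phi> x * second_diff f h x) x = (LINT w|lborel. \<zeta> w * g w)" .
  have "\<bar>LINT w|lborel. \<zeta> w * g w\<bar> \<le> \<bar>\<alpha> - \<beta>\<bar>
      * (4 * Kz * \<eta>\<^sup>2 + 8/3 * T)"
  proof (rule second_difference_step_integral[where \<rho>=\<rho> and wa=w0 and wb=w1 and wc=w2])
    show "\<bar>\<zeta> v - \<zeta> w\<bar> \<le> Kz * \<bar>v - w\<bar>" for v w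
    proof -
      have eq: "\<zeta> v - \<zeta> w = (tent (v + ws) - tent (w + ws)) * \<phi> (z + v *\<^sub>R q)
          + tent (w + ws) * (\<phi> (z + v *\<^sub>R q) - \<phi> (z + w *\<^sub>R q))"
        by (simp add: \<zeta>_def algebra_simps)
      have 1: "\<bar>(tent (v + ws) - tent (w + ws)) * \<phi> (z + v *\<^sub>R q)\<bar> \<le> \<bar>v - w\<bar> * 1"
        unfolding abs_mult using tent_lipschitz[of "v + ws" "w + ws"] \<phi>_bd by (intro mult_mono) auto
      have 2: "\<bar>tent (w + ws) * (\<phi> (z + v *\<^sub>R q) - \<phi> (z + w *\<^sub>R q))\<bar> \<le> 1
          * (Lip * (\<bar>v - w\<bar> * Kq))"
        unfolding abs_mult
      proof (intro mult_mono)
        have "\<bar>\<phi> (z + v *\<^sub>R q) - \<phi> (z + w *\<^sub>R q)\<bar> \<le> Lip * norm ((z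
            + v *\<^sub>R q) - (z + w *\<^sub>R q))" by (rule \<phi>_lip)
        also have "(z + v *\<^sub>R q) - (z + w *\<^sub>R q) = (v - w) *\<^sub>R q" by (simp add: algebra_simps)
        also have "Lip * norm ((v - w) *\<^sub>R q) \<le> Lip * (\<bar>v - w\<bar> * Kq)"
          using q_le Lip_nonneg by (auto intro!: mult_left_mono)
        finally show "\<bar>\<phi> (z + v *\<^sub>R q) - \<phi> (z + w *\<^sub>R q)\<bar> \<le> Lip
            * (\<bar>v - w\<bar> * Kq)" .
      qed (use tent_range in auto)
      have "\<bar>\<zeta> v - \<zeta> w\<bar> \<le> \<bar>v - w\<bar> * 1 + 1 * (Lip * (\<bar>v - w\<bar> * Kq))"
        unfolding eq by (intro order_trans[OF abs_triangle_ineq] add_mono 1 2)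
      then show ?thesis by (simp add: Kz_def algebra_simps)
    qed
    show "\<bar>\<zeta> w\<bar> \<le> 1" for w
      unfolding \<zeta>_def abs_mult using tent_range \<phi>_bd by (intro mult_le_one) auto
    show "\<zeta> w = 0" if "\<rho> < \<bar>w\<bar>" for w
    proof (rule ccontr)
      assume "\<zeta> w \<noteq> 0"
      then have "norm (z + w *\<^sub>R q - c) \<le> \<rho> / 8" using \<phi>_supp[of "z
          + w *\<^sub>R q"] r32 by (auto simp: \<zeta>_def)
      then have "norm (w *\<^sub>R q) \<le> \<rho> / 4"
        using norm_triangle_ineq4[of "z + w *\<^sub>R q - c" "z - c"] zc by (simp add: algebra_simps)
      moreover have "1 \<le> norm q" using Cauchy_Schwarz_ineq2[of q n] q_n n by simp
      then have "\<bar>w\<bar> * 1 \<le> \<bar>w\<bar> * norm q" by (intro mult_left_mono) auto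
      ultimately show False using that \<rho>_pos by simp
    qed
    show "g w = (\<alpha> - \<beta>) * (indicator {w2<..} w - 2 * indicator {w1<..} w + indicator {w0<..} w)"
      if "w \<noteq> w0" "w \<noteq> w1" "w \<noteq> w2" "\<bar>w\<bar> \<le> \<rho>" for w
    proof -
      have "g w = f (z + h + h + w *\<^sub>R q) - 2 * f (z + h + w *\<^sub>R q) + f (z + w *\<^sub>R q)"
        by (simp add: g_def second_diff_def add_ac)
      then show ?thesis using w0(3)[of w] w1(3)[of w] w2(3)[of w] that by (simp add: algebra_simps)
    qed
    show "g \<in> borel_measurable borel" unfolding g_def by measurable
  qed (use w0 w1 w2 d0 d2' sec in auto)
  also have "\<dots> \<le> 2 * (4 * Kz * \<eta>\<^sup>2 + 8/3 * T)"
  proof (rule mult_right_mono)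
    show "\<bar>\<alpha> - \<beta>\<bar> \<le> 2" using \<alpha>\<beta> by linarith
    show "0 \<le> 4 * Kz * \<eta>\<^sup>2 + 8/3 * T" using Lip_nonneg Kq C1 by (simp add: Kz_def T_def)
  qed
  \<comment> \<open>For R \<ge> 1 the Lipschitz error of order R^(-2) is dominated by
    R^(-3/2).\<close>
  also have "\<dots> \<le> Cx * R powr (- (3/2))"
  proof -
    have "1 / R\<^sup>2 = R powr (- 2)" using R0 by (simp add: powr_minus powr_numeral inverse_eq_divide)
    also have "\<dots> \<le> R powr (- (3/2))" using R by (intro powr_mono) auto
    finally have "36 * Kz * (1 / R\<^sup>2) \<le> 36 * Kz * R powr (- (3/2))"
      using Lip_nonneg Kq by (intro mult_left_mono) (auto simp: Kz_def)
    moreover have "4 * Kz * \<eta>\<^sup>2 = 36 * Kz * (1 / R\<^sup>2)" by (simp add: \<eta>_def power2_eq_square)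
    moreover have "T = C1 * (4 * Kq) powr (3/2) * R powr (- (3/2))"
    proof -
      have "(4 * Kq / R) powr (3/2) = (4 * Kq) powr (3/2) / R powr (3/2)"
        by (rule powr_divide)
      also have "\<dots> = (4 * Kq) powr (3/2) * R powr (- (3/2))"
        unfolding powr_minus divide_inverse ..
      finally show ?thesis by (simp only: T_def mult.assoc)
    qed
    moreover have "Cx * R powr (- (3/2)) = 2 * (36 * Kz * R powr (- (3/2)) + 8/3 * (C1
        * (4 * Kq) powr (3/2) * R powr (- (3/2))))"
      unfolding Cx_def by (simp only: distrib_left distrib_right mult.assoc)
    ultimately show ?thesis by argo
  qed
  finally show ?thesis unfolding xr .
qed

end

section \<open>Summation over the directions\<close>

lemma second_diff_bd: "\<bar>second_diff f h x\<bar> \<le> 2"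
  using f_bd[of x] f_bd[of "x + h"] f_bd[of "x + h + h"] unfolding second_diff_def by linarith

definition "L' = L + Kq"
text \<open>16 is the square of the loss 4 caused by the tent, \<open>DIM('a)\<close> counts the
  choices of b, and (2 sqrt d + 7) R bounds the number of choices of j; the rest is the bound of
  \<open>xray_L2\<close>.\<close>

definition "far_const = 16 * real DIM('a) * (2 * sqrt (real DIM('a))
    + 7) * trace_const TYPE('a) L' * Cx\<^sup>2 * measure lborel (cball (0::'a) L')"

lemma norm_tang_le: "norm (tang b) \<le> norm b"
proof -
  have "(norm (tang b))\<^sup>2 = (norm b)\<^sup>2 - (b \<bullet> n)\<^sup>2"
    using n unfolding power2_norm_eq_inner tang_def
    by (simp add: inner_diff_left inner_diff_right norm_eq_1 inner_commute power2_eq_square)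
  then have "(norm (tang b))\<^sup>2 \<le> (norm b)\<^sup>2" by simp
  then show ?thesis by (rule power2_le_imp_le) simp
qed

lemma tang_n: "tang b \<bullet> n = 0"
  using n by (simp add: tang_def inner_diff_left norm_eq_1)

text \<open>Squaring the pointwise bound gives R^(-3) on a ball of fixed radius L', which is L
  enlarged by the length of q; the trace inequality supplies R/R^d.\<close>

lemma xray_L2:
  assumes R: "R \<ge> 1" "R \<ge> 16 / \<rho>" and h: "norm h = 1 / R" and q: "q \<bullet> n = 1" "norm q \<le> Kq"
  shows "sphere_energy R (\<lambda>x. of_real (xray q (\<lambda>x. \<phi> x * second_diff f h x) x))
    \<le> ennreal (trace_const TYPE('a) L' * (R / R ^ DIM('a)) * (Cx\<^sup>2
        * (1 / R ^ 3) * measure lborel (cball (0::'a) L')))"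
proof -
  define H where "H = xray q (\<lambda>x. \<phi> x * second_diff f h x)"
  have R0: "R > 0" using R by simp
  have [measurable]: "H \<in> borel_measurable borel" unfolding H_def by measurable
  have H_bd: "\<bar>H x\<bar> \<le> Cx * R powr (- (3/2))" for x unfolding H_def by (rule xray_bound[OF q R h])
  have H_supp: "H x = 0" if "norm x > L'" for x
    unfolding H_def
  proof (rule xray_supp[of L])
    show "\<phi> x * second_diff f h x = 0" if "norm x > L" for x
    proof -
      have "\<phi> x = 0"
      proof (rule ccontr)
        assume "\<phi> x \<noteq> 0"
        then have "norm (x - c) \<le> \<rho> / 8" using \<phi>_supp r32 by simp
        then show False using not_ball[OF that] \<rho>_le \<rho>_pos r by (simp add: dist_norm norm_minus_commute)
      qed
      then show ?thesis by simp
    qed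
    show "norm x > L + norm q" using that q unfolding L'_def by simp
  qed
  have H_int: "integrable lborel (\<lambda>x. complex_of_real (H x))"
    by (rule integrable_bounded_support[of _ "Cx * R powr (- (3/2))" L']) (use H_bd H_supp in auto)
  have sq: "(Cx * R powr (- (3/2)))\<^sup>2 = Cx\<^sup>2 * (1 / R ^ 3)"
  proof -
    have "(R powr (- (3/2)))\<^sup>2 = R powr (- (3/2) + - (3/2))"
      unfolding power2_eq_square by (rule powr_add[symmetric])
    also have "\<dots> = R powr (- real 3)" by simp
    also have "\<dots> = 1 / R ^ 3" using R0 by (simp only: powr_minus powr_realpow inverse_eq_divide)
    finally show ?thesis by (simp add: power_mult_distrib)
  qed
  have "energy (\<lambda>x. complex_of_real (H x)) \<le> (\<integral>\<^sup>+x. ennreal (Cx\<^sup>2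
      * (1 / R ^ 3)) * indicator (cball (0::'a) L') x \<partial>lborel)"
  proof (rule nn_integral_mono)
    fix x
    show "ennreal ((cmod (complex_of_real (H x)))\<^sup>2) \<le> ennreal (Cx\<^sup>2
        * (1 / R ^ 3)) * indicator (cball (0::'a) L') x"
    proof (cases "norm x > L'")
      case False
      have "(cmod (complex_of_real (H x)))\<^sup>2 \<le> (Cx * R powr (- (3/2)))\<^sup>2"
        using H_bd[of x] by (intro power_mono) auto
      then show ?thesis using False unfolding sq by (auto intro!: ennreal_leI)
    qed (simp add: H_supp)
  qed
  also have "\<dots> = ennreal (Cx\<^sup>2 * (1 / R ^ 3)) * emeasure lborel (cball (0::'a) L')"
    by (rule nn_integral_cmult_indicator) simp
  also have "emeasure lborel (cball (0::'a) L') = ennreal (measure lborel (cball (0::'a) L'))"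
    using emeasure_lborel_cball_finite[of "0::'a" L'] by (intro emeasure_eq_ennreal_measure) auto
  also have "ennreal (Cx\<^sup>2 * (1 / R ^ 3)) * \<dots> = ennreal (Cx\<^sup>2
      * (1 / R ^ 3) * measure lborel (cball (0::'a) L'))"
    using R0 by (intro ennreal_mult[symmetric]) auto
  finally have H2: "energy (\<lambda>x. complex_of_real (H x)) \<le> ennreal (Cx\<^sup>2
      * (1 / R ^ 3) * measure lborel (cball (0::'a) L'))" .
  have "sphere_energy R (\<lambda>x. complex_of_real (H x))
    \<le> ennreal (trace_const TYPE('a) L' * (R / R ^ DIM('a))) * energy (\<lambda>x. complex_of_real (H x))"
    by (rule sphere_trace_L2[OF H_int _ R(1)]) (simp add: H_supp)
  also have "\<dots> \<le> ennreal (trace_const TYPE('a) L' * (R / R ^ DIM('a))) * ennreal (Cx\<^sup>2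
      * (1 / R ^ 3) * measure lborel (cball (0::'a) L'))"
    by (intro mult_left_mono H2) simp
  also have "\<dots> = ennreal (trace_const TYPE('a) L' * (R / R ^ DIM('a)) * (Cx\<^sup>2
      * (1 / R ^ 3) * measure lborel (cball (0::'a) L')))"
    using R0 by (intro ennreal_mult[symmetric]) (auto simp: trace_const_nonneg)
  finally show ?thesis by (simp add: H_def)
qed

text \<open>The squares of \<omega> \<bullet> tang b sum to at least 3/4, so one of them is at least
  3/(4 d). Subtracting from n a multiple s of this \<open>tang b\<close>, with |s| \<le> sqrt d,
  gives a vector orthogonal to \<omega>. Rounding s R down to an integer j changes the inner product
  with R \<omega> by at most 1 and leaves only O(R) candidates.\<close>

lemma far_direction:
  assumes \<omega>: "norm \<omega> = 1" "\<bar>\<omega> \<bullet> n\<bar> < 1/2" and R: "R > 0"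
  obtains b and j :: int where "b \<in> Basis" "\<bar>of_int j\<bar> \<le> sqrt (real DIM('a)) * R + 1"
    "\<bar>(n - (of_int j / R) *\<^sub>R tang b) \<bullet> (R *\<^sub>R \<omega>)\<bar> \<le> 1"
proof -
  define d where "d = real DIM('a)"
  have d: "d \<ge> 1" by (simp add: d_def Suc_leI)
  have "(\<Sum>b\<in>Basis. (\<omega> \<bullet> tang b)\<^sup>2) = (norm (\<omega>
      - (\<omega> \<bullet> n) *\<^sub>R n))\<^sup>2"
    unfolding inner_tang by (rule norm_power2_Basis[symmetric])
  also have "\<dots> = 1 - (\<omega> \<bullet> n)\<^sup>2"
    using \<omega> n unfolding power2_norm_eq_inner
    by (simp add: inner_diff_left inner_diff_right norm_eq_1 inner_commute power2_eq_square)
  finally have S: "(\<Sum>b\<in>Basis. (\<omega> \<bullet> tang b)\<^sup>2) = 1 - (\<omega> \<bullet> n)\<^sup>2" .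
  have "\<bar>\<omega> \<bullet> n\<bar>\<^sup>2 \<le> (1/2)\<^sup>2" using \<omega> by (intro power_mono) auto
  then have sq: "(\<omega> \<bullet> n)\<^sup>2 \<le> 1/4" by (simp add: power2_eq_square)
  have "\<exists>b\<in>Basis. 3 / (4 * d) \<le> (\<omega> \<bullet> tang b)\<^sup>2"
  proof (rule ccontr)
    assume "\<not> ?thesis"
    then have "(\<Sum>b\<in>Basis. (\<omega> \<bullet> tang b)\<^sup>2) < (\<Sum>b\<in>(Basis :: 'a set). 3 / (4 * d))"
      by (intro sum_strict_mono) (auto simp: not_le)
    also have "\<dots> = 3/4" using d by (simp add: d_def)
    finally show False using S sq by linarith
  qed
  then obtain b where b: "b \<in> Basis" "3 / (4 * d) \<le> (\<omega> \<bullet> tang b)\<^sup>2" by blast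
  define t where "t = \<omega> \<bullet> tang b"
  have t2: "3 / (4 * d) \<le> t\<^sup>2" using b by (simp add: t_def)
  have t0: "t \<noteq> 0" using t2 d by (auto simp: field_simps)
  have t1: "\<bar>t\<bar> \<le> 1"
    using Cauchy_Schwarz_ineq2[of \<omega> "tang b"] norm_tang_le[of b] \<omega> b by (simp add: t_def norm_Basis)
  define s where "s = (\<omega> \<bullet> n) / t"
  have "s\<^sup>2 \<le> d"
  proof -
    have "s\<^sup>2 = (\<omega> \<bullet> n)\<^sup>2 / t\<^sup>2" by (simp add: s_def power_divide)
    also have "\<dots> \<le> (1/4) / (3 / (4 * d))"
      using sq t2 d by (intro frac_le) auto
    also have "\<dots> \<le> d" using d by simp
    finally show ?thesis .
  qed
  then have s: "\<bar>s\<bar> \<le> sqrt d" by (simp add: real_le_rsqrt)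
  define j where "j = \<lfloor>s * R\<rfloor>"
  have jj: "of_int j \<le> s * R" "s * R < of_int j + 1" unfolding j_def by linarith+
  show ?thesis
  proof (rule that[OF b(1)])
    have "\<bar>s * R\<bar> \<le> sqrt d * R" unfolding abs_mult using s R d by (intro mult_mono) auto
    then show "\<bar>of_int j\<bar> \<le> sqrt (real DIM('a)) * R + 1" using jj unfolding d_def abs_le_iff by linarith
    have "(n - (of_int j / R) *\<^sub>R tang b) \<bullet> (R *\<^sub>R \<omega>) = R * (\<omega> \<bullet> n)
        - of_int j * t"
      using R by (simp add: inner_diff_left inner_commute t_def algebra_simps)
    also have "\<dots> = t * (s * R - of_int j)" using t0 by (simp add: s_def algebra_simps)
    finally have e: "(n - (of_int j / R) *\<^sub>R tang b) \<bullet> (R *\<^sub>R \<omega>) = t * (s * R - of_int j)" .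
    have "\<bar>s * R - of_int j\<bar> \<le> 1" using jj by linarith
    then show "\<bar>(n - (of_int j / R) *\<^sub>R tang b) \<bullet> (R *\<^sub>R \<omega>)\<bar> \<le> 1"
      unfolding e abs_mult using t1 by (intro mult_le_one) auto
  qed
qed

text \<open>Each frequency is served by one pair (b, j), and the integrand is bounded by the sum
  over all pairs. The number of pairs is O(R), which turns R^(1-d) R^(-3) into R^(-(d+1)).\<close>

lemma far_estimate:
  assumes R: "R \<ge> 1" "R \<ge> 16 / \<rho>" and h: "norm h = 1 / R"
  shows "(\<integral>\<^sup>+\<omega>. indicator {\<omega>. \<bar>\<omega> \<bullet> n\<bar> < 1/2} \<omega> * ennreal ((cmod (ft (\<lambda>x. of_real (\<phi> x * second_diff f h x)) (R *\<^sub>R \<omega>)))\<^sup>2) \<partial>sphere_measure)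
    \<le> ennreal (far_const * (1 / (R * R ^ DIM('a))))"
proof -
  have R0: "R > 0" using R by simp
  define G where "G x = \<phi> x * second_diff f h x" for x
  have [measurable]: "G \<in> borel_measurable borel" unfolding G_def by measurable
  have G_bd: "\<bar>G x\<bar> \<le> 2" for x
    unfolding G_def abs_mult using mult_mono[OF \<phi>_bd[of x] second_diff_bd[of h x]] by simp
  have G_supp: "G x = 0" if "norm x > L" for x
  proof (rule ccontr)
    assume "G x \<noteq> 0"
    then have "norm (x - c) \<le> \<rho> / 8" using \<phi>_supp r32 by (auto simp: G_def)
    then show False using not_ball[OF that] \<rho>_le \<rho>_pos r by (simp add: dist_norm norm_minus_commute)
  qed
  define J where "J = {- \<lceil>sqrt (real DIM('a)) * R\<rceil> - 1 .. \<lceil>sqrt (real DIM('a)) * R\<rceil> + 1}"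
  define q where "q b j = n - (of_int j / R) *\<^sub>R tang b" for b and j :: int
  have q: "q b j \<bullet> n = 1" "norm (q b j) \<le> Kq" if "b \<in> Basis" "j \<in> J" for b j
  proof -
    show "q b j \<bullet> n = 1" using n by (simp add: q_def inner_diff_left tang_n norm_eq_1)
    have "\<bar>of_int j\<bar> \<le> sqrt (real DIM('a)) * R + 2" using that(2) unfolding J_def
        by (simp add: abs_le_iff) linarith
    also have "\<dots> \<le> (sqrt (real DIM('a)) + 2) * R" using R by (simp add: algebra_simps)
    finally have "\<bar>of_int j / R\<bar> \<le> sqrt (real DIM('a)) + 2" using R0
        by (simp add: abs_divide divide_le_eq)
    then have "\<bar>of_int j / R\<bar> * norm (tang b) \<le> (sqrt (real DIM('a)) + 2) * 1"
      using norm_tang_le[of b] that(1) by (intro mult_mono) (auto simp: norm_Basis)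
    then show "norm (q b j) \<le> Kq"
      unfolding q_def Kq_def dim_const_def using n
      by (intro order_trans[OF norm_triangle_ineq4]) simp
  qed
  define P where "P = trace_const TYPE('a) L' * (R / R ^ DIM('a)) * (Cx\<^sup>2
      * (1 / R ^ 3) * measure lborel (cball (0::'a) L'))"
  have P0: "P \<ge> 0"
    unfolding P_def using R0 trace_const_nonneg by (intro mult_nonneg_nonneg) auto
  define X where "X b j \<omega>
      = ennreal ((cmod (ft (\<lambda>x. of_real (xray (q b j) G x)) (R *\<^sub>R \<omega>)))\<^sup>2)" for b j \<omega>
  have X_meas [measurable]: "X b j \<in> borel_measurable borel" for b j
  proof -
    have [measurable]: "ft (\<lambda>x. complex_of_real (xray (q b j) G x)) \<in> borel_measurable borel"
      by (rule measurable_ft) measurable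
    show ?thesis unfolding X_def by measurable
  qed
  have "(\<integral>\<^sup>+\<omega>. indicator {\<omega>. \<bar>\<omega> \<bullet> n\<bar> < 1/2} \<omega> * ennreal ((cmod (ft (\<lambda>x. of_real (G x)) (R *\<^sub>R \<omega>)))\<^sup>2) \<partial>sphere_measure)
    \<le> (\<integral>\<^sup>+\<omega>. (\<Sum>b\<in>Basis. \<Sum>j\<in>J. 16 * X b j \<omega>) \<partial>sphere_measure)"
  proof (rule nn_integral_mono)
    fix \<omega> :: 'a assume "\<omega> \<in> space sphere_measure"
    then have \<omega>: "norm \<omega> = 1" by simp
    show "indicator {\<omega>. \<bar>\<omega> \<bullet> n\<bar> < 1/2} \<omega> * ennreal ((cmod (ft (\<lambda>x. of_real (G x)) (R *\<^sub>R \<omega>)))\<^sup>2)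
      \<le> (\<Sum>b\<in>Basis. \<Sum>j\<in>J. 16 * X b j \<omega>)"
    proof (cases "\<bar>\<omega> \<bullet> n\<bar> < 1/2")
      case True
      obtain b j where b: "b \<in> Basis" and j: "\<bar>of_int j\<bar> \<le> sqrt (real DIM('a)) * R + 1"
        and slab: "\<bar>(n - (of_int j / R) *\<^sub>R tang b) \<bullet> (R *\<^sub>R \<omega>)\<bar> \<le> 1"
        using far_direction[OF \<omega> True R0] by blast
      have jJ: "j \<in> J" using j unfolding J_def by (simp add: abs_le_iff) linarith
      let ?t = "LINT w|lborel. of_real (tent w) * cis (w * (q b j \<bullet> (R *\<^sub>R \<omega>)))"
      have "1/4 \<le> cmod ?t" using slab by (intro tent_fourier_lower) (simp add: q_def)
      moreover have "ft (\<lambda>x. of_real (xray (q b j) G x)) (R *\<^sub>R \<omega>)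
          = ?t * ft (\<lambda>x. of_real (G x)) (R *\<^sub>R \<omega>)"
        by (rule ft_xray[OF _ G_bd G_supp]) auto
      ultimately have "1/4 * cmod (ft (\<lambda>x. of_real (G x)) (R *\<^sub>R \<omega>))
          \<le> cmod (ft (\<lambda>x. of_real (xray (q b j) G x)) (R *\<^sub>R \<omega>))"
        unfolding norm_mult by (simp only: norm_mult mult_right_mono norm_ge_zero)
      then have "cmod (ft (\<lambda>x. of_real (G x)) (R *\<^sub>R \<omega>))
          \<le> 4 * cmod (ft (\<lambda>x. of_real (xray (q b j) G x)) (R *\<^sub>R \<omega>))" by simp
      then have "(cmod (ft (\<lambda>x. of_real (G x)) (R *\<^sub>R \<omega>)))\<^sup>2
          \<le> (4 * cmod (ft (\<lambda>x. of_real (xray (q b j) G x)) (R *\<^sub>R \<omega>)))\<^sup>2"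
        by (rule power_mono) simp
      then have "ennreal ((cmod (ft (\<lambda>x. of_real (G x)) (R *\<^sub>R \<omega>)))\<^sup>2)
          \<le> ennreal (16 * (cmod (ft (\<lambda>x. of_real (xray (q b j) G x)) (R *\<^sub>R \<omega>)))\<^sup>2)"
        by (intro ennreal_leI) (simp add: power_mult_distrib)
      also have "\<dots> = 16 * X b j \<omega>" by (simp add: X_def ennreal_mult)
      also have "\<dots> \<le> (\<Sum>j\<in>J. 16 * X b j \<omega>)"
        by (rule member_le_sum[OF jJ]) (auto simp: J_def)
      also have "\<dots> \<le> (\<Sum>b\<in>Basis. \<Sum>j\<in>J. 16 * X b j \<omega>)"
        by (rule member_le_sum[OF b, of "\<lambda>b. \<Sum>j\<in>J. 16 * X b j \<omega>"]) auto
      finally show ?thesis using True by simp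
    qed simp
  qed
  also have "\<dots> = (\<Sum>b\<in>Basis. \<Sum>j\<in>J. 16
      * (\<integral>\<^sup>+\<omega>. X b j \<omega> \<partial>sphere_measure))"
  proof -
    have [measurable]: "X b j \<in> borel_measurable sphere_measure" for b j
        by (rule measurable_sphere_measure) measurable
    show ?thesis by (simp add: nn_integral_sum nn_integral_cmult)
  qed
  also have "\<dots> \<le> (\<Sum>b\<in>(Basis :: 'a set). \<Sum>j\<in>J. 16 * ennreal P)"
    unfolding X_def G_def P_def by (intro sum_mono mult_left_mono xray_L2 R h q) auto
  also have "\<dots> = ennreal (real DIM('a) * real (card J) * (16 * P))"
    using P0 by (simp add: ennreal_mult ennreal_of_nat_eq_real_of_nat mult.assoc)
  also have "\<dots> \<le> ennreal (real DIM('a) * ((2 * sqrt (real DIM('a)) + 7) * R) * (16 * P))"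
  proof (intro ennreal_leI mult_right_mono mult_left_mono)
    have "0 \<le> sqrt (real DIM('a)) * R" using R0 by simp
    then have c0: "0 \<le> \<lceil>sqrt (real DIM('a)) * R\<rceil>" by linarith
    have "real (card J) = 2 * of_int \<lceil>sqrt (real DIM('a)) * R\<rceil> + 3" using c0 by (simp add: J_def)
    also have "\<dots> \<le> 2 * (sqrt (real DIM('a)) * R + 1) + 3"
      using of_int_ceiling_le_add_one[of "sqrt (real DIM('a)) * R"] by (intro add_mono mult_left_mono) auto
    also have "\<dots> \<le> (2 * sqrt (real DIM('a)) + 7) * R" using R by (simp add: algebra_simps)
    finally show "real (card J) \<le> (2 * sqrt (real DIM('a)) + 7) * R" .
    show "0 \<le> 16 * P" using P0 by simp
  qed simp
  also have "real DIM('a) * ((2 * sqrt (real DIM('a)) + 7) * R) * (16 * P)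
    = far_const * (1 / (R * R ^ DIM('a)))"
    using R0 unfolding far_const_def P_def by (simp add: power3_eq_cube field_simps)
  finally show ?thesis by (simp add: G_def)
qed

text \<open>F changes by at most 17/16 times 2/R, which is less than 3/R, between x and its shifts;
  here 17/16 = 1 + 1/16 because 4 Kq \<ge> 16. If |F x| > 3/R, all three points lie on one side of
  the boundary and the second difference vanishes.\<close>

lemma layer_support:
  assumes R: "R \<ge> 1" "R \<ge> 16 / \<rho>" and h: "norm h = 1 / R" and x: "\<phi> x * second_diff f h x \<noteq> 0"
  shows "norm (x - c) \<le> r / 4" and "\<bar>R * F x\<bar> \<le> 3"
proof -
  have R0: "R > 0" using R by simp
  have xc: "norm (x - c) \<le> \<rho> / 8" using \<phi>_supp[of x] r32 x by auto
  then show "norm (x - c) \<le> r / 4" using \<rho>_le \<rho>_pos r by simp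
  have hR: "1 / R \<le> \<rho> / 16" using R \<rho>_pos by (simp add: field_simps)
  have xb: "x \<in> ball c r" using xc \<rho>_le \<rho>_pos r by (simp add: dist_norm norm_minus_commute)
  have move: "x + v \<in> ball c r \<and> \<bar>F (x + v) - F x\<bar> \<le> 17/8 * (1 / R)" if v: "norm v
      \<le> 2 / R" for v
  proof
    show b: "x + v \<in> ball c r"
      using norm_triangle_ineq[of "x - c" v] xc v hR \<rho>_le \<rho>_pos r
      by (simp add: dist_norm norm_minus_commute algebra_simps)
    have "\<bar>F (x + v) - F x - v \<bullet> n\<bar> * 16 \<le> \<bar>F (x + v) - F x - v \<bullet> n\<bar> * (4 * Kq)"
      using Kq by (intro mult_left_mono) auto
    also have "\<dots> \<le> norm v" using F_linear_approx[OF xb b] by simp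
    finally have "\<bar>F (x + v) - F x - v \<bullet> n\<bar> \<le> norm v / 16" by simp
    moreover have "\<bar>v \<bullet> n\<bar> \<le> norm v" using Cauchy_Schwarz_ineq2[of v n] n by simp
    ultimately have "\<bar>F (x + v) - F x\<bar> \<le> 17/16 * norm v" unfolding abs_le_iff by auto
    then show "\<bar>F (x + v) - F x\<bar> \<le> 17/8 * (1 / R)" using v by simp
  qed
  have h1: "norm h \<le> 2 / R" using h R0 by (simp add: divide_right_mono)
  have h2: "norm (h + h) \<le> 2 / R" using norm_triangle_ineq[of h h] h by simp
  show "\<bar>R * F x\<bar> \<le> 3"
  proof (rule ccontr)
    assume "\<not> \<bar>R * F x\<bar> \<le> 3"
    then have "3 / R < \<bar>F x\<bar>" using R0 by (simp add: abs_mult field_simps)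
    moreover have "17/8 * (1 / R) < 3 / R" using R0 by (simp add: field_simps)
    ultimately have big: "17/8 * (1 / R) < \<bar>F x\<bar>" by linarith
    note m1 = move[OF h1] and m2 = move[OF h2]
    have "second_diff f h x = 0"
    proof (cases "F x > 0")
      case True
      have "F (x + h) > 0" "F (x + (h + h)) > 0" using m1 m2 big True by (auto simp: abs_le_iff)
      then show ?thesis using True m1 m2 xb f_pos[of x] f_pos[of "x + h"] f_pos[of "x + (h + h)"]
        by (simp add: second_diff_def add.assoc del: mem_ball)
    next
      case False
      have "F (x + h) < 0" "F (x + (h + h)) < 0" "F x < 0" using m1 m2 big False
          by (auto simp: abs_le_iff abs_real_def split: if_splits)
      then show ?thesis using m1 m2 xb f_neg[of x] f_neg[of "x + h"] f_neg[of "x + (h + h)"]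
        by (simp add: second_diff_def add.assoc del: mem_ball)
    qed
    then show False using x by simp
  qed
qed

definition "piece_const = 38400 * (K1 + 1) * Y * vol + far_const"

lemma piece_const_nonneg: "piece_const \<ge> 0"
  unfolding piece_const_def far_const_def using K1_nonneg Y_pos trace_const_nonneg
  by (intro add_nonneg_nonneg mult_nonneg_nonneg) (auto simp: vol_def)

lemma piece_estimate:
  assumes R: "R \<ge> 1" "R \<ge> 16 / \<rho>" and h: "norm h = 1 / R"
  shows "sphere_energy R (\<lambda>x. of_real (\<phi> x * second_diff f h x))
    \<le> ennreal (piece_const * (1 / (R * R ^ DIM('a))))"
proof -
  let ?G = "\<lambda>x. complex_of_real (\<phi> x * second_diff f h x)"
  let ?E = "\<lambda>\<omega>. ennreal ((cmod (ft ?G (R *\<^sub>R \<omega>)))\<^sup>2)"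
  have [measurable]: "ft ?G \<in> borel_measurable borel" by (rule measurable_ft) measurable
  have sum: "?E \<omega> = indicator {\<omega>. 1/2
      \<le> \<bar>\<omega> \<bullet> n\<bar>} \<omega> * ?E \<omega>
      + indicator {\<omega>. \<bar>\<omega> \<bullet> n\<bar> < 1/2} \<omega> * ?E \<omega>" for \<omega>
    by (cases "\<bar>\<omega> \<bullet> n\<bar> < 1/2") (auto simp: not_less)
  have "(\<integral>\<^sup>+\<omega>. ?E \<omega> \<partial>sphere_measure)
      = (\<integral>\<^sup>+\<omega>. indicator {\<omega>. 1/2
      \<le> \<bar>\<omega> \<bullet> n\<bar>} \<omega> * ?E \<omega> \<partial>sphere_measure)
      + (\<integral>\<^sup>+\<omega>. indicator {\<omega>. \<bar>\<omega> \<bullet> n\<bar> < 1/2} \<omega> * ?E \<omega> \<partial>sphere_measure)"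
    by (subst sum, subst nn_integral_add) (auto intro!: measurable_sphere_measure)
  also have "\<dots> \<le> ennreal (38400 * (K1 + 1) * Y * vol * (1 / (R * R ^ DIM('a))))
      + ennreal (far_const * (1 / (R * R ^ DIM('a))))"
  proof (rule add_mono[OF near_estimate[OF R(1)] far_estimate[OF R h]])
    show "?G \<in> borel_measurable borel" by measurable
    show "cmod (?G x) \<le> 2" for x
      unfolding norm_of_real abs_mult using mult_mono[OF \<phi>_bd[of x] second_diff_bd[of h x]] by simp
    show "norm (x - c) \<le> r/4 \<and> \<bar>R * F x\<bar> \<le> 3" if "?G x \<noteq> 0" for x
      using layer_support[OF R h, of x] that by simp
  qed
  also have "\<dots> = ennreal (piece_const * (1 / (R * R ^ DIM('a))))"
    using R K1_nonneg Y_pos trace_const_nonneg[where 'a='a] unfolding piece_const_def distrib_right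
    by (intro ennreal_plus[symmetric] mult_nonneg_nonneg) (auto simp: vol_def far_const_def intro!: mult_nonneg_nonneg)
  finally show ?thesis .
qed

end

section \<open>Local structure of the boundary\<close>

lemma segment_avoiding_frontier:
  fixes u v :: "'a::euclidean_space"
  assumes "closed_segment u v \<inter> frontier B = {}"
  shows "u \<in> B \<longleftrightarrow> v \<in> B"
proof (rule ccontr)
  assume "\<not> ?thesis"
  then have "closed_segment u v \<inter> B \<noteq> {}" "closed_segment u v - B \<noteq> {}"
    using ends_in_segment[of u v] by blast+
  then have "closed_segment u v \<inter> frontier B \<noteq> {}"
    by (rule connected_Int_frontier[OF connected_segment])
  then show False using assms by simp
qed

text \<open>The part of the small ball where F > 0 need not be convex, so the two points are joined
  by a detour: up by r/2 along n, where F increases, then across at a height where F exceeds r/4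
  minus a small error, and down again. None of the three segments meets the frontier.\<close>

lemma positive_side_constant:
  fixes F :: "'a::euclidean_space \<Rightarrow> real"
  assumes n: "norm n = 1" and r: "r > 0"
    and approx: "\<And>x y. x \<in> ball c r \<Longrightarrow> y \<in> ball c r \<Longrightarrow> \<bar>F y
        - F x - (y - x) \<bullet> n\<bar> \<le> 1/20 * norm (y - x)"
    and F_c: "F c = 0" and front: "\<And>x. x \<in> ball c r
        \<Longrightarrow> x \<in> frontier B \<Longrightarrow> F x = 0"
    and x: "x \<in> ball c (r/4)" "F x > 0" and y: "y \<in> ball c (r/4)" "F y > 0"
  shows "x \<in> B \<longleftrightarrow> y \<in> B"
proof -
  have up: "z \<in> B \<longleftrightarrow> z + (r/2) *\<^sub>R n \<in> B" if z: "z \<in> ball c (r/4)" "F z > 0" for z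
  proof (rule segment_avoiding_frontier)
    have "p \<notin> frontier B" if "p \<in> closed_segment z (z + (r/2) *\<^sub>R n)" for p
    proof -
      from that obtain s where s: "0 \<le> s" "s \<le> 1" "p = z + (s * (r/2)) *\<^sub>R n"
        by (auto simp: closed_segment_def algebra_simps)
      have sr: "0 \<le> s * (r/2)" "s * (r/2) \<le> r/2" using s r by (auto simp: mult_left_le_one_le)
      have "norm (p - c) \<le> norm (z - c) + s * (r/2)"
        using norm_triangle_ineq[of "z - c" "(s * (r/2)) *\<^sub>R n"] n sr by (simp add: s(3) algebra_simps)
      moreover have "norm (z - c) < r/4" using z by (simp add: dist_norm norm_minus_commute)
      ultimately have "norm (p - c) < r" using sr r by linarith
      then have pb: "p \<in> ball c r" by (simp add: dist_norm norm_minus_commute)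
      have zb: "z \<in> ball c r" using z r by simp
      have "\<bar>F p - F z - s * (r/2)\<bar> \<le> 1/20 * (s * (r/2))"
        using approx[OF zb pb] n sr by (simp add: s(3) norm_eq_1)
      then have "F p > 0" using z(2) sr unfolding abs_le_iff by linarith
      then show ?thesis using front[OF pb] by auto
    qed
    then show "closed_segment z (z + (r/2) *\<^sub>R n) \<inter> frontier B = {}" by blast
  qed
  have "x + (r/2) *\<^sub>R n \<in> B \<longleftrightarrow> y + (r/2) *\<^sub>R n \<in> B"
  proof (rule segment_avoiding_frontier)
    have "p \<notin> frontier B" if "p \<in> closed_segment (x + (r/2) *\<^sub>R n) (y + (r/2) *\<^sub>R n)" for p
    proof -
      have "p - (r/2) *\<^sub>R n \<in> closed_segment x y"
        using that closed_segment_translation_eq[of "(r/2) *\<^sub>R n" "p - (r/2) *\<^sub>R n" x y]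
            by (simp add: add.commute)
      then have pz: "p - (r/2) *\<^sub>R n \<in> ball c (r/4)"
        using closed_segment_subset[OF x(1) y(1) convex_ball] by blast
      define z where "z = p - (r/2) *\<^sub>R n"
      have z: "norm (z - c) < r/4" using pz by (simp add: z_def dist_norm norm_minus_commute)
      have p: "p = z + (r/2) *\<^sub>R n" by (simp add: z_def)
      have pc: "norm (p - c) \<le> norm (z - c) + r/2"
        using norm_triangle_ineq[of "z - c" "(r/2) *\<^sub>R n"] n r by (simp add: p algebra_simps)
      then have "norm (p - c) < r" using z r by linarith
      then have pb: "p \<in> ball c r" by (simp add: dist_norm norm_minus_commute)
      have cb: "c \<in> ball c r" using r by simp
      have "\<bar>F p - (p - c) \<bullet> n\<bar> \<le> 1/20 * norm (p - c)" using approx[OF cb pb] F_c by simp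
      moreover have "(p - c) \<bullet> n = (z - c) \<bullet> n + r/2"
        using n by (simp add: p inner_add_left inner_diff_left norm_eq_1)
      moreover have "\<bar>(z - c) \<bullet> n\<bar> \<le> norm (z - c)" using Cauchy_Schwarz_ineq2[of "z
          - c" n] n by simp
      ultimately have "F p > 0" using z pc r unfolding abs_le_iff by argo
      then show ?thesis using front[OF pb] by auto
    qed
    then show "closed_segment (x + (r/2) *\<^sub>R n) (y + (r/2) *\<^sub>R n) \<inter> frontier B = {}" by blast
  qed
  then show ?thesis using up[OF x] up[OF y] by simp
qed

lemma graph_gradient:
  fixes g :: "'a::euclidean_space \<Rightarrow> real" and e :: 'a
  assumes "GDERIV g (x - (x \<bullet> e) *\<^sub>R e) :> D"
  shows "GDERIV (\<lambda>x. x \<bullet> e - g (x - (x \<bullet> e) *\<^sub>R e)) x :> e - (D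
      - (D \<bullet> e) *\<^sub>R e)"
proof -
  have P: "((\<lambda>x. x - (x \<bullet> e) *\<^sub>R e) has_derivative (\<lambda>h. h
      - (h \<bullet> e) *\<^sub>R e)) (at x)"
    by (auto intro!: derivative_eq_intros)
  have "((\<lambda>x. g (x - (x \<bullet> e) *\<^sub>R e)) has_derivative (\<lambda>h. (h
      - (h \<bullet> e) *\<^sub>R e) \<bullet> D)) (at x)"
    using has_derivative_compose[OF P] assms unfolding gderiv_def by blast
  then have "((\<lambda>x. x \<bullet> e - g (x
      - (x \<bullet> e) *\<^sub>R e)) has_derivative (\<lambda>h. h \<bullet> e - (h
      - (h \<bullet> e) *\<^sub>R e) \<bullet> D)) (at x)"
    by (intro has_derivative_diff bounded_linear_imp_has_derivative[OF bounded_linear_inner_left])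
  then show ?thesis
    unfolding gderiv_def by (simp add: inner_diff_left inner_diff_right inner_commute algebra_simps)
qed

text \<open>Tangent curves \<open>t \<mapsto> Q + t \<eta> + (g(Q' + t \<eta>) - g(Q')) e\<close> with \<open>\<eta> \<bullet> e = 0\<close> determine the normal.\<close>
lemma unit_normal_graph:
  fixes S :: "'a::euclidean_space set" and e :: 'a
  assumes e: "norm e = 1" and W: "open W" "Q \<in> W" and Q: "Q \<in> S"
    and graph: "S \<inter> W = {x \<in> W. x \<bullet> e = g (x - (x \<bullet> e) *\<^sub>R e)}"
    and D: "GDERIV g (Q - (Q \<bullet> e) *\<^sub>R e) :> D"
    and \<nu>: "unit_normal S Q \<nu>"
  shows "\<nu> = (\<nu> \<bullet> e) *\<^sub>R (e - (D - (D \<bullet> e) *\<^sub>R e))"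
proof -
  define P where "P x = x - (x \<bullet> e) *\<^sub>R e" for x
  have ee: "e \<bullet> e = 1" using e by (simp add: norm_eq_1)
  have Qe: "Q \<bullet> e = g (P Q)" using graph Q W by (auto simp: P_def)
  have tangent: "(\<eta> + (\<eta> \<bullet> D) *\<^sub>R e) \<bullet> \<nu>
      = 0" if \<eta>: "\<eta> \<bullet> e = 0" for \<eta>
  proof -
    define \<gamma> where "\<gamma> t = Q + t *\<^sub>R \<eta> + (g (P Q + t *\<^sub>R \<eta>)
        - g (P Q)) *\<^sub>R e" for t :: real
    have l: "((\<lambda>t. P Q + t *\<^sub>R \<eta>) has_derivative (\<lambda>t. t *\<^sub>R \<eta>)) (at 0)"
      by (auto intro!: derivative_eq_intros)
    have "((\<lambda>t. g (P Q
        + t *\<^sub>R \<eta>)) has_derivative (\<lambda>t. (t *\<^sub>R \<eta>) \<bullet> D)) (at 0)"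
      using has_derivative_compose[OF l, of g "\<lambda>h. h \<bullet> D"] D by (simp add: gderiv_def P_def)
    then have \<gamma>': "(\<gamma> has_vector_derivative \<eta> + (\<eta> \<bullet> D) *\<^sub>R e) (at 0)"
      unfolding has_vector_derivative_def \<gamma>_def
      by (auto intro!: derivative_eq_intros simp: algebra_simps fun_eq_iff)
    have "isCont \<gamma> 0" using \<gamma>' by (rule has_vector_derivative_continuous)
    moreover have "\<gamma> 0 = Q" by (simp add: \<gamma>_def)
    ultimately have "(\<gamma> \<longlongrightarrow> Q) (at 0)" by (simp add: isCont_def)
    then have "\<forall>\<^sub>F t in at 0. \<gamma> t \<in> W" by (rule topological_tendstoD[OF _ W])
    then obtain \<epsilon> where \<epsilon>: "\<epsilon> > 0" "\<And>t. t \<noteq> 0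
        \<Longrightarrow> \<bar>t\<bar> < \<epsilon> \<Longrightarrow> \<gamma> t \<in> W"
      by (auto simp: eventually_at dist_real_def)
    have "\<gamma> t \<in> S" if t: "\<bar>t\<bar> < \<epsilon>" for t
    proof -
      have tW: "\<gamma> t \<in> W" using \<epsilon>(2)[OF _ t] W \<open>\<gamma> 0 = Q\<close> by (cases "t = 0") auto
      have ge: "\<gamma> t \<bullet> e = g (P Q + t *\<^sub>R \<eta>)" using \<eta> ee Qe
          by (simp add: \<gamma>_def inner_add_left)
      have "P (\<gamma> t) = P Q + t *\<^sub>R \<eta>"
      proof -
        have "P (\<gamma> t) = \<gamma> t - g (P Q + t *\<^sub>R \<eta>) *\<^sub>R e"
            by (simp only: P_def[of "\<gamma> t"] ge)
        also have "\<dots> = (Q - g (P Q) *\<^sub>R e) + t *\<^sub>R \<eta>"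
            by (simp add: \<gamma>_def scaleR_left_diff_distrib)
        also have "Q - g (P Q) *\<^sub>R e = P Q" by (subst Qe[symmetric]) (rule P_def[symmetric])
        finally show ?thesis .
      qed
      then have "\<gamma> t \<bullet> e = g (P (\<gamma> t))" by (simp only: ge)
      then have "\<gamma> t \<in> S \<inter> W" unfolding graph P_def using tW by blast
      then show ?thesis by blast
    qed
    then have "tangent_vector S Q (\<eta> + (\<eta> \<bullet> D) *\<^sub>R e)"
      unfolding tangent_vector_def using \<epsilon>(1) \<open>\<gamma> 0 = Q\<close> \<gamma>' by blast
    then show ?thesis using \<nu> by (simp add: unit_normal_def)
  qed
  define \<eta> where "\<eta> = P \<nu> + (\<nu> \<bullet> e) *\<^sub>R P D"
  have \<eta>e: "\<eta> \<bullet> e = 0" using ee by (simp add: \<eta>_def P_def inner_add_left inner_diff_left)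
  have "\<eta> \<bullet> \<nu> + (\<eta> \<bullet> D) * (\<nu> \<bullet> e) = 0"
    using tangent[OF \<eta>e] by (simp add: inner_add_left inner_commute[of e \<nu>])
  moreover have "\<eta> \<bullet> \<nu> = \<eta> \<bullet> P \<nu>" "\<eta> \<bullet> D
      = \<eta> \<bullet> P D" using \<eta>e by (simp_all add: P_def inner_diff_right)
  ultimately have "\<eta> \<bullet> \<eta> = 0"
    by (subst (2) \<eta>_def) (simp add: inner_add_right mult.commute)
  then have "P \<nu> + (\<nu> \<bullet> e) *\<^sub>R P D = 0" by (simp add: \<eta>_def)
  then show ?thesis by (simp add: P_def algebra_simps)
qed

text \<open>F is the height above the graph, divided by the length of its gradient at c so that the
  gradient there is the unit vector n. At boundary points the unit normal is parallel to m, and m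
  has length at most 2; hence the constant 2 C0.\<close>

lemma local_defining_function:
  fixes B :: "'a::euclidean_space set"
  assumes C1: "C1_hypersurface (frontier B)" and c: "c \<in> frontier B"
    and normal: "\<And>Q. Q \<in> frontier B \<Longrightarrow> unit_normal (frontier B) Q (\<nu> Q)"
    and U: "openin (top_of_set (frontier B)) U" "c \<in> U" and C0: "C0 \<ge> 0"
    and hoelder: "\<And>P Q. P \<in> U \<Longrightarrow> Q \<in> U \<Longrightarrow> \<bar>(P
        - Q) \<bullet> \<nu> Q\<bar> \<le> C0 * norm (P - Q) powr (3/2)"
    and \<delta>: "0 < \<delta>" "\<delta> \<le> 1/20"
  obtains F m n r and \<alpha> \<beta> :: real where
    "r > 0" "norm n = 1" "F c = 0" "\<bar>\<alpha>\<bar> \<le> 1" "\<bar>\<beta>\<bar> \<le> 1"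
    "\<And>x. x \<in> ball c r
        \<Longrightarrow> GDERIV F x :> m x" "\<And>x. x \<in> ball c r \<Longrightarrow> norm (m x - n) \<le> \<delta>"
    "\<And>x. x \<in> ball c r \<Longrightarrow> F x > 0 \<Longrightarrow> indicator B x = \<alpha>"
    "\<And>x. x \<in> ball c r \<Longrightarrow> F x < 0 \<Longrightarrow> indicator B x = \<beta>"
    "\<And>P Q. P \<in> ball c r \<Longrightarrow> Q \<in> ball c r \<Longrightarrow> F P = 0 \<Longrightarrow> F Q = 0
      \<Longrightarrow> \<bar>(P - Q) \<bullet> m Q\<bar> \<le> 2 * C0 * norm (P - Q) powr (3/2)"
proof -
  obtain e W V g where chart: "norm e = 1 \<and> open W \<and> c \<in> W \<and> open V \<and> C1_function_on g V \<and>
      (\<forall>x\<in>W. x - (x \<bullet> e) *\<^sub>R e \<in> V) \<and> frontier B \<inter> W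
          = {x \<in> W. x \<bullet> e = g (x - (x \<bullet> e) *\<^sub>R e)}"
    using bspec[OF C1[unfolded C1_hypersurface_def] c] by (elim exE)
  then have e: "norm e = 1" and W: "open W" "c \<in> W" and "C1_function_on g V"
    and WV: "\<And>x. x \<in> W \<Longrightarrow> x - (x \<bullet> e) *\<^sub>R e \<in> V"
    and graph: "frontier B \<inter> W = {x \<in> W. x \<bullet> e = g (x - (x \<bullet> e) *\<^sub>R e)}"
    by simp_all
  from \<open>C1_function_on g V\<close> obtain G where G: "\<And>y. y \<in> V
      \<Longrightarrow> GDERIV g y :> G y" and G_cont: "continuous_on V G"
    unfolding C1_function_on_def by blast
  define P where "P x = x - (x \<bullet> e) *\<^sub>R e" for x
  define M where "M x = e - (G (P x) - (G (P x) \<bullet> e) *\<^sub>R e)" for x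
  define F0 where "F0 x = x \<bullet> e - g (P x)" for x
  have ee: "e \<bullet> e = 1" using e by (simp add: norm_eq_1)
  have F0: "GDERIV F0 x :> M x" if "x \<in> W" for x
    unfolding F0_def[abs_def] M_def P_def by (rule graph_gradient[OF G[OF WV[OF that]]])
  \<comment> \<open>The component of M along e is 1 for every g, which keeps the divisor l away from
    0.\<close>
  have M1: "norm (M x) \<ge> 1" for x
  proof -
    have "M x \<bullet> e = 1" using ee by (simp add: M_def inner_diff_left)
    then show ?thesis using Cauchy_Schwarz_ineq2[of "M x" e] e by simp
  qed
  define l where "l = norm (M c)"
  have l: "l \<ge> 1" by (simp add: l_def M1)
  define n where "n = M c /\<^sub>R l"
  define F where "F x = F0 x / l" for x
  define m where "m x = M x /\<^sub>R l" for x
  have n1: "norm n = 1"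
  proof -
    have "norm n = inverse l * l" using l by (simp add: n_def l_def[symmetric])
    then show ?thesis using l by simp
  qed
  have F_grad: "GDERIV F x :> m x" if "x \<in> W" for x
    using has_derivative_mult_left[OF F0[OF that, unfolded gderiv_def], of "1/l"]
    unfolding gderiv_def F_def[abs_def] m_def by (simp add: divide_inverse mult.commute)
  have "continuous_on W m"
  proof -
    have "continuous_on W (\<lambda>x. G (P x))"
      by (rule continuous_on_compose2[OF G_cont]) (auto simp: P_def intro!: continuous_intros WV)
    then show ?thesis unfolding m_def M_def by (intro continuous_intros)
  qed
  then have "isCont m c" using W by (simp add: continuous_on_eq_continuous_at)
  then obtain r1 where r1: "r1 > 0" "\<And>x. dist x c < r1 \<Longrightarrow> dist (m x) (m c) < \<delta>"
    using \<delta> by (auto simp: continuous_at_eps_delta)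
  obtain r2 where r2: "r2 > 0" "ball c r2 \<subseteq> W" using W open_contains_ball by blast
  obtain T where T: "open T" "U = frontier B \<inter> T" using U(1) by (auto simp: openin_open)
  then obtain r3 where r3: "r3 > 0" "ball c r3 \<subseteq> T" using U(2) open_contains_ball by blast
  define r' where "r' = min r1 (min r2 r3)"
  have r': "r' > 0" using r1 r2 r3 by (simp add: r'_def)
  have inW: "x \<in> W" and close: "norm (m x - n) \<le> \<delta>"
      and inU: "x \<in> frontier B \<Longrightarrow> x \<in> U" if "x \<in> ball c r'" for x
  proof -
    show "x \<in> W" using that r2 by (auto simp: r'_def)
    have "dist (m x) (m c) < \<delta>" using that by (intro r1(2)) (simp add: r'_def dist_commute)
    then show "norm (m x - n) \<le> \<delta>" by (simp add: dist_norm m_def n_def)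
    show "x \<in> frontier B \<Longrightarrow> x \<in> U" using that r3 T by (auto simp: r'_def)
  qed
  have zero: "x \<in> frontier B \<longleftrightarrow> F x = 0" if "x \<in> ball c r'" for x
  proof -
    have "x \<in> frontier B \<longleftrightarrow> x \<bullet> e = g (P x)" using graph inW[OF that]
        unfolding P_def by blast
    then show ?thesis using l by (simp add: F_def F0_def)
  qed
  have F_c: "F c = 0" using zero[of c] c r' by simp
  have approx: "\<bar>F y - F x - (y - x) \<bullet> n\<bar> \<le> 1/20 * norm (y - x)"
      if "x \<in> ball c r'" "y \<in> ball c r'" for x y
    by (rule GDERIV_ball_linear_approx[OF F_grad order_trans[OF close \<delta>(2)] that]) (auto intro: inW)
  have approx': "\<bar>(- F y) - (- F x) - (y - x) \<bullet> (- n)\<bar> \<le> 1/20 * norm (y - x)"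
      if "x \<in> ball c r'" "y \<in> ball c r'" for x y
    using approx[OF that] by (simp add: abs_minus_commute algebra_simps)
  \<comment> \<open>A quarter of the radius leaves room for the detour in
    \<open>positive_side_constant\<close>.\<close>
  define r where "r = r' / 4"
  have r: "r > 0" "r \<le> r'" using r' by (auto simp: r_def)
  have "\<exists>\<alpha>. \<bar>\<alpha>\<bar> \<le> (1::real)
      \<and> (\<forall>x\<in>ball c r. F x > 0 \<longrightarrow> indicator B x = \<alpha>)"
  proof (cases "\<exists>x\<in>ball c r. F x > 0")
    case True
    then obtain x0 where x0: "x0 \<in> ball c r" "F x0 > 0" by blast
    have "x \<in> B \<longleftrightarrow> x0 \<in> B" if "x \<in> ball c r" "F x > 0" for x
      by (rule positive_side_constant[OF n1 r' approx F_c]) (use zero that x0 in \<open>auto simp: r_def simp del: mem_ball\<close>)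
    then show ?thesis by (intro exI[of _ "indicator B x0"]) (auto simp: indicator_def)
  next
    case False
    \<comment> \<open>Without positive values of F in the ball the claim is vacuous, and 0 serves as
      a default.\<close>
    then show ?thesis by (intro exI[of _ 0]) auto
  qed
  then obtain \<alpha> :: real where \<alpha>: "\<bar>\<alpha>\<bar>
      \<le> 1" "\<And>x. x \<in> ball c r \<Longrightarrow> F x > 0 \<Longrightarrow> indicator B x = \<alpha>" by blast
  have "\<exists>\<beta>. \<bar>\<beta>\<bar> \<le> (1::real)
      \<and> (\<forall>x\<in>ball c r. F x < 0 \<longrightarrow> indicator B x = \<beta>)"
  proof (cases "\<exists>x\<in>ball c r. F x < 0")
    case True
    then obtain x0 where x0: "x0 \<in> ball c r" "F x0 < 0" by blast
    \<comment> \<open>The negative side of F is the positive side of - F, with - n in place of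
      n.\<close>
    have "x \<in> B \<longleftrightarrow> x0 \<in> B" if "x \<in> ball c r" "F x < 0" for x
      by (rule positive_side_constant[of "- n" r' c "\<lambda>x. - F x", OF _ r' approx'])
        (use n1 F_c zero that x0 in \<open>auto simp: r_def simp del: mem_ball\<close>)
    then show ?thesis by (intro exI[of _ "indicator B x0"]) (auto simp: indicator_def)
  next
    case False
    then show ?thesis by (intro exI[of _ 0]) auto
  qed
  then obtain \<beta> :: real where \<beta>: "\<bar>\<beta>\<bar>
      \<le> 1" "\<And>x. x \<in> ball c r \<Longrightarrow> F x < 0 \<Longrightarrow> indicator B x = \<beta>" by blast
  have sub: "x \<in> ball c r'" if "x \<in> ball c r" for x using that r by simp
  show ?thesis
  proof (rule that[of r n F \<alpha> \<beta> m])
    fix p q assume p: "p \<in> ball c r" "F p = 0" and q: "q \<in> ball c r" "F q = 0"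
    have pf: "p \<in> frontier B" and qf: "q \<in> frontier B" using zero[OF sub] p q by auto
    have \<nu>q: "\<nu> q = (\<nu> q \<bullet> e) *\<^sub>R M q"
      unfolding M_def P_def
      by (rule unit_normal_graph[OF e W(1) inW[OF sub[OF q(1)]] qf graph G[OF WV[OF inW[OF sub[OF q(1)]]]] normal[OF qf]])
    have "norm (\<nu> q) = 1" using normal[OF qf] by (simp add: unit_normal_def)
    then have s: "\<bar>\<nu> q \<bullet> e\<bar> * norm (M q) = 1" using \<nu>q by (metis norm_scaleR)
    have "\<bar>(p - q) \<bullet> m q\<bar> = \<bar>(p - q) \<bullet> M q\<bar> / l" using l
        by (simp add: m_def divide_inverse mult.commute abs_mult)
    also have "\<bar>(p - q) \<bullet> M q\<bar> = norm (M q) * \<bar>(p - q) \<bullet> \<nu> q\<bar>"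
    proof -
      have "\<bar>(p - q) \<bullet> \<nu> q\<bar> = \<bar>\<nu> q \<bullet> e\<bar> * \<bar>(p - q) \<bullet> M q\<bar>"
        by (subst \<nu>q) (simp add: abs_mult)
      then have "norm (M q) * \<bar>(p - q) \<bullet> \<nu> q\<bar>
          = (\<bar>\<nu> q \<bullet> e\<bar> * norm (M q)) * \<bar>(p - q) \<bullet> M q\<bar>" by (simp only: mult_ac)
      then show ?thesis using s by simp
    qed
    also have "norm (M q) * \<bar>(p - q) \<bullet> \<nu> q\<bar> / l = norm (m q) * \<bar>(p
        - q) \<bullet> \<nu> q\<bar>"
      using l by (simp add: m_def divide_inverse mult_ac)
    also have "\<dots> \<le> 2 * (C0 * norm (p - q) powr (3/2))"
    proof (rule mult_mono)
      show "norm (m q) \<le> 2" using norm_triangle_ineq2[of "m q" n] close[OF sub[OF q(1)]] n1 \<delta> by simp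
      show "\<bar>(p - q) \<bullet> \<nu> q\<bar> \<le> C0 * norm (p - q) powr (3/2)"
        by (intro hoelder inU sub p q pf qf)
    qed auto
    finally show "\<bar>(p - q) \<bullet> m q\<bar> \<le> 2 * C0 * norm (p - q) powr (3/2)" by simp
  qed (use r n1 F_c \<alpha> \<beta> F_grad inW close sub in auto)
qed

section \<open>Localization and conclusion\<close>

text \<open>Uniform over all shifts h of length 1/R, so that the same constants serve every
  coordinate direction later.\<close>

definition localized_decay :: "('a::euclidean_space \<Rightarrow> real) \<Rightarrow> ('a \<Rightarrow> real) \<Rightarrow> bool" where
  "localized_decay f \<phi> \<longleftrightarrow> (\<exists>C\<ge>0. \<exists>R0\<ge>1. \<forall>R\<ge>R0. \<forall>h. norm h = 1 / R \<longrightarrow>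
     sphere_energy R (\<lambda>x. of_real (\<phi> x * second_diff f h x))
       \<le> ennreal (C * (1 / (R * R ^ DIM('a)))))"

lemma localized_decayI:
  fixes f :: "'a::euclidean_space \<Rightarrow> real"
  assumes "C \<ge> 0" "R0 \<ge> 1" "\<And>R h. R \<ge> R0 \<Longrightarrow> norm h = 1 / R \<Longrightarrow>
     sphere_energy R (\<lambda>x. of_real (\<phi> x * second_diff f h x))
       \<le> ennreal (C * (1 / (R * R ^ DIM('a))))"
  shows "localized_decay f \<phi>"
  unfolding localized_decay_def using assms by blast

lemma ft_add:
  assumes "integrable lborel G" "integrable lborel H"
  shows "ft (\<lambda>x. G x + H x) \<xi> = ft G \<xi> + ft H \<xi>"
  unfolding ft_def using ft_cong_integrable[OF assms(1), of \<xi>] ft_cong_integrable[OF assms(2), of \<xi>]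
  by (subst Bochner_Integration.integral_add[symmetric]) (auto simp: distrib_left)

lemma ft_cmult: "ft (\<lambda>x. z * H x) \<xi> = z * ft H \<xi>"
  unfolding ft_def by (simp add: mult.left_commute)

lemma integrable_second_diff:
  fixes f :: "'a::euclidean_space \<Rightarrow> real"
  assumes "integrable lborel f"
  shows "integrable lborel (second_diff f h)"
  unfolding second_diff_def[abs_def]
  using lborel_integrable_shift[OF assms, of "h + h"] lborel_integrable_shift[OF assms, of h] assms
  by (intro Bochner_Integration.integrable_add Bochner_Integration.integrable_diff integrable_mult_right) (auto simp: add.assoc)

lemma localized_decay_add:
  fixes f :: "'a::euclidean_space \<Rightarrow> real"
  assumes f: "integrable lborel f"
    and 1: "localized_decay f \<phi>" "\<phi> \<in> borel_measurable borel" "\<And>x. \<bar>\<phi> x\<bar> \<le> 1"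
    and 2: "localized_decay f \<psi>" "\<psi> \<in> borel_measurable borel" "\<And>x. \<bar>\<psi> x\<bar> \<le> 1"
  shows "localized_decay f (\<lambda>x. \<phi> x + \<psi> x)"
proof -
  from 1(1) obtain C R0 where C: "C \<ge> 0" "R0 \<ge> 1" "\<And>R h. R \<ge> R0 \<Longrightarrow> norm h
      = 1 / R \<Longrightarrow>
     sphere_energy R (\<lambda>x. of_real (\<phi> x * second_diff f h x))
       \<le> ennreal (C * (1 / (R * R ^ DIM('a))))"
    unfolding localized_decay_def by blast
  from 2(1) obtain D S0 where D: "D \<ge> 0" "S0 \<ge> 1" "\<And>R h. R \<ge> S0 \<Longrightarrow> norm h
      = 1 / R \<Longrightarrow>
     sphere_energy R (\<lambda>x. of_real (\<psi> x * second_diff f h x))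
       \<le> ennreal (D * (1 / (R * R ^ DIM('a))))"
    unfolding localized_decay_def by blast
  have [measurable]: "\<phi> \<in> borel_measurable borel" "\<psi> \<in> borel_measurable borel" "f \<in> borel_measurable borel"
    using 1 2 f by auto
  show ?thesis
  proof (rule localized_decayI[of "2 * C + 2 * D" "max R0 S0"])
    fix R :: real and h :: 'a assume R: "max R0 S0 \<le> R" and h: "norm h = 1 / R"
    have R0: "R > 0" using R C by simp
    let ?G = "\<lambda>x. complex_of_real (\<phi> x * second_diff f h x)" and ?H
        = "\<lambda>x. complex_of_real (\<psi> x * second_diff f h x)"
    have int: "integrable lborel (\<lambda>x. complex_of_real (\<theta> x * second_diff f h x))"
      if [measurable]: "\<theta> \<in> borel_measurable borel" and "\<And>x. \<bar>\<theta> x\<bar>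
          \<le> 1" for \<theta> :: "'a \<Rightarrow> real"
    proof (rule Bochner_Integration.integrable_bound[OF integrable_second_diff[OF f, of h]])
      show "AE x in lborel. norm (complex_of_real (\<theta> x * second_diff f h x)) \<le> norm (second_diff f h x)"
        using that(2) by (auto simp: abs_mult norm_mult intro!: mult_left_le_one_le)
    qed measurable
    have [measurable]: "ft ?G \<in> borel_measurable borel" "ft ?H \<in> borel_measurable borel"
      by (auto intro!: measurable_ft)
    have pt: "ennreal ((cmod (ft (\<lambda>x. of_real ((\<phi> x + \<psi> x) * second_diff f h x)) \<xi>))\<^sup>2)
      \<le> 2 * ennreal ((cmod (ft ?G \<xi>))\<^sup>2) + 2 * ennreal ((cmod (ft ?H \<xi>))\<^sup>2)" for \<xi>
    proof -
      have "ft (\<lambda>x. of_real ((\<phi> x + \<psi> x) * second_diff f h x)) \<xi> = ft ?G \<xi> + ft ?H \<xi>"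
        by (subst ft_add[symmetric]) (auto intro!: int 1 2 simp: distrib_right simp del: of_real_mult)
      then have "(cmod (ft (\<lambda>x. of_real ((\<phi> x
          + \<psi> x) * second_diff f h x)) \<xi>))\<^sup>2 \<le> (cmod (ft ?G \<xi>) + cmod (ft ?H \<xi>))\<^sup>2"
        using norm_triangle_ineq[of "ft ?G \<xi>" "ft ?H \<xi>"] by (intro power_mono) auto
      also have "\<dots> \<le> 2 * (cmod (ft ?G \<xi>))\<^sup>2 + 2 * (cmod (ft ?H \<xi>))\<^sup>2"
        using sum_squares_bound[of "cmod (ft ?G \<xi>)" "cmod (ft ?H \<xi>)"] by (simp add: power2_sum)
      finally have "ennreal ((cmod (ft (\<lambda>x. of_real ((\<phi> x
          + \<psi> x) * second_diff f h x)) \<xi>))\<^sup>2)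
        \<le> ennreal (2 * (cmod (ft ?G \<xi>))\<^sup>2 + 2 * (cmod (ft ?H \<xi>))\<^sup>2)" by (rule ennreal_leI)
      also have "\<dots> = 2 * ennreal ((cmod (ft ?G \<xi>))\<^sup>2) + 2 * ennreal ((cmod (ft ?H \<xi>))\<^sup>2)"
        by (simp add: ennreal_plus ennreal_mult)
      finally show ?thesis .
    qed
    have "sphere_energy R (\<lambda>x. of_real ((\<phi> x + \<psi> x) * second_diff f h x))
      \<le> (\<integral>\<^sup>+\<omega>. 2 * ennreal ((cmod (ft ?G (R *\<^sub>R \<omega>)))\<^sup>2)
          + 2 * ennreal ((cmod (ft ?H (R *\<^sub>R \<omega>)))\<^sup>2) \<partial>sphere_measure)"
      by (intro nn_integral_mono pt)
    also have "\<dots> = 2 * sphere_energy R ?G + 2 * sphere_energy R ?H"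
      by (simp add: nn_integral_add nn_integral_cmult measurable_sphere_measure)
    also have "\<dots> \<le> 2 * ennreal (C * (1 / (R * R ^ DIM('a)))) + 2 * ennreal (D * (1 / (R * R ^ DIM('a))))"
      using R h by (intro add_mono mult_left_mono C D) auto
    also have "\<dots> = ennreal (2 * (C * (1 / (R * R ^ DIM('a))))) + ennreal (2 * (D * (1 / (R * R ^ DIM('a)))))"
    proof -
      have dbl: "2 * ennreal x = ennreal (2 * x)" if "x \<ge> 0" for x using that by (simp add: ennreal_mult)
      have "0 \<le> C * (1 / (R * R ^ DIM('a)))" "0 \<le> D * (1 / (R * R ^ DIM('a)))" using R0 C D by simp_all
      then show ?thesis by (simp only: dbl)
    qed
    also have "\<dots> = ennreal (2 * (C * (1 / (R * R ^ DIM('a)))) + 2 * (D * (1 / (R * R ^ DIM('a)))))"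
      using R0 C D by (intro ennreal_plus[symmetric]) auto
    also have "2 * (C * (1 / (R * R ^ DIM('a)))) + 2 * (D * (1 / (R * R ^ DIM('a)))) = (2 * C + 2 * D)
        * (1 / (R * R ^ DIM('a)))"
      by (simp only: distrib_right mult.assoc)
    finally show "sphere_energy R (\<lambda>x. of_real ((\<phi> x + \<psi> x) * second_diff f h x))
      \<le> ennreal ((2 * C + 2 * D) * (1 / (R * R ^ DIM('a))))" .
  qed (use C D in auto)
qed

text \<open>Quantified over all Lipschitz cutoffs near c, with s independent of Lip: the cutoffs met
  in \<open>partition_decay\<close> are products whose Lipschitz constants grow with the number of
  balls.\<close>

definition local_cutoff_decay :: "('a::euclidean_space \<Rightarrow> real) \<Rightarrow> 'a \<Rightarrow> real \<Rightarrow> bool" where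
  "local_cutoff_decay f c s \<longleftrightarrow> (\<forall>\<phi> Lip. (\<forall>x. \<bar>\<phi> x\<bar>
      \<le> 1) \<longrightarrow> (\<forall>x y. \<bar>\<phi> x - \<phi> y\<bar> \<le> Lip * norm (x - y))
     \<longrightarrow> (\<forall>x. \<phi> x \<noteq> 0 \<longrightarrow> norm (x - c)
         \<le> s) \<longrightarrow> localized_decay f \<phi>)"

lemma frontier_local_cutoff_decay:
  fixes B :: "'a::euclidean_space set"
  assumes B: "open B" "bounded B" and C1: "C1_hypersurface (frontier B)" and c: "c \<in> frontier B"
    and normal: "\<And>Q. Q \<in> frontier B \<Longrightarrow> unit_normal (frontier B) Q (\<nu> Q)"
    and U: "openin (top_of_set (frontier B)) U" "c \<in> U" and C0: "C0 \<ge> 0"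
    and hoelder: "\<And>P Q. P \<in> U \<Longrightarrow> Q \<in> U \<Longrightarrow> \<bar>(P
        - Q) \<bullet> \<nu> Q\<bar> \<le> C0 * norm (P - Q) powr (3/2)"
  shows "\<exists>s>0. local_cutoff_decay (indicator B) c s"
proof -
  \<comment> \<open>Meets the tolerances of \<open>near_graph\<close> and \<open>far_graph\<close>
    at once.\<close>
  define \<delta> where "\<delta> = min (1/20) (1 / (4 * dim_const TYPE('a)))"
  have \<delta>: "0 < \<delta>" "\<delta> \<le> 1/20" "\<delta> * (4 * dim_const TYPE('a)) \<le> 1"
    using dim_const_ge[where 'a='a] by (auto simp: \<delta>_def min_def field_simps)
  obtain F m n r and \<alpha> \<beta> :: real where *:
    "r > 0" "norm n = 1" "F c = 0" "\<bar>\<alpha>\<bar> \<le> 1" "\<bar>\<beta>\<bar> \<le> 1"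
    "\<And>x. x \<in> ball c r
        \<Longrightarrow> GDERIV F x :> m x" "\<And>x. x \<in> ball c r \<Longrightarrow> norm (m x - n) \<le> \<delta>"
    "\<And>x. x \<in> ball c r \<Longrightarrow> F x > 0 \<Longrightarrow> indicator B x = \<alpha>"
    "\<And>x. x \<in> ball c r \<Longrightarrow> F x < 0 \<Longrightarrow> indicator B x = \<beta>"
    "\<And>P Q. P \<in> ball c r \<Longrightarrow> Q \<in> ball c r \<Longrightarrow> F P = 0 \<Longrightarrow> F Q = 0
      \<Longrightarrow> \<bar>(P - Q) \<bullet> m Q\<bar> \<le> 2 * C0 * norm (P - Q) powr (3/2)"
    by (rule local_defining_function[OF C1 c normal U C0 hoelder \<delta>(1,2)]) (assumption | rule that)+
  define s where "s = r / (32 * dim_const TYPE('a))"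
  have s: "s > 0" using *(1) dim_const_ge[where 'a='a] by (simp add: s_def)
  have "local_cutoff_decay (indicator B) c s"
    unfolding local_cutoff_decay_def
  proof (intro allI impI)
    fix \<phi> :: "'a \<Rightarrow> real" and Lip :: real
    assume \<phi>: "\<forall>x. \<bar>\<phi> x\<bar> \<le> 1" "\<forall>x y. \<bar>\<phi> x
        - \<phi> y\<bar> \<le> Lip * norm (x - y)" "\<forall>x. \<phi> x \<noteq> 0 \<longrightarrow> norm (x
        - c) \<le> s"
    interpret far_graph F m n c r "indicator B" \<phi> \<alpha> \<beta> "2 * C0" Lip
    proof
      show "norm (m x - n) \<le> 1/20" if "x \<in> ball c r" for x using *(7)[OF that] \<delta> by linarith
      show "norm (m x - n) * (4 * dim_const TYPE('a)) \<le> 1" if "x \<in> ball c r" for x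
      proof -
        have "norm (m x - n) * (4 * dim_const TYPE('a)) \<le> \<delta> * (4 * dim_const TYPE('a))"
          using *(7)[OF that] dim_const_ge[where 'a='a] by (intro mult_right_mono) auto
        then show ?thesis using \<delta> by linarith
      qed
      show "(indicator B :: 'a \<Rightarrow> real) \<in> borel_measurable borel" using B
          by (intro borel_measurable_indicator) auto
    qed (use * \<phi> C0 in \<open>auto simp: s_def simp del: mem_ball split: split_indicator\<close>)
    show "localized_decay (indicator B) \<phi>"
      by (rule localized_decayI[OF piece_const_nonneg, of "max 1 (16 / \<rho>)"], simp, rule piece_estimate) auto
  qed
  then show ?thesis using s by blast
qed

section \<open>Partition of the boundary layer\<close>

definition cutoff :: "real \<Rightarrow> 'a::euclidean_space \<Rightarrow> 'a \<Rightarrow> real" where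
  "cutoff s c x = max 0 (min 1 (2 - 2 * norm (x - c) / s))"

lemma cutoff_range: "0 \<le> cutoff s c x" "cutoff s c x \<le> 1"
  by (auto simp: cutoff_def)

lemma cutoff_eq_1:
  assumes "s > 0" "norm (x - c) \<le> s / 2"
  shows "cutoff s c x = 1"
proof -
  have "1 \<le> 2 - 2 * norm (x - c) / s" using assms by (simp add: field_simps)
  then show ?thesis by (simp add: cutoff_def)
qed

lemma cutoff_support:
  assumes "s > 0" "cutoff s c x \<noteq> 0"
  shows "norm (x - c) \<le> s"
proof (rule ccontr)
  assume "\<not> ?thesis"
  then have "2 - 2 * norm (x - c) / s < 0" using assms(1) by (simp add: field_simps)
  then show False using assms(2) by (simp add: cutoff_def)
qed

lemma cutoff_lipschitz:
  assumes "s > 0"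
  shows "\<bar>cutoff s c x - cutoff s c y\<bar> \<le> 2 / s * norm (x - y)"
proof -
  have "\<bar>norm (x - c) - norm (y - c)\<bar> \<le> norm (x - y)"
    using norm_triangle_ineq3[of "x - c" "y - c"] by simp
  then have "2 / s * \<bar>norm (x - c) - norm (y - c)\<bar> \<le> 2 / s * norm (x - y)"
    using assms by (intro mult_left_mono) auto
  moreover have "2 * norm (x - c) / s - 2 * norm (y - c) / s = 2 / s * (norm (x - c) - norm (y - c))"
    by (simp add: right_diff_distrib)
  ultimately have "\<bar>2 * norm (x - c) / s - 2 * norm (y - c) / s\<bar> \<le> 2 / s * norm (x - y)"
    using assms by (simp only: abs_mult) simp
  moreover have "\<bar>max 0 (min 1 (2 - a)) - max 0 (min 1 (2 - b))\<bar> \<le> \<bar>a - b\<bar>" for a b :: real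
    by (auto simp: max_def min_def)
  ultimately show ?thesis unfolding cutoff_def by (rule order_trans[rotated])
qed

lemma lipschitz_mult_unit:
  fixes p q :: "'a::real_normed_vector \<Rightarrow> real"
  assumes "\<And>x. 0 \<le> p x \<and> p x \<le> 1" "\<And>x. 0 \<le> q x \<and> q x \<le> 1"
    and "\<And>x y. \<bar>p x - p y\<bar> \<le> K * norm (x - y)" "\<And>x y. \<bar>q x - q y\<bar>
        \<le> M * norm (x - y)"
  shows "\<bar>p x * q x - p y * q y\<bar> \<le> (K + M) * norm (x - y)"
proof -
  have "\<bar>p x * q x - p y * q y\<bar> = \<bar>(p x - p y) * q x + p y * (q x - q y)\<bar>"
      by (simp add: algebra_simps)
  also have "\<dots> \<le> \<bar>p x - p y\<bar> * \<bar>q x\<bar> + \<bar>p y\<bar> * \<bar>q x - q y\<bar>"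
    unfolding abs_mult[symmetric] by (rule abs_triangle_ineq)
  also have "\<dots> \<le> \<bar>p x - p y\<bar> * 1 + 1 * \<bar>q x - q y\<bar>"
    using assms(1)[of y] assms(2)[of x] by (intro add_mono mult_mono) auto
  also have "\<dots> \<le> (K + M) * norm (x - y)"
    using assms(3)[of x y] assms(4)[of x y] by (simp add: distrib_right)
  finally show ?thesis .
qed

text \<open>A partition of unity by telescoping: \<open>rst\<close> is the product of all the 1 -
  cutoff, and a further centre c adds to 1 - rst the single term cutoff times rst, which is
  supported near c and thus decays by hypothesis. On each half ball one factor of \<open>rst\<close>
  vanishes.\<close>

lemma partition_decay:
  fixes f :: "'a::euclidean_space \<Rightarrow> real"
  assumes f: "integrable lborel f" and J: "finite J" "\<And>c. c \<in> J \<Longrightarrow> s c > 0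
      \<and> local_cutoff_decay f c (s c)"
  shows "\<exists>rst K. (\<forall>x. 0 \<le> rst x \<and> rst x \<le> 1) \<and> (\<forall>x y. \<bar>rst x
      - rst y\<bar> \<le> K * norm (x - y))
    \<and> (\<forall>x. (\<exists>c\<in>J. norm (x - c) \<le> s c / 2) \<longrightarrow> rst x = 0)
        \<and> localized_decay f (\<lambda>x. 1 - rst x)"
  using J
proof (induction J rule: finite_induct)
  case empty
  have "localized_decay f (\<lambda>x. 1 - 1)"
    by (rule localized_decayI[of 0 1]) (auto simp: ft_def)
  then show ?case by (intro exI[of _ "\<lambda>x. 1"] exI[of _ 0]) auto
next
  case (insert c J)
  then obtain rst K where rst: "\<And>x. 0 \<le> rst x \<and> rst x \<le> 1" "\<And>x y. \<bar>rst x
      - rst y\<bar> \<le> K * norm (x - y)"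
    "\<And>x. (\<exists>c\<in>J. norm (x - c) \<le> s c / 2) \<Longrightarrow> rst x
        = 0" "localized_decay f (\<lambda>x. 1 - rst x)"
    by (metis insertI2)
  have s: "s c > 0" and loc: "local_cutoff_decay f c (s c)" using insert.prems by auto
  let ?c = "cutoff (s c) c"
  have cr: "0 \<le> ?c x \<and> ?c x \<le> 1" for x by (simp add: cutoff_range)
  have prod_lip: "\<bar>?c x * rst x - ?c y * rst y\<bar> \<le> (2 / s c + K) * norm (x - y)" for x y
    by (rule lipschitz_mult_unit[OF cr rst(1) cutoff_lipschitz[OF s] rst(2)])
  have prod_bd: "0 \<le> ?c x * rst x \<and> ?c x * rst x \<le> 1" for x
    using cr[of x] rst(1)[of x] by (auto intro: mult_le_one)
  have "localized_decay f (\<lambda>x. ?c x * rst x)"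
  proof -
    have "\<forall>x. \<bar>?c x * rst x\<bar> \<le> 1" using prod_bd by auto
    moreover have "\<forall>x. ?c x * rst x \<noteq> 0 \<longrightarrow> norm (x - c) \<le> s c"
        using cutoff_support[OF s] by auto
    ultimately show ?thesis
      using spec[OF spec[OF loc[unfolded local_cutoff_decay_def], of "\<lambda>x. ?c x * rst x"], of "2 / s c
          + K"] prod_lip by blast
  qed
  then have "localized_decay f (\<lambda>x. (1 - rst x) + ?c x * rst x)"
    using rst(1) prod_bd
    by (intro localized_decay_add f rst(4) lipschitz_borel[OF prod_lip] borel_measurable_diff borel_measurable_const lipschitz_borel[OF rst(2)])
      (auto simp: abs_le_iff intro: order_trans[of _ 0])
  then have dec: "localized_decay f (\<lambda>x. 1 - (1 - ?c x) * rst x)" by (simp add: algebra_simps)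
  have lip1: "\<bar>(1 - ?c x) - (1 - ?c y)\<bar> \<le> 2 / s c * norm (x - y)" for x y
    using cutoff_lipschitz[OF s, of c x y] by (simp add: abs_minus_commute)
  have cr1: "0 \<le> 1 - ?c x \<and> 1 - ?c x \<le> 1" for x using cr[of x] by simp
  have "\<bar>(1 - ?c x) * rst x - (1 - ?c y) * rst y\<bar> \<le> (2 / s c + K) * norm (x - y)" for x y
    by (rule lipschitz_mult_unit[OF cr1 rst(1) lip1 rst(2)])
  moreover have "0 \<le> (1 - ?c x) * rst x \<and> (1 - ?c x) * rst x \<le> 1" for x
    using cr1[of x] rst(1)[of x] by (auto intro: mult_le_one)
  moreover have "(1 - ?c x) * rst x = 0" if "\<exists>c\<in>insert c J. norm (x - c) \<le> s c / 2" for x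
    using that cutoff_eq_1[OF s, of x c] rst(3)[of x] by auto
  ultimately show ?case using dec by (intro exI[of _ "\<lambda>x. (1 - ?c x) * rst x"] exI[of _ "2 / s c + K"]) auto
qed

lemma second_diff_away_from_frontier:
  assumes "\<And>y. y \<in> frontier B \<Longrightarrow> norm (x - y) > 2 * norm h"
  shows "second_diff (indicator B) h x = 0"
proof -
  have "closed_segment x (x + v) \<inter> frontier B = {}" if "norm v \<le> 2 * norm h" for v
  proof -
    have "p \<notin> frontier B" if p: "p \<in> closed_segment x (x + v)" for p
    proof -
      from p obtain t where "0 \<le> t" "t \<le> 1" "p = x + t *\<^sub>R v"
          by (auto simp: closed_segment_def algebra_simps)
      then have "norm (x - p) \<le> norm v" by (simp add: mult_left_le_one_le)
      then show ?thesis using assms[of p] \<open>norm v \<le> 2 * norm h\<close> by auto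
    qed
    then show ?thesis by blast
  qed
  then have *: "x \<in> B \<longleftrightarrow> x + v \<in> B" if "norm v \<le> 2 * norm h" for v
    using that by (intro segment_avoiding_frontier)
  have "norm (h + h) \<le> 2 * norm h" using norm_triangle_ineq[of h h] by simp
  then show ?thesis using *[of h] *[of "h + h"] by (simp add: second_diff_def indicator_def add.assoc)
qed

section \<open>Return from second differences to the indicator function\<close>

lemma cmod_cis_minus_1_ge:
  assumes "\<bar>t\<bar> \<le> 1"
  shows "\<bar>t\<bar> / 2 \<le> cmod (cis t - 1)"
proof -
  have pos: "t / 2 \<le> sin t" if "0 \<le> t" "t \<le> 1" for t :: real
  proof (cases "t = 0")
    case False
    then have "0 < t" using that by simp
    then obtain z where z: "0 < z" "z < t" "sin t - sin 0 = (t - 0) * cos z"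
      using MVT2[of 0 t sin cos] by auto
    have "t * (1/2) \<le> t * cos z" using z that by (intro mult_left_mono cos_ge_half) auto
    then show ?thesis using z by simp
  qed simp
  have "\<bar>t\<bar> / 2 \<le> \<bar>sin t\<bar>"
    using pos[of t] pos[of "- t"] assms by (cases "0 \<le> t") auto
  also have "\<dots> \<le> cmod (cis t - 1)" using abs_Im_le_cmod[of "cis t - 1"] by simp
  finally show ?thesis .
qed

lemma ft_second_diff:
  fixes f :: "'a::euclidean_space \<Rightarrow> real"
  assumes f: "integrable lborel f"
  shows "ft (\<lambda>x. of_real (second_diff f h x)) \<xi> = (cis (h \<bullet> \<xi>)
      - 1)\<^sup>2 * ft (\<lambda>x. of_real (f x)) \<xi>"
proof -
  let ?f = "\<lambda>x. complex_of_real (f x)"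
  have [measurable]: "f \<in> borel_measurable borel" using f by auto
  have i: "integrable lborel ?f" using f by simp
  have "ft (\<lambda>x. of_real (second_diff f h x)) \<xi> = ft (\<lambda>x. (?f (x + (h + h))
      + (- 2) * ?f (x + h)) + ?f x) \<xi>"
    by (simp add: second_diff_def add.assoc)
  also have "\<dots> = ft (\<lambda>x. ?f (x + (h + h))) \<xi> + (- 2) * ft (\<lambda>x. ?f (x + h)) \<xi>
      + ft ?f \<xi>"
    using lborel_integrable_shift[OF i, of "h + h"] lborel_integrable_shift[OF i, of h] i
    by (subst ft_add, force, force, subst ft_add, force, force, subst ft_cmult) simp
  also have "\<dots> = (cis ((h + h) \<bullet> \<xi>) + (- 2) * cis (h \<bullet> \<xi>) + 1) * ft ?f \<xi>"
    by (simp add: ft_shift[where H="?f"] algebra_simps)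
  also have "cis ((h + h) \<bullet> \<xi>) + (- 2) * cis (h \<bullet> \<xi>) + 1 = (cis (h \<bullet> \<xi>)
      - 1)\<^sup>2"
  proof -
    have "cis ((h + h) \<bullet> \<xi>) = cis (h \<bullet> \<xi>) * cis (h \<bullet> \<xi>)"
        by (simp only: inner_add_left cis_mult)
    then show ?thesis by (simp add: power2_eq_square algebra_simps)
  qed
  finally show ?thesis .
qed

lemma fourier_eq_ft:
  assumes [measurable]: "f \<in> borel_measurable borel"
  shows "fourier f \<xi> = ft f \<xi>"
proof -
  have "exp (- (\<i> * complex_of_real t)) = cis (- t)" for t by (simp add: cis_conv_exp)
  then show ?thesis
    unfolding fourier_def ft_def by (simp add: integral_completion)
qed

text \<open>Some coordinate t = \<omega> \<bullet> b satisfies t^2 \<ge> 1/d. For h = b/R the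
  multiplier of the second difference has modulus |cis t - 1|^2 \<ge> t^2/4 \<ge> 1/(4 d), so
  passing to second differences costs a factor 4 d. Squaring and summing over d coordinates gives 16
  d^3.\<close>

lemma indicator_decay:
  fixes B :: "'a::euclidean_space set"
  assumes B: "open B" "bounded B" and loc: "\<And>c. c \<in> frontier B
      \<Longrightarrow> \<exists>s>0. local_cutoff_decay (indicator B) c s"
  shows "\<exists>C\<ge>0. \<exists>R0\<ge>1. \<forall>R\<ge>R0. sphere_energy R (\<lambda>x. of_real (indicator B x))
       \<le> ennreal (C * (1 / (R * R ^ DIM('a))))"
proof -
  let ?f = "indicator B :: 'a \<Rightarrow> real"
  define d where "d = real DIM('a)"
  have d: "d \<ge> 1" by (simp add: d_def Suc_leI)
  have [measurable]: "B \<in> sets borel" using B by auto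
  have f: "integrable lborel ?f"
    using emeasure_bounded_finite[OF B(2)] by (intro integrable_real_indicator) auto
  obtain s where s: "\<And>c. c \<in> frontier B \<Longrightarrow> s c > 0 \<and> local_cutoff_decay ?f c (s c)"
    using loc by metis
  have cpt: "compact (frontier B)" using B by (simp add: compact_frontier_bounded)
  have "frontier B \<subseteq> (\<Union>c\<in>frontier B. ball c (s c / 2))" using s by force
  then obtain J where J: "J \<subseteq> frontier B" "finite J" "frontier B \<subseteq> (\<Union>c\<in>J. ball c (s c / 2))"
    using compactE_image[OF cpt, of "frontier B" "\<lambda>c. ball c (s c / 2)"] by (metis open_ball)
  have Js: "\<And>c. c \<in> J \<Longrightarrow> s c > 0 \<and> local_cutoff_decay ?f c (s c)" using J s by blast
  obtain rst K where rst: "\<And>x. (\<exists>c\<in>J. norm (x - c) \<le> s c / 2) \<Longrightarrow> rst x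
      = 0" "localized_decay ?f (\<lambda>x. 1 - rst x)"
    using partition_decay[OF f J(2) Js] by blast
  have "open (\<Union>c\<in>J. ball c (s c / 2))" by (intro open_UN ballI open_ball)
  \<comment> \<open>By compactness the half balls cover a uniform neighbourhood of the frontier. For
    R \<ge> 3/e it contains every point where a second difference of step 1/R can be nonzero, since
    2/R < e.\<close>
  then obtain e where e: "e > 0" "(\<Union>x\<in>frontier B. ball x e) \<subseteq> (\<Union>c\<in>J. ball c (s c / 2))"
    using compact_subset_open_imp_ball_epsilon_subset[OF cpt _ J(3)] by metis
  obtain C R0 where C: "C \<ge> 0" "R0 \<ge> 1" "\<And>R h. R \<ge> R0 \<Longrightarrow> norm h
      = 1 / R \<Longrightarrow>
     sphere_energy R (\<lambda>x. of_real ((1 - rst x) * second_diff ?f h x))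
       \<le> ennreal (C * (1 / (R * R ^ DIM('a))))"
    using rst(2) unfolding localized_decay_def by blast
  have est: "sphere_energy R (\<lambda>x. of_real (?f x))
      \<le> ennreal (16 * d ^ 3 * C * (1 / (R * R ^ DIM('a))))" if R: "R \<ge> max R0 (3 / e)" for R
  proof -
    have R1: "R \<ge> R0" "R > 0" using R C by auto
    have Re: "2 * (1 / R) < e"
    proof -
      have "3 / e \<le> R" using R by simp
      then have "3 \<le> R * e" using e(1) by (simp add: pos_divide_le_eq)
      then show ?thesis using R1 by (simp add: field_simps)
    qed
    define X where "X b \<omega>
        = ennreal ((cmod (ft (\<lambda>x. of_real (second_diff ?f ((1 / R) *\<^sub>R b) x)) (R *\<^sub>R \<omega>)))\<^sup>2)" for b \<omega>
    have X_meas: "X b \<in> borel_measurable sphere_measure" for b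
    proof -
      have [measurable]: "ft (\<lambda>x. complex_of_real (second_diff ?f ((1 / R) *\<^sub>R b) x)) \<in> borel_measurable borel"
        by (rule measurable_ft) measurable
      show ?thesis unfolding X_def by (rule measurable_sphere_measure) measurable
    qed
    have X_le: "(\<integral>\<^sup>+\<omega>. X b \<omega> \<partial>sphere_measure) \<le> ennreal (C
        * (1 / (R * R ^ DIM('a))))" if b: "b \<in> Basis" for b
    proof -
      let ?h = "(1 / R) *\<^sub>R b"
      have h: "norm ?h = 1 / R" using b R1 by (simp add: norm_Basis)
      have "second_diff ?f ?h x = (1 - rst x) * second_diff ?f ?h x" for x
      proof (cases "\<exists>y\<in>frontier B. norm (x - y) \<le> 2 * norm ?h")
        case True
        then obtain y where y: "y \<in> frontier B" "norm (x - y) < e" using Re unfolding h by fastforce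
        then have "x \<in> (\<Union>x\<in>frontier B. ball x e)" by (auto simp: dist_norm norm_minus_commute)
        then have "x \<in> (\<Union>c\<in>J. ball c (s c / 2))" using e(2) by blast
        then obtain c where "c \<in> J" "x \<in> ball c (s c / 2)" by blast
        then have "\<exists>c\<in>J. norm (x - c) \<le> s c / 2"
            by (intro bexI[of _ c]) (auto simp: dist_norm norm_minus_commute)
        then show ?thesis using rst(1) by simp
      next
        case False
        then have "second_diff ?f ?h x = 0" by (intro second_diff_away_from_frontier) (auto simp: not_le)
        then show ?thesis by simp
      qed
      then have "X b = (\<lambda>\<omega>. ennreal ((cmod (ft (\<lambda>x. of_real ((1
          - rst x) * second_diff ?f ?h x)) (R *\<^sub>R \<omega>)))\<^sup>2))"
        unfolding X_def by presburger
      then show ?thesis using C(3)[OF R1(1) h] by simp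
    qed
    have "sphere_energy R (\<lambda>x. of_real (?f x))
      \<le> (\<integral>\<^sup>+\<omega>. (\<Sum>b\<in>Basis. ennreal (16 * d\<^sup>2) * X b \<omega>) \<partial>sphere_measure)"
    proof (rule nn_integral_mono)
      fix \<omega> :: 'a assume "\<omega> \<in> space sphere_measure"
      then have \<omega>: "norm \<omega> = 1" by simp
      have "\<exists>b\<in>Basis. 1 / d \<le> (\<omega> \<bullet> b)\<^sup>2"
      proof (rule ccontr)
        assume "\<not> ?thesis"
        then have "(\<Sum>b\<in>Basis. (\<omega> \<bullet> b)\<^sup>2) < (\<Sum>b\<in>(Basis :: 'a set). 1 / d)"
          by (intro sum_strict_mono) (auto simp: not_le)
        also have "\<dots> = 1" using d by (simp add: d_def)
        finally show False using \<omega> by (simp add: norm_power2_Basis[symmetric])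
      qed
      then obtain b where b: "b \<in> Basis" "1 / d \<le> (\<omega> \<bullet> b)\<^sup>2" by blast
      define t where "t = \<omega> \<bullet> b"
      have t1: "\<bar>t\<bar> \<le> 1" using Basis_le_norm[OF b(1), of \<omega>] \<omega> by (simp add: t_def)
      have "(\<bar>t\<bar> / 2)\<^sup>2 \<le> (cmod (cis t - 1))\<^sup>2"
        by (intro power_mono cmod_cis_minus_1_ge t1) simp
      then have "1 / d / 4 \<le> cmod ((cis t - 1)\<^sup>2)"
        using b(2) by (simp add: t_def norm_power power_divide)
      then have "1 / d / 4 * cmod (ft (\<lambda>x. of_real (?f x)) (R *\<^sub>R \<omega>)) \<le> cmod ((cis t
          - 1)\<^sup>2) * cmod (ft (\<lambda>x. of_real (?f x)) (R *\<^sub>R \<omega>))"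
        by (rule mult_right_mono) simp
      also have "\<dots> = cmod (ft (\<lambda>x. of_real (second_diff ?f ((1 / R) *\<^sub>R b) x)) (R *\<^sub>R \<omega>))"
        using R1 by (simp add: ft_second_diff[OF f] norm_mult t_def inner_commute)
      finally have "cmod (ft (\<lambda>x. of_real (?f x)) (R *\<^sub>R \<omega>))
          \<le> 4 * d * cmod (ft (\<lambda>x. of_real (second_diff ?f ((1 / R) *\<^sub>R b) x)) (R *\<^sub>R \<omega>))"
        using d by (simp add: field_simps)
      then have "(cmod (ft (\<lambda>x. of_real (?f x)) (R *\<^sub>R \<omega>)))\<^sup>2
          \<le> (4 * d * cmod (ft (\<lambda>x. of_real (second_diff ?f ((1 / R) *\<^sub>R b) x)) (R *\<^sub>R \<omega>)))\<^sup>2"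
        by (rule power_mono) simp
      then have "ennreal ((cmod (ft (\<lambda>x. of_real (?f x)) (R *\<^sub>R \<omega>)))\<^sup>2)
          \<le> ennreal (16 * d\<^sup>2
          * (cmod (ft (\<lambda>x. of_real (second_diff ?f ((1 / R) *\<^sub>R b) x)) (R *\<^sub>R \<omega>)))\<^sup>2)"
        by (intro ennreal_leI) (simp add: power_mult_distrib)
      also have "\<dots> = ennreal (16 * d\<^sup>2) * X b \<omega>" unfolding X_def using d by (intro ennreal_mult) auto
      also have "\<dots> \<le> (\<Sum>b\<in>Basis. ennreal (16 * d\<^sup>2) * X b \<omega>)"
        by (rule member_le_sum[OF b(1), of "\<lambda>b. ennreal (16 * d\<^sup>2) * X b \<omega>"]) auto
      finally show "ennreal ((cmod (ft (\<lambda>x. of_real (?f x)) (R *\<^sub>R \<omega>)))\<^sup>2)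
          \<le> (\<Sum>b\<in>Basis. ennreal (16 * d\<^sup>2) * X b \<omega>)" .
    qed
    also have "\<dots> = (\<Sum>b\<in>Basis. ennreal (16 * d\<^sup>2)
        * (\<integral>\<^sup>+\<omega>. X b \<omega> \<partial>sphere_measure))"
      using X_meas by (simp add: nn_integral_sum nn_integral_cmult)
    also have "\<dots> \<le> (\<Sum>b\<in>(Basis :: 'a set). ennreal (16 * d\<^sup>2) * ennreal (C
        * (1 / (R * R ^ DIM('a)))))"
      by (intro sum_mono mult_left_mono X_le) auto
    also have "\<dots> = ennreal d * (ennreal (16 * d\<^sup>2) * ennreal (C * (1 / (R * R ^ DIM('a)))))"
      by (simp only: sum_constant ennreal_of_nat_eq_real_of_nat d_def)
    also have "\<dots> = ennreal (d * (16 * d\<^sup>2 * (C * (1 / (R * R ^ DIM('a))))))"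
    proof -
      have "0 \<le> C * (1 / (R * R ^ DIM('a)))" using C R1 by simp
      moreover have "ennreal d * (ennreal a * ennreal P) = ennreal (d * (a * P))" if "0 \<le> a" "0 \<le> P" for a P
        using that d by (simp add: ennreal_mult)
      ultimately show ?thesis by simp
    qed
    also have "d * (16 * d\<^sup>2 * (C * (1 / (R * R ^ DIM('a))))) = 16 * d ^ 3 * C * (1 / (R * R ^ DIM('a)))"
      by (simp add: power2_eq_square power3_eq_cube)
    finally show ?thesis .
  qed
  show ?thesis
    by (rule exI[of _ "16 * d ^ 3 * C"], rule conjI, use C d in simp, rule exI[of _ "max R0 (3 / e)"], rule conjI)
      (use C est in auto)
qed

lemma sphere_average_bounded:
  fixes H :: "'a::euclidean_space \<Rightarrow> complex"
  shows "sphere_energy R H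
    \<le> ennreal ((LINT x|lborel. cmod (H x))\<^sup>2 * measure sphere_measure (space (sphere_measure :: 'a measure)))"
proof -
  have "sphere_energy R H
    \<le> (\<integral>\<^sup>+(\<omega>::'a). ennreal ((LINT x|lborel. cmod (H x))\<^sup>2) \<partial>sphere_measure)"
    by (intro nn_integral_mono ennreal_leI power_mono cmod_ft_le) auto
  also have "\<dots> = ennreal ((LINT x|lborel. cmod (H x))\<^sup>2) * ennreal (measure sphere_measure (space (sphere_measure :: 'a measure)))"
    by (simp only: nn_integral_const sphere.emeasure_eq_measure)
  finally show ?thesis by (simp add: ennreal_mult)
qed

theorem theorem1p2:
  fixes B :: "(real ^ 'n) set" and n :: "real ^ 'n \<Rightarrow> real ^ 'n"
    and N :: nat and U :: "nat \<Rightarrow> (real ^ 'n) set" and C0 :: real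
  assumes "CARD('n) \<ge> 2"
    and "open B" and "bounded B"
    and "C1_hypersurface (frontier B)"
    and "\<And>Q. Q \<in> frontier B \<Longrightarrow> unit_normal (frontier B) Q (n Q)"
    and "frontier B = (\<Union>j\<in>{1..N}. U j)"
    and "\<And>j. j \<in> {1..N} \<Longrightarrow> openin (top_of_set (frontier B)) (U j)"
    and "C0 > 0"
    and "\<And>j P Q. j \<in> {1..N} \<Longrightarrow> P \<in> U j \<Longrightarrow> Q \<in> U j \<Longrightarrow>
           \<bar>(P - Q) \<bullet> n Q\<bar> \<le> C0 * norm (P - Q) powr (3/2)"
  shows "\<exists>C>0. \<forall>R>0.
           (\<integral>\<^sup>+ \<omega>. ennreal ((cmod (fourier (indicator B) (R *\<^sub>R \<omega>)))\<^sup>2) \<partial>sphere_measure)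
             \<le> ennreal (C * R powr (- (real CARD('n) + 1)))"
proof -
  have loc: "\<exists>s>0. local_cutoff_decay (indicator B) c s" if c: "c \<in> frontier B" for c
  proof -
    obtain j where j: "j \<in> {1..N}" "c \<in> U j" using c assms(6) by blast
    show ?thesis
      by (rule frontier_local_cutoff_decay[OF assms(2-4) c assms(5) assms(7)[OF j(1)] j(2) less_imp_le[OF assms(8)] assms(9)[OF j(1)]])
  qed
  let ?H = "\<lambda>x. complex_of_real (indicator B x)"
  obtain C R0 where C: "C \<ge> 0" "R0 \<ge> 1" "\<And>R. R \<ge> R0 \<Longrightarrow>
      sphere_energy R ?H \<le> ennreal (C * (1 / (R * R ^ DIM(real ^ 'n))))"
    using indicator_decay[OF assms(2,3) loc] by blast
  \<comment> \<open>The trivial bound by the L1 norm, which handles R below R0.\<close>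
  define M where "M = (LINT x|lborel. cmod (?H x))\<^sup>2 * measure sphere_measure (space (sphere_measure :: (real ^ 'n) measure))"
  have M: "M \<ge> 0" by (simp add: M_def)
  define p where "p = real CARD('n) + 1"
  have four: "fourier (indicator B) \<xi> = ft ?H \<xi>" for \<xi>
  proof -
    have "(indicator B :: real ^ 'n \<Rightarrow> complex) = ?H" by (auto simp: indicator_def)
    moreover have "?H \<in> borel_measurable borel" using assms(2) by simp
    ultimately show ?thesis by (simp only: fourier_eq_ft)
  qed
  show ?thesis
  \<comment> \<open>C serves R \<ge> R0, M R0^p converts the trivial bound for R < R0 into the
    required power, and 1 makes the constant positive.\<close>
  proof (intro exI[of _ "C + M * R0 powr p + 1"] conjI allI impI)
    show "0 < C + M * R0 powr p + 1" using C M by (simp add: add_nonneg_pos)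
    fix R :: real assume R: "R > 0"
    show "(\<integral>\<^sup>+ \<omega>. ennreal ((cmod (fourier (indicator B) (R *\<^sub>R \<omega>)))\<^sup>2) \<partial>sphere_measure)
      \<le> ennreal ((C + M * R0 powr p + 1) * R powr (- (real CARD('n) + 1)))"
      unfolding four p_def[symmetric]
    proof (cases "R \<ge> R0")
      case True
      have "1 / (R * R ^ DIM(real ^ 'n)) = R powr (- p)"
      proof -
        have "R powr p = R ^ CARD('n) * R" using R by (simp add: p_def powr_add powr_realpow)
        then show ?thesis using R by (simp add: powr_minus divide_inverse mult.commute)
      qed
      then have "C * (1 / (R * R ^ DIM(real ^ 'n))) \<le> (C + M * R0 powr p + 1) * R powr (- p)"
        using M C by (simp only:) (intro mult_right_mono, auto)
      then show "sphere_energy R ?H \<le> ennreal ((C + M * R0 powr p + 1) * R powr (- p))"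
        using C(3)[OF True] order_trans ennreal_leI by blast
    next
      case False
      have "R powr p \<le> R0 powr p" using False R by (intro powr_mono2) (auto simp: p_def)
      then have "1 \<le> R0 powr p * R powr (- p)" using R by (simp add: powr_minus field_simps)
      then have "M * 1 \<le> M * (R0 powr p * R powr (- p))" using M by (rule mult_left_mono)
      also have "\<dots> \<le> (C + M * R0 powr p + 1) * R powr (- p)"
        unfolding mult.assoc[symmetric] using C by (intro mult_right_mono) auto
      finally have "M \<le> (C + M * R0 powr p + 1) * R powr (- p)" by simp
      then show "sphere_energy R ?H \<le> ennreal ((C + M * R0 powr p + 1) * R powr (- p))"
        using sphere_average_bounded[of ?H R, folded M_def] order_trans ennreal_leI by blast
    qed
  qed
qed

end
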